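(* Let $b$ be a connected graph over $(X,m)$ such that $\mathcal{L}(C_c(X))\subseteq\ell^2(X,m)$ and $\lambda_0>0$, where $\lambda_0=\lambda_0(L)$ is the bottom of the spectrum of the Laplacian of $b$ over $(X,m)$. Let $o\in X$ be such that the number of neighbors of $o$ is finite. Let $b_o$ over $(X_o,m_o)$ be a graph obtained from $b$ by removing $o$ and attaching rays and single vertices as described in the context, chosen so that for every $x\in N_o$, with $\mathbb{N}_x=\{x_1,x_2,\ldots\}$, we have $$\sum_{r=1}^\infty\left(\sum_{n=1}^{r}\frac{1}{b_o(x_n,x_{n+1})}\right)^2 m_o(x_{r+1})<\infty.$$ Then there exists a harmonic function (with respect to $b_o$) in $\ell^2(X_o,m_o)$ which is non-constant on an infinite connected component of $b_o$. In particular, the Laplacian $L_{o,c}$ associated to $b_o$ over $(X_o,m_o)$ does not satisfy the $\ell^2$-Liouville property and is not essentially self-adjoint.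
   Context: Graphs. $X$ is a countably infinite set, $m:X\to(0,\infty)$, and a graph over $(X,m)$ is a function $b:X\times X\to[0,\infty)$ with $b(x,x)=0$, $b(x,y)=b(y,x)$ and $\sum_{y}b(x,y)<\infty$ for all $x,y$. Write $x\sim y$ ($x,y$ are neighbors) if $b(x,y)>0$. The graph is connected if any two vertices are joined by a finite sequence of successive neighbors; connected components are the maximal connected subsets. $C(X)$ is the set of functions $X\to\mathbb{R}$, $C_c(X)$ the finitely supported ones, and $\ell^2(X,m)$ has inner product $\langle f,g\rangle=\sum_x f(x)g(x)m(x)$. Let $\mathcal{F}=\{f\in C(X):\sum_y b(x,y)|f(y)|<\infty\ \forall x\}$ and, for $f\in\mathcal{F}$, $\mathcal{L}f(x)=\frac1{m(x)}\sum_y b(x,y)(f(x)-f(y))$. A function $f\in\mathcal{F}$ is harmonic if $\mathcal{L}f=0$. All notions are used analogously for $b_o$ over $(X_o,m_o)$. Laplacian and Green's function. $\mathcal{Q}(f)=\frac12\sum_{x,y}b(x,y)(f(x)-f(y))^2$; $L$ is the self-adjoint operator on $\ell^2(X,m)$ associated with the closure of the restriction of $\mathcal{Q}$ to $C_c(X)$; $\lambda_0(L)=\inf_{0\ne\varphi\in C_c(X)}\mathcal{Q}(\varphi)/\|\varphi\|^2$. The heat kernel $p_t(x,y)$ is defined by $e^{-tL}f(x)=\sum_y p_t(x,y)f(y)m(y)$ for $f\in\ell^2(X,m)$, and the Green's function is $G(x,y)=\int_0^\infty p_t(x,y)\,dt$. If $\lambda_0(L)>0$, then $G(x,y)<\infty$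 for all $x,y$ (the graph is transient). Construction of $b_o$ over $(X_o,m_o)$. Let $g(x)=G(o,x)$, $N_o=\{x\in X: x\sim o,\ g(x)\ne g(o)\}$ and $N_c=\{x\in X:x\sim o,\ g(x)=g(o)\}$. For each $x\in N_o$ let $\mathbb{N}_x=\{x_1,x_2,x_3,\ldots\}$ be a copy of the natural numbers consisting of new vertices, and for each $x\in N_c$ let $x_c$ be a single new vertex (all new vertices distinct). Set $X_o=(X\setminus\{o\})\cup\bigcup_{x\in N_o}\mathbb{N}_x\cup\bigcup_{x\in N_c}\{x_c\}$. Let $b_o:X_o\times X_o\to[0,\infty)$ be symmetric with: $b_o(x,y)=b(x,y)$ for $x,y\in X\setminus\{o\}$; $b_o(x,x_1)>0$ for every $x\in N_o$; for $x\in N_o$ and $x_j,x_k\in\mathbb{N}_x$, $b_o(x_j,x_k)>0$ if and only if $|j-k|=1$; $b_o(x,x_c)>0$ for every $x\in N_c$; and $b_o=0$ for all other pairs. The measure $m_o:X_o\to(0,\infty)$ is any extension of $m|_{X\setminus\{o\}}$ to $X_o$. (The resulting graph need not be connected.) $L_{o,c}$ is the restriction of the formal Laplacian of $b_o$ over $(X_o,m_o)$ to $C_c(X_o)$, as an operator in $\ell^2(X_o,m_o)$. It satisfies the $\ell^2$-Liouville property if every harmonic function in $\ell^2(X_o,m_o)$ is constant. It is essentially self-adjoint if its closure is self-adjoint (equivalently, it has a unique self-adjoint extension). *)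

theory Defs
  imports "HOL-Analysis.Analysis"
begin

section \<open>Weighted graphs\<close>

text \<open>The vertex set is an explicit carrier \<open>V\<close>; values of \<open>b\<close> and \<open>m\<close> off the carrier are irrelevant.\<close>

definition weighted_graph :: "'v set \<Rightarrow> ('v \<Rightarrow> 'v \<Rightarrow> real) \<Rightarrow> ('v \<Rightarrow> real) \<Rightarrow> bool" where
  "weighted_graph V b m \<longleftrightarrow>
     countable V \<and> infinite V \<and> (\<forall>x\<in>V. m x > 0) \<and>
     (\<forall>x\<in>V. \<forall>y\<in>V. b x y \<ge> 0) \<and>
     (\<forall>x\<in>V. b x x = 0) \<and>
     (\<forall>x\<in>V. \<forall>y\<in>V. b x y = b y x) \<and>
     (\<forall>x\<in>V. b x summable_on V)"

definition neighbors :: "'v set \<Rightarrow> ('v \<Rightarrow> 'v \<Rightarrow> real) \<Rightarrow> 'v \<Rightarrow> 'v set" where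
  "neighbors V b x = {y \<in> V. b x y > 0}"

definition graph_connected :: "'v set \<Rightarrow> ('v \<Rightarrow> 'v \<Rightarrow> real) \<Rightarrow> bool" where
  "graph_connected W b \<longleftrightarrow>
     (\<forall>x\<in>W. \<forall>y\<in>W. (\<lambda>u v. u \<in> W \<and> v \<in> W \<and> b u v > 0)\<^sup>*\<^sup>* x y)"

definition graph_component :: "'v set \<Rightarrow> ('v \<Rightarrow> 'v \<Rightarrow> real) \<Rightarrow> 'v set \<Rightarrow> bool" where
  "graph_component V b W \<longleftrightarrow>
     W \<subseteq> V \<and> W \<noteq> {} \<and> graph_connected W b \<and>
     (\<forall>W'. W \<subseteq> W' \<and> W' \<subseteq> V \<and> graph_connected W' b \<longrightarrow> W' = W)"

section \<open>Function spaces and the formal Laplacian\<close>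

text \<open>Elements of \<open>C\<^sub>c(V)\<close> and \<open>\<ell>\<^sup>2(V,m)\<close> are represented by functions that vanish off \<open>V\<close>,
  so that equality in these spaces is equality of functions.\<close>

definition fin_supp :: "'v set \<Rightarrow> ('v \<Rightarrow> real) set" where
  "fin_supp V = {f. finite {x. f x \<noteq> 0} \<and> {x. f x \<noteq> 0} \<subseteq> V}"

definition ell2 :: "'v set \<Rightarrow> ('v \<Rightarrow> real) \<Rightarrow> ('v \<Rightarrow> real) set" where
  "ell2 V m = {f. (\<forall>x. x \<notin> V \<longrightarrow> f x = 0) \<and> (\<lambda>x. (f x)\<^sup>2 * m x) summable_on V}"

definition ell2_inner :: "'v set \<Rightarrow> ('v \<Rightarrow> real) \<Rightarrow> ('v \<Rightarrow> real) \<Rightarrow> ('v \<Rightarrow> real) \<Rightarrow> real" where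
  "ell2_inner V m f h = (\<Sum>\<^sub>\<infinity>x\<in>V. f x * h x * m x)"

definition ell2_norm :: "'v set \<Rightarrow> ('v \<Rightarrow> real) \<Rightarrow> ('v \<Rightarrow> real) \<Rightarrow> real" where
  "ell2_norm V m f = sqrt (ell2_inner V m f f)"

definition ell2_tendsto ::
    "'v set \<Rightarrow> ('v \<Rightarrow> real) \<Rightarrow> ('i \<Rightarrow> 'v \<Rightarrow> real) \<Rightarrow> ('v \<Rightarrow> real) \<Rightarrow> 'i filter \<Rightarrow> bool" where
  "ell2_tendsto V m \<phi> f F \<longleftrightarrow> f \<in> ell2 V m \<and> (\<forall>\<^sub>F i in F. \<phi> i \<in> ell2 V m) \<and>
     ((\<lambda>i. ell2_norm V m (\<lambda>x. \<phi> i x - f x)) \<longlongrightarrow> 0) F"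

definition formal_domain :: "'v set \<Rightarrow> ('v \<Rightarrow> 'v \<Rightarrow> real) \<Rightarrow> ('v \<Rightarrow> real) set" where
  "formal_domain V b = {f. \<forall>x\<in>V. (\<lambda>y. b x y * \<bar>f y\<bar>) summable_on V}"

definition formal_laplacian ::
    "'v set \<Rightarrow> ('v \<Rightarrow> 'v \<Rightarrow> real) \<Rightarrow> ('v \<Rightarrow> real) \<Rightarrow> ('v \<Rightarrow> real) \<Rightarrow> 'v \<Rightarrow> real" where
  "formal_laplacian V b m f x =
     (if x \<in> V then (1 / m x) * (\<Sum>\<^sub>\<infinity>y\<in>V. b x y * (f x - f y)) else 0)"

definition harmonic :: "'v set \<Rightarrow> ('v \<Rightarrow> 'v \<Rightarrow> real) \<Rightarrow> ('v \<Rightarrow> real) \<Rightarrow> ('v \<Rightarrow> real) \<Rightarrow> bool" where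
  "harmonic V b m f \<longleftrightarrow> f \<in> formal_domain V b \<and> (\<forall>x\<in>V. formal_laplacian V b m f x = 0)"

definition ell2_Liouville :: "'v set \<Rightarrow> ('v \<Rightarrow> 'v \<Rightarrow> real) \<Rightarrow> ('v \<Rightarrow> real) \<Rightarrow> bool" where
  "ell2_Liouville V b m \<longleftrightarrow>
     (\<forall>f\<in>ell2 V m. harmonic V b m f \<longrightarrow> (\<exists>c. \<forall>x\<in>V. f x = c))"

section \<open>Unbounded operators in \<open>\<ell>\<^sup>2(V,m)\<close>\<close>

text \<open>An operator is identified with its graph, a set of pairs (argument, value).\<close>

type_synonym 'v operator = "(('v \<Rightarrow> real) \<times> ('v \<Rightarrow> real)) set"

definition operator_closure :: "'v set \<Rightarrow> ('v \<Rightarrow> real) \<Rightarrow> 'v operator \<Rightarrow> 'v operator" where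
  "operator_closure V m T = {(f, u).
     \<exists>\<phi> \<psi>. (\<forall>n. (\<phi> n, \<psi> n) \<in> T) \<and>
        ell2_tendsto V m \<phi> f sequentially \<and> ell2_tendsto V m \<psi> u sequentially}"

definition operator_adjoint :: "'v set \<Rightarrow> ('v \<Rightarrow> real) \<Rightarrow> 'v operator \<Rightarrow> 'v operator" where
  "operator_adjoint V m T = {(f, u). f \<in> ell2 V m \<and> u \<in> ell2 V m \<and>
     (\<forall>(\<phi>, \<psi>)\<in>T. ell2_inner V m \<psi> f = ell2_inner V m \<phi> u)}"

definition densely_defined :: "'v set \<Rightarrow> ('v \<Rightarrow> real) \<Rightarrow> 'v operator \<Rightarrow> bool" where
  "densely_defined V m T \<longleftrightarrow>
     (\<forall>f\<in>ell2 V m. \<exists>\<phi>. (\<forall>n. \<phi> n \<in> Domain T) \<and> ell2_tendsto V m \<phi> f sequentially)"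

definition self_adjoint :: "'v set \<Rightarrow> ('v \<Rightarrow> real) \<Rightarrow> 'v operator \<Rightarrow> bool" where
  "self_adjoint V m T \<longleftrightarrow> densely_defined V m T \<and> operator_adjoint V m T = T"

definition essentially_self_adjoint :: "'v set \<Rightarrow> ('v \<Rightarrow> real) \<Rightarrow> 'v operator \<Rightarrow> bool" where
  "essentially_self_adjoint V m T \<longleftrightarrow> self_adjoint V m (operator_closure V m T)"

definition minimal_laplacian ::
    "'v set \<Rightarrow> ('v \<Rightarrow> 'v \<Rightarrow> real) \<Rightarrow> ('v \<Rightarrow> real) \<Rightarrow> 'v operator" where
  "minimal_laplacian V b m = {(\<phi>, formal_laplacian V b m \<phi>) | \<phi>. \<phi> \<in> fin_supp V}"

section \<open>The energy form, its closure and the Laplacian\<close>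

text \<open>The form is given as a bilinear form, with \<open>\<Q>(f) = energy V b f f\<close>.
  Below it is evaluated on finitely supported functions only, where the double sum converges
  absolutely.\<close>

definition energy ::
    "'v set \<Rightarrow> ('v \<Rightarrow> 'v \<Rightarrow> real) \<Rightarrow> ('v \<Rightarrow> real) \<Rightarrow> ('v \<Rightarrow> real) \<Rightarrow> real" where
  "energy V b f h = (1/2) * (\<Sum>\<^sub>\<infinity>(x, y)\<in>V \<times> V. b x y * ((f x - f y) * (h x - h y)))"

definition form_approx ::
    "'v set \<Rightarrow> ('v \<Rightarrow> 'v \<Rightarrow> real) \<Rightarrow> ('v \<Rightarrow> real) \<Rightarrow> (nat \<Rightarrow> 'v \<Rightarrow> real) \<Rightarrow> ('v \<Rightarrow> real) \<Rightarrow> bool" where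
  "form_approx V b m \<phi> f \<longleftrightarrow>
     (\<forall>n. \<phi> n \<in> fin_supp V) \<and> ell2_tendsto V m \<phi> f sequentially \<and>
     (\<forall>\<epsilon>>0. \<exists>N. \<forall>i\<ge>N. \<forall>j\<ge>N. energy V b (\<lambda>x. \<phi> i x - \<phi> j x) (\<lambda>x. \<phi> i x - \<phi> j x) < \<epsilon>)"

definition closed_form_domain ::
    "'v set \<Rightarrow> ('v \<Rightarrow> 'v \<Rightarrow> real) \<Rightarrow> ('v \<Rightarrow> real) \<Rightarrow> ('v \<Rightarrow> real) set" where
  "closed_form_domain V b m = {f. \<exists>\<phi>. form_approx V b m \<phi> f}"

text \<open>The restriction of the form to \<open>C\<^sub>c(V)\<close> is closable, so the following limit exists and does
  not depend on the approximating sequences.\<close>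

definition closed_form ::
    "'v set \<Rightarrow> ('v \<Rightarrow> 'v \<Rightarrow> real) \<Rightarrow> ('v \<Rightarrow> real) \<Rightarrow> ('v \<Rightarrow> real) \<Rightarrow> ('v \<Rightarrow> real) \<Rightarrow> real" where
  "closed_form V b m f h =
     (THE c. \<forall>\<phi> \<psi>. form_approx V b m \<phi> f \<longrightarrow> form_approx V b m \<psi> h \<longrightarrow>
                (\<lambda>n. energy V b (\<phi> n) (\<psi> n)) \<longlonglongrightarrow> c)"

text \<open>The operator associated with a closed form: \<open>f\<close> is in the domain with value \<open>u\<close> iff
  \<open>u\<close> represents the functional \<open>h \<mapsto> \<Q>(f,h)\<close> on the form domain.\<close>

definition laplacian ::
    "'v set \<Rightarrow> ('v \<Rightarrow> 'v \<Rightarrow> real) \<Rightarrow> ('v \<Rightarrow> real) \<Rightarrow> 'v operator" where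
  "laplacian V b m = {(f, u). f \<in> closed_form_domain V b m \<and> u \<in> ell2 V m \<and>
     (\<forall>h\<in>closed_form_domain V b m. closed_form V b m f h = ell2_inner V m u h)}"

definition spectral_bottom ::
    "'v set \<Rightarrow> ('v \<Rightarrow> 'v \<Rightarrow> real) \<Rightarrow> ('v \<Rightarrow> real) \<Rightarrow> real" where
  "spectral_bottom V b m =
     (INF \<phi>\<in>fin_supp V - {\<lambda>_. 0}. energy V b \<phi> \<phi> / (ell2_norm V m \<phi>)\<^sup>2)"

section \<open>Heat semigroup, heat kernel and Green's function\<close>

definition C0_semigroup ::
    "'v set \<Rightarrow> ('v \<Rightarrow> real) \<Rightarrow> (real \<Rightarrow> ('v \<Rightarrow> real) \<Rightarrow> 'v \<Rightarrow> real) \<Rightarrow> bool" where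
  "C0_semigroup V m S \<longleftrightarrow>
     (\<forall>t\<ge>0. \<forall>f\<in>ell2 V m. S t f \<in> ell2 V m) \<and>
     (\<forall>t\<ge>0. \<forall>f\<in>ell2 V m. \<forall>h\<in>ell2 V m. \<forall>\<alpha> \<beta>.
        S t (\<lambda>x. \<alpha> * f x + \<beta> * h x) = (\<lambda>x. \<alpha> * S t f x + \<beta> * S t h x)) \<and>
     (\<forall>t\<ge>0. \<exists>C. \<forall>f\<in>ell2 V m. ell2_norm V m (S t f) \<le> C * ell2_norm V m f) \<and>
     (\<forall>f\<in>ell2 V m. S 0 f = f) \<and>
     (\<forall>s\<ge>0. \<forall>t\<ge>0. \<forall>f\<in>ell2 V m. S (s + t) f = S s (S t f)) \<and>
     (\<forall>f\<in>ell2 V m. ell2_tendsto V m (\<lambda>t. S t f) f (at_right 0))"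

definition semigroup_generator ::
    "'v set \<Rightarrow> ('v \<Rightarrow> real) \<Rightarrow> (real \<Rightarrow> ('v \<Rightarrow> real) \<Rightarrow> 'v \<Rightarrow> real) \<Rightarrow> 'v operator" where
  "semigroup_generator V m S = {(f, u). f \<in> ell2 V m \<and>
     ell2_tendsto V m (\<lambda>t x. (S t f x - f x) / t) u (at_right 0)}"

text \<open>\<open>exp_semigroup V m A t\<close> is \<open>e\<^bsup>-tA\<^esup>\<close>, the strongly continuous semigroup with generator \<open>-A\<close>.
  For self-adjoint \<open>A\<close> bounded below it exists, and it is determined uniquely on \<open>\<ell>\<^sup>2(V,m)\<close> for
  \<open>t \<ge> 0\<close>; the choice operator only fixes irrelevant values elsewhere.\<close>

definition exp_semigroup ::
    "'v set \<Rightarrow> ('v \<Rightarrow> real) \<Rightarrow> 'v operator \<Rightarrow> real \<Rightarrow> ('v \<Rightarrow> real) \<Rightarrow> 'v \<Rightarrow> real" where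
  "exp_semigroup V m A =
     (SOME S. C0_semigroup V m S \<and>
        semigroup_generator V m S = {(f, \<lambda>x. - u x) | f u. (f, u) \<in> A})"

definition heat_kernel ::
    "'v set \<Rightarrow> ('v \<Rightarrow> 'v \<Rightarrow> real) \<Rightarrow> ('v \<Rightarrow> real) \<Rightarrow> real \<Rightarrow> 'v \<Rightarrow> 'v \<Rightarrow> real" where
  "heat_kernel V b m =
     (SOME p. \<forall>t\<ge>0. \<forall>f\<in>ell2 V m. \<forall>x\<in>V.
        ((\<lambda>y. p t x y * f y * m y) has_sum exp_semigroup V m (laplacian V b m) t f x) V)"

text \<open>The integral converges absolutely if \<open>spectral_bottom V b m > 0\<close>, which is the only case in
  which \<open>green\<close> is used.\<close>

definition green ::
    "'v set \<Rightarrow> ('v \<Rightarrow> 'v \<Rightarrow> real) \<Rightarrow> ('v \<Rightarrow> real) \<Rightarrow> 'v \<Rightarrow> 'v \<Rightarrow> real" where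
  "green V b m x y = (LINT t:{0..}|lborel. heat_kernel V b m t x y)"

section \<open>Replacing a vertex by rays and single vertices\<close>

text \<open>\<open>Ray x n\<close> with \<open>n \<ge> 1\<close> is the vertex \<open>x\<^sub>n\<close> of the ray attached at \<open>x\<close>, and \<open>Cap x\<close> is the single
  vertex \<open>x\<^sub>c\<close>; \<open>Ray x 0\<close> is not used.\<close>

datatype 'a vertex = Old 'a | Ray 'a nat | Cap 'a

definition ray_neighbors ::
    "'a set \<Rightarrow> ('a \<Rightarrow> 'a \<Rightarrow> real) \<Rightarrow> ('a \<Rightarrow> real) \<Rightarrow> 'a \<Rightarrow> 'a set" where
  "ray_neighbors X b m v =
     {x \<in> neighbors X b v. green X b m v x \<noteq> green X b m v v}"

definition cap_neighbors ::
    "'a set \<Rightarrow> ('a \<Rightarrow> 'a \<Rightarrow> real) \<Rightarrow> ('a \<Rightarrow> real) \<Rightarrow> 'a \<Rightarrow> 'a set" where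
  "cap_neighbors X b m v =
     {x \<in> neighbors X b v. green X b m v x = green X b m v v}"

definition modified_vertices ::
    "'a set \<Rightarrow> ('a \<Rightarrow> 'a \<Rightarrow> real) \<Rightarrow> ('a \<Rightarrow> real) \<Rightarrow> 'a \<Rightarrow> 'a vertex set" where
  "modified_vertices X b m v =
     Old ` (X - {v}) \<union>
     {Ray x n | x n. x \<in> ray_neighbors X b m v \<and> n \<ge> 1} \<union>
     Cap ` cap_neighbors X b m v"

definition modified_graph ::
    "'a set \<Rightarrow> ('a \<Rightarrow> 'a \<Rightarrow> real) \<Rightarrow> ('a \<Rightarrow> real) \<Rightarrow> 'a \<Rightarrow>
     ('a vertex \<Rightarrow> 'a vertex \<Rightarrow> real) \<Rightarrow> ('a vertex \<Rightarrow> real) \<Rightarrow> bool" where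
  "modified_graph X b m v b' m' \<longleftrightarrow>
     (let N = ray_neighbors X b m v; K = cap_neighbors X b m v; Y = modified_vertices X b m v in
       (\<forall>p\<in>Y. \<forall>q\<in>Y. b' p q \<ge> 0 \<and> b' p q = b' q p) \<and>
       (\<forall>x\<in>X - {v}. \<forall>y\<in>X - {v}. b' (Old x) (Old y) = b x y) \<and>
       (\<forall>x\<in>N. b' (Old x) (Ray x 1) > 0) \<and>
       (\<forall>x\<in>N. \<forall>j\<ge>1. \<forall>k\<ge>1. b' (Ray x j) (Ray x k) > 0 \<longleftrightarrow> \<bar>int j - int k\<bar> = 1) \<and>
       (\<forall>x\<in>K. b' (Old x) (Cap x) > 0) \<and>
       \<comment> \<open>all remaining pairs, up to symmetry\<close>
       (\<forall>y\<in>X - {v}. \<forall>x\<in>N. \<forall>j\<ge>1. \<not> (y = x \<and> j = 1) \<longrightarrow> b' (Old y) (Ray x j) = 0) \<and>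
       (\<forall>y\<in>X - {v}. \<forall>x\<in>K. y \<noteq> x \<longrightarrow> b' (Old y) (Cap x) = 0) \<and>
       (\<forall>x\<in>N. \<forall>y\<in>N. \<forall>j\<ge>1. \<forall>k\<ge>1. x \<noteq> y \<longrightarrow> b' (Ray x j) (Ray y k) = 0) \<and>
       (\<forall>x\<in>N. \<forall>j\<ge>1. \<forall>y\<in>K. b' (Ray x j) (Cap y) = 0) \<and>
       (\<forall>x\<in>K. \<forall>y\<in>K. b' (Cap x) (Cap y) = 0) \<and>
       (\<forall>x\<in>X - {v}. m' (Old x) = m x) \<and>
       (\<forall>p\<in>Y. m' p > 0))"

end

theory Submission
  imports Defs
begin

text \<open>The Green's function \<open>g = G(v, \<cdot>)\<close> lies in \<open>\<ell>\<^sup>2(X, m)\<close> and satisfies \<open>\<L> g = 0\<close> off \<open>v\<close> and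
  \<open>\<L> g v = 1 / m v\<close>. Hence some neighbour \<open>x\<close> of \<open>v\<close> has \<open>g x \<noteq> g v\<close>. On the modified graph, \<open>g\<close> extends
  to a harmonic function: it is constant towards the single vertices, and along the ray at \<open>x\<close> its
  increments are those for which the flux \<open>b x v * (g x - g v)\<close>, formerly entering \<open>v\<close>, passes
  through the ray unchanged. The summability condition on the rays makes the extension square-summable.

  The properties of \<open>g\<close> come from \<open>g = A\<^sup>-\<^sup>1 \<delta>\<^sub>v / m v\<close>, where \<open>A\<close> is the Friedrichs extension of the
  Laplacian on finitely supported functions. This identity is obtained by integrating the heat
  semigroup over time; the spectral gap gives its exponential decay. Since the heat semigroup is given
  by a choice operator, its existence is needed as well, which is the Hille-Yosida theorem. Functional
  analysis is carried out in a type of square-summable sequences, to which \<open>\<ell>\<^sup>2(X, m)\<close> is isometric.\<close>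

section \<open>The Banach algebra of bounded operators\<close>

text \<open>The difficulty sits in the definition of \<open>green\<close>: closed form, semigroup
  and heat kernel are given by description or choice operators and are accessible only through their
  defining properties. The Yosida construction makes the choice of the semigroup meaningful. Decay
  and the time integral are then proved for an arbitrary strongly continuous semigroup with
  generator \<open>- A\<close>; as such a semigroup is not known in advance to be contractive, its
  local boundedness comes from the uniform boundedness principle. The spectral gap makes
  \<open>A\<close> itself invertible, so that \<open>g\<close> is square-summable and not merely
  finite. The rays have to be infinite because of the equation at their vertices. A single vertex
  attached by one edge is forced to take the value of its neighbor, so it carries no flux and can
  only replace \<open>v\<close> where \<open>g x = g v\<close>. A nonzero flux must be handed on
  from vertex to vertex without end.\<close>

typedef (overloaded) 'a endo = "UNIV :: ('a::real_normed_vector \<Rightarrow>\<^sub>L 'a) set"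
  morphisms blinfun_of_endo endo_of_blinfun ..

setup_lifting type_definition_endo

lift_definition app :: "'a::real_normed_vector endo \<Rightarrow> 'a \<Rightarrow> 'a" is blinfun_apply .

lift_definition Endo :: "('a::real_normed_vector \<Rightarrow> 'a) \<Rightarrow> 'a endo" is Blinfun .

instantiation endo :: (real_normed_vector) real_normed_vector
begin

lift_definition zero_endo :: "'a endo" is 0 .
lift_definition plus_endo :: "'a endo \<Rightarrow> 'a endo \<Rightarrow> 'a endo" is "(+)" .
lift_definition minus_endo :: "'a endo \<Rightarrow> 'a endo \<Rightarrow> 'a endo" is "(-)" .
lift_definition uminus_endo :: "'a endo \<Rightarrow> 'a endo" is uminus .
lift_definition scaleR_endo :: "real \<Rightarrow> 'a endo \<Rightarrow> 'a endo" is scaleR .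
lift_definition norm_endo :: "'a endo \<Rightarrow> real" is norm .
lift_definition sgn_endo :: "'a endo \<Rightarrow> 'a endo" is sgn .
lift_definition dist_endo :: "'a endo \<Rightarrow> 'a endo \<Rightarrow> real" is dist .

definition uniformity_endo :: "('a endo \<times> 'a endo) filter" where
  "uniformity_endo = (INF e\<in>{0<..}. principal {(x, y). dist x y < e})"

definition open_endo :: "'a endo set \<Rightarrow> bool" where
  "open_endo U = (\<forall>x\<in>U. \<forall>\<^sub>F (x', y) in uniformity. x' = x \<longrightarrow> y \<in> U)"

instance
  by standard (transfer, simp add: algebra_simps dist_norm sgn_div_norm norm_triangle_ineq
      uniformity_endo_def open_endo_def; fail | simp add: uniformity_endo_def open_endo_def)+

end

instance endo :: (banach) banach
proof
  fix X :: "nat \<Rightarrow> 'a endo" assume "Cauchy X"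
  then have "Cauchy (\<lambda>n. blinfun_of_endo (X n))"
    unfolding Cauchy_def by transfer
  then obtain l where "(\<lambda>n. blinfun_of_endo (X n)) \<longlonglongrightarrow> l"
    using convergent_def Cauchy_convergent by blast
  then have "X \<longlonglongrightarrow> endo_of_blinfun l"
    unfolding lim_sequentially by (simp add: dist_endo.rep_eq endo_of_blinfun_inverse)
  then show "convergent X" by (auto simp: convergent_def)
qed

text \<open>Composition as multiplication gives access to \<open>exp\<close> on operators. The class
  demands \<open>0 \<noteq> 1\<close>, which fails on the zero space; \<open>perfect_space\<close>
  excludes it.\<close>

instantiation endo :: ("{real_normed_vector, perfect_space}") real_normed_algebra_1
begin

lift_definition one_endo :: "'a endo" is id_blinfun .
lift_definition times_endo :: "'a endo \<Rightarrow> 'a endo \<Rightarrow> 'a endo" is "(o\<^sub>L)" .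

instance
proof
  show "(0::'a endo) \<noteq> 1"
  proof
    assume "(0::'a endo) = 1"
    then have "norm (0::'a \<Rightarrow>\<^sub>L 'a) = norm (id_blinfun::'a \<Rightarrow>\<^sub>L 'a)"
      by transfer simp
    then show False by simp
  qed
qed (transfer; auto intro!: blinfun_eqI norm_blinfun_compose simp: blinfun.bilinear_simps; fail)+

end

lemma bounded_bilinear_app [bounded_bilinear]: "bounded_bilinear app"
proof
  fix a b :: "'a endo" and r x y
  show "app (a + b) x = app a x + app b x" by transfer (simp add: blinfun.bilinear_simps)
  show "app a (x + y) = app a x + app a y" by transfer (simp add: blinfun.bilinear_simps)
  show "app (r *\<^sub>R a) x = r *\<^sub>R app a x" by transfer (simp add: blinfun.bilinear_simps)
  show "app a (r *\<^sub>R x) = r *\<^sub>R app a x" by transfer (simp add: blinfun.bilinear_simps)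
  have "norm (app f u) \<le> norm f * norm u * 1" for f :: "'a endo" and u
    by transfer (simp add: norm_blinfun)
  then show "\<exists>K. \<forall>(a::'a endo) b. norm (app a b) \<le> norm a * norm b * K" by blast
qed

interpretation app: bounded_bilinear app by (rule bounded_bilinear_app)

lemma app_one [simp]: "app 1 x = x" by transfer simp
lemma app_times [simp]: "app (a * b) x = app a (app b x)" by transfer simp

lemma app_Endo: "bounded_linear f \<Longrightarrow> app (Endo f) = f"
  by transfer (rule bounded_linear_Blinfun_apply)

lemma norm_app: "norm (app a x) \<le> norm a * norm x"
  by transfer (rule norm_blinfun)

lemma norm_endo_bound: "0 \<le> K \<Longrightarrow> (\<And>x. norm (app a x) \<le> K * norm x) \<Longrightarrow> norm a \<le> K"
  by transfer (rule norm_blinfun_bound)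

lemma endo_eqI: "(\<And>x. app a x = app b x) \<Longrightarrow> a = b"
  by transfer (rule blinfun_eqI)

section \<open>Semigroups\<close>

definition strongly_continuous_semigroup :: "(real \<Rightarrow> 'a::real_normed_vector \<Rightarrow> 'a) \<Rightarrow> bool" where
  "strongly_continuous_semigroup S \<longleftrightarrow>
     (\<forall>t\<ge>0. bounded_linear (S t)) \<and> (\<forall>f. S 0 f = f) \<and>
     (\<forall>s\<ge>0. \<forall>t\<ge>0. \<forall>f. S (s + t) f = S s (S t f)) \<and>
     (\<forall>f. ((\<lambda>t. S t f) \<longlongrightarrow> f) (at_right 0))"

definition generator :: "(real \<Rightarrow> 'a::real_normed_vector \<Rightarrow> 'a) \<Rightarrow> ('a \<times> 'a) set" where
  "generator S = {(f, u). ((\<lambda>t. (S t f - f) /\<^sub>R t) \<longlongrightarrow> u) (at_right 0)}"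

text \<open>All quantitative estimates on the regularised semigroups apply this mean value
  inequality to a path of vectors chosen for the purpose.\<close>

lemma vector_derivative_growth:
  fixes \<phi> :: "real \<Rightarrow> 'a::real_normed_vector"
  assumes "0 \<le> t" and der: "\<And>s. (\<phi> has_vector_derivative \<phi>' s) (at s)"
    and bound: "\<And>s. 0 \<le> s \<Longrightarrow> s \<le> t \<Longrightarrow> norm (\<phi>' s) \<le> K"
  shows "norm (\<phi> t - \<phi> 0) \<le> t * K"
proof -
  have "norm (\<phi> t - \<phi> 0) \<le> K * norm (t - 0)"
  proof (rule differentiable_bound[where S="{0..t}" and f'="\<lambda>s h. h *\<^sub>R \<phi>' s"])
    fix s assume "s \<in> {0..t}"
    show "(\<phi> has_derivative (\<lambda>h. h *\<^sub>R \<phi>' s)) (at s within {0..t})"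
      using der[of s] has_derivative_at_withinI has_vector_derivative_def by blast
    show "onorm (\<lambda>h. h *\<^sub>R \<phi>' s) \<le> K"
      using bound[of s] \<open>s \<in> {0..t}\<close>
      by (intro onorm_le) (simp add: mult_left_mono mult.commute[of K])
  qed (use assms in auto)
  then show ?thesis using assms by (simp add: mult.commute)
qed

text \<open>Operators are identified with their graphs.\<close>

locale m_accretive =
  fixes A :: "('a::{real_inner, banach, perfect_space} \<times> 'a) set"
  assumes subspace_A: "subspace A"
    and accretive: "(f, u) \<in> A \<Longrightarrow> 0 \<le> u \<bullet> f"
    and range_full: "0 < l \<Longrightarrow> \<exists>f. (f, h - l *\<^sub>R f) \<in> A"
    and dense: "closure (fst ` A) = UNIV"
begin

section \<open>Resolvents and Yosida regularisation\<close>

lemma A_add: "(f, u) \<in> A \<Longrightarrow> (g, w) \<in> A \<Longrightarrow> (f + g, u + w) \<in> A"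
  using subspace_add[OF subspace_A, of "(f,u)" "(g,w)"] by simp

lemma A_diff: "(f, u) \<in> A \<Longrightarrow> (g, w) \<in> A \<Longrightarrow> (f - g, u - w) \<in> A"
  using subspace_diff[OF subspace_A, of "(f,u)" "(g,w)"] by simp

lemma A_scale: "(f, u) \<in> A \<Longrightarrow> (r *\<^sub>R f, r *\<^sub>R u) \<in> A"
  using subspace_scale[OF subspace_A, of "(f,u)" r] by simp

text \<open>The hypothesis encodes \<open>A f + l f = h\<close>. Pairing with \<open>f\<close> and
  dropping the nonnegative term from \<open>A\<close> leaves
  \<open>l * (f \<bullet> f) \<le> h \<bullet> f\<close>.\<close>

lemma resolvent_bound:
  assumes "(f, h - l *\<^sub>R f) \<in> A"
  shows "l * norm f \<le> norm h"
proof (cases "f = 0")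
  case False
  have "l * norm f * norm f \<le> norm h * norm f"
    using accretive[OF assms] norm_cauchy_schwarz[of h f]
    by (simp add: inner_diff_left dot_square_norm power2_eq_square algebra_simps)
  then show ?thesis using False by simp
qed simp

lemma resolvent_unique:
  assumes "0 < l" "(f, h - l *\<^sub>R f) \<in> A" "(g, h - l *\<^sub>R g) \<in> A"
  shows "f = g"
proof -
  have "(f - g, 0 - l *\<^sub>R (f - g)) \<in> A"
    using A_diff[OF assms(2,3)] by (simp add: algebra_simps)
  from resolvent_bound[OF this] assms(1) show ?thesis by (simp add: mult_le_0_iff)
qed

definition resolvent :: "real \<Rightarrow> 'a \<Rightarrow> 'a" where
  "resolvent l h = (SOME f. (f, h - l *\<^sub>R f) \<in> A)"

lemma resolvent: "0 < l \<Longrightarrow> (resolvent l h, h - l *\<^sub>R resolvent l h) \<in> A"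
  unfolding resolvent_def by (rule someI_ex) (rule range_full)

lemma resolvent_eqI: "0 < l \<Longrightarrow> (f, h - l *\<^sub>R f) \<in> A \<Longrightarrow> resolvent l h = f"
  using resolvent resolvent_unique by blast

text \<open>The Yosida regularisation: \<open>J n = n (n + A)\<^sup>-\<^sup>1\<close> and \<open>B n = A (J n)\<close>.\<close>

definition J :: "real \<Rightarrow> 'a endo" where "J n = Endo (\<lambda>h. n *\<^sub>R resolvent n h)"

definition B :: "real \<Rightarrow> 'a endo" where "B n = n *\<^sub>R (1 - J n)"

lemma bounded_linear_resolvent:
  assumes n: "0 < n"
  shows "bounded_linear (\<lambda>h. n *\<^sub>R resolvent n h)"
proof (rule bounded_linear_intro[where K=1])
  fix x y r
  have "(resolvent n x + resolvent n y, (x + y) - n *\<^sub>R (resolvent n x + resolvent n y)) \<in> A"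
    using A_add[OF resolvent[OF n, of x] resolvent[OF n, of y]] by (simp add: algebra_simps)
  from resolvent_eqI[OF n this]
  show "n *\<^sub>R resolvent n (x + y) = n *\<^sub>R resolvent n x + n *\<^sub>R resolvent n y"
    by (simp add: scaleR_add_right)
  have "(r *\<^sub>R resolvent n x, (r *\<^sub>R x) - n *\<^sub>R (r *\<^sub>R resolvent n x)) \<in> A"
    using A_scale[OF resolvent[OF n, of x], of r] by (simp add: algebra_simps)
  from resolvent_eqI[OF n this]
  show "n *\<^sub>R resolvent n (r *\<^sub>R x) = r *\<^sub>R (n *\<^sub>R resolvent n x)"
    by simp
  show "norm (n *\<^sub>R resolvent n x) \<le> norm x * 1"
    using resolvent_bound[OF resolvent[OF n]] n by simp
qed

lemma app_J: "0 < n \<Longrightarrow> app (J n) h = n *\<^sub>R resolvent n h"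
  unfolding J_def by (simp add: app_Endo bounded_linear_resolvent)

lemma norm_J: "0 < n \<Longrightarrow> norm (J n) \<le> 1"
  by (rule norm_endo_bound) (auto simp: app_J resolvent_bound[OF resolvent])

lemma norm_app_J: "0 < n \<Longrightarrow> norm (app (J n) h) \<le> norm h"
  by (auto simp: app_J resolvent_bound[OF resolvent])

lemma app_B: "app (B n) h = n *\<^sub>R (h - app (J n) h)"
  by (simp add: B_def app.scaleR_left app.diff_left)

lemma J_B_in_A:
  assumes "0 < n" shows "(app (J n) h, app (B n) h) \<in> A"
  using A_scale[OF resolvent[OF assms, of h], of n] assms by (simp add: app_B app_J)

text \<open>The regularisation commutes with \<open>A\<close>. Hence on the domain
  \<open>B n f\<close> is bounded by \<open>norm u\<close> uniformly in \<open>n\<close>, and it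
  tends to \<open>u\<close> once \<open>J n\<close> is known to tend strongly to the
  identity.\<close>

lemma B_eq_J:
  assumes n: "0 < n" and fu: "(f, u) \<in> A"
  shows "app (B n) f = app (J n) u"
proof -
  have "(f - app (J n) f, u - n *\<^sub>R (f - app (J n) f)) \<in> A"
    using A_diff[OF fu J_B_in_A[OF n, of f]] by (simp add: app_B)
  from resolvent_eqI[OF n this] show ?thesis
    by (simp add: app_B app_J n)
qed

text \<open>Commutation with \<open>A\<close> shows that \<open>J n\<close> maps the solution of the
  resolvent equation at \<open>m\<close> with datum \<open>h\<close> to the one with datum
  \<open>J n h\<close>, and solutions are unique.\<close>

lemma J_commute:
  assumes n: "0 < n" and m: "0 < m"
  shows "J n * J m = J m * J n"
proof (rule endo_eqI)
  fix h
  have "app (B n) (resolvent m h) = app (J n) (h - m *\<^sub>R resolvent m h)"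
    by (rule B_eq_J[OF n resolvent[OF m]])
  then have "(app (J n) (resolvent m h), app (J n) h - m *\<^sub>R app (J n) (resolvent m h)) \<in> A"
    using J_B_in_A[OF n, of "resolvent m h"] by (simp add: app.diff_right app.scaleR_right)
  from resolvent_eqI[OF m this]
  show "app (J n * J m) h = app (J m * J n) h"
    by (simp add: app_J[OF m] app.scaleR_right)
qed

lemma B_commute: "0 < n \<Longrightarrow> 0 < m \<Longrightarrow> B n * B m = B m * B n"
  by (simp add: B_def algebra_simps J_commute)

text \<open>For \<open>f\<close> in the domain, \<open>f - J n f = B n f / n\<close> has norm at
  most \<open>norm w / n\<close>. Since the \<open>J n\<close> are contractions, density carries the
  convergence over to all vectors.\<close>

lemma J_tendsto: "(\<lambda>n. app (J (real (Suc n))) u) \<longlonglongrightarrow> u"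
proof (rule LIMSEQ_I)
  fix e :: real assume e: "0 < e"
  obtain f w where fw: "(f, w) \<in> A" and f: "norm (u - f) < e / 3"
    using dense e closure_approachable[of u "fst ` A"]
    by (metis (no_types, lifting) UNIV_I dist_norm divide_pos_pos imageE norm_minus_commute
        prod.collapse zero_less_numeral)
  obtain N :: nat where N: "norm w * 3 / e < real N" using reals_Archimedean2 by blast
  have "norm (app (J (real (Suc n))) u - u) < e" if "n \<ge> N" for n
  proof -
    let ?n = "real (Suc n)"
    have "norm (f - app (J ?n) f) = norm (app (B ?n) f) / ?n"
      unfolding app_B by simp
    also have "\<dots> \<le> norm w / ?n"
      using norm_app_J[of ?n w] B_eq_J[OF _ fw, of ?n] by (simp add: divide_right_mono)
    also have "\<dots> < e / 3"
      using N that e by (simp add: field_simps) (smt (verit) mult_left_mono of_nat_mono)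
    finally have "norm (app (J ?n) f - f) < e / 3" by (simp add: norm_minus_commute)
    moreover have "norm (app (J ?n) (u - f)) < e / 3"
      using norm_app_J[of ?n "u - f"] f by simp
    moreover have "app (J ?n) u - u = app (J ?n) (u - f) + (app (J ?n) f - f) + (f - u)"
      by (simp add: app.diff_right)
    ultimately show ?thesis
      using norm_triangle_ineq[of "app (J ?n) (u - f) + (app (J ?n) f - f)" "f - u"]
        norm_triangle_ineq[of "app (J ?n) (u - f)" "app (J ?n) f - f"] f
      by (simp add: norm_minus_commute)
  qed
  then show "\<exists>no. \<forall>n\<ge>no. norm (app (J (real (Suc n))) u - u) < e" by blast
qed

section \<open>Contraction semigroups of the regularised operators\<close>

definition T :: "real \<Rightarrow> real \<Rightarrow> 'a endo" where "T n t = exp (t *\<^sub>R (- B n))"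

lemma T_zero [simp]: "T n 0 = 1" by (simp add: T_def)

lemma T_add: "T n (s + t) = T n s * T n t"
  unfolding T_def scaleR_add_left by (rule exp_add_commuting) simp

text \<open>Splitting \<open>- B n\<close> into the scalar \<open>- n\<close> and
  \<open>n *\<^sub>R J n\<close> isolates the factor \<open>exp (- (t * n))\<close>, which exactly
  cancels the bound \<open>exp (t * n)\<close> of the other factor. Estimating the exponential
  series of \<open>- B n\<close> directly would lose this cancellation.\<close>

lemma norm_T:
  assumes n: "0 < n" and t: "0 \<le> t"
  shows "norm (T n t) \<le> 1"
proof -
  have "t *\<^sub>R (- B n) = of_real (- (t * n)) + (t * n) *\<^sub>R J n"
    by (simp add: B_def of_real_def algebra_simps)
  moreover have "exp (of_real (- (t * n)) + (t * n) *\<^sub>R J n)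
      = exp (of_real (- (t * n))) * exp ((t * n) *\<^sub>R J n)"
    by (rule exp_add_commuting) (simp add: of_real_def)
  ultimately have "T n t = exp (of_real (- (t * n))) * exp ((t * n) *\<^sub>R J n)"
    unfolding T_def by (simp add: T_def)
  then have "norm (T n t) \<le> exp (- (t * n)) * norm (exp ((t * n) *\<^sub>R J n))"
    by (simp only: exp_of_real) (metis norm_mult_ineq norm_of_real abs_exp_cancel)
  also have "\<dots> \<le> exp (- (t * n)) * exp (norm ((t * n) *\<^sub>R J n))"
    by (intro mult_left_mono norm_exp) simp
  also have "\<dots> \<le> exp (- (t * n)) * exp (t * n)"
    using n t norm_J[OF n] by (intro mult_left_mono) (auto simp: mult_left_le)
  also have "\<dots> = 1" by (simp flip: exp_add)
  finally show ?thesis .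
qed

lemma norm_app_T: "0 < n \<Longrightarrow> 0 \<le> t \<Longrightarrow> norm (app (T n t) f) \<le> norm f"
  by (rule order_trans[OF norm_app]) (use norm_T[of n t] in \<open>simp add: mult_left_le_one_le\<close>)

lemma T_derivative:
  "((\<lambda>s. app (T n s) f) has_vector_derivative - app (T n s) (app (B n) f)) (at s)"
  unfolding T_def
  by (rule has_vector_derivative_eq_rhs, rule bounded_linear.has_vector_derivative[OF app.bounded_linear_left],
      rule exp_scaleR_has_vector_derivative_right) (simp add: app.minus_left app.minus_right)

text \<open>The path \<open>T m (t - s) * T n s\<close> applied to \<open>f\<close> leads from
  \<open>T m t f\<close> to \<open>T n t f\<close>. Since \<open>B n\<close> and \<open>B m\<close>
  commute, it equals \<open>T m t * exp (s *\<^sub>R C)\<close>, whose derivative puts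
  \<open>C\<close> next to \<open>f\<close> and leaves a contraction in front.\<close>

lemma T_diff_bound:
  assumes n: "0 < n" and m: "0 < m" and t: "0 \<le> t"
  shows "norm (app (T n t) f - app (T m t) f) \<le> t * norm (app (B m) f - app (B n) f)"
proof -
  define C where "C = B m - B n"
  define \<phi> where "\<phi> s = app (T m t * exp (s *\<^sub>R C)) f" for s
  have comm: "B n * B m = B m * B n" by (rule B_commute[OF n m])
  have "norm (\<phi> t - \<phi> 0) \<le> t * norm (app C f)"
  proof (rule vector_derivative_growth[OF t])
    fix s
    show "(\<phi> has_vector_derivative app (T m t * exp (s *\<^sub>R C)) (app C f)) (at s)"
      unfolding \<phi>_def
      by (rule has_vector_derivative_eq_rhs, rule bounded_linear.has_vector_derivative[OF app.bounded_linear_left],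
          rule bounded_linear.has_vector_derivative[OF bounded_linear_mult_right],
          rule exp_scaleR_has_vector_derivative_right) simp
    assume s: "0 \<le> s" "s \<le> t"
    have "T m t * exp (s *\<^sub>R C) = exp (t *\<^sub>R (- B m) + s *\<^sub>R C)"
      unfolding T_def by (rule exp_add_commuting[symmetric]) (simp add: C_def algebra_simps comm)
    also have "t *\<^sub>R (- B m) + s *\<^sub>R C = (t - s) *\<^sub>R (- B m) + s *\<^sub>R (- B n)"
      by (simp add: C_def algebra_simps)
    also have "exp \<dots> = T m (t - s) * T n s"
      unfolding T_def by (rule exp_add_commuting) (simp add: algebra_simps comm)
    finally show "norm (app (T m t * exp (s *\<^sub>R C)) (app C f)) \<le> norm (app C f)"
      using s norm_app_T[OF m, of "t - s"] norm_app_T[OF n, of s]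
      by (simp add: order_trans[of _ "norm (app (T n s) (app C f))"])
  qed
  moreover have "T m t * exp (t *\<^sub>R C) = exp (t *\<^sub>R (- B m) + t *\<^sub>R C)"
    unfolding T_def by (rule exp_add_commuting[symmetric]) (simp add: C_def algebra_simps comm)
  then have "T m t * exp (t *\<^sub>R C) = T n t"
    by (simp add: T_def C_def algebra_simps)
  ultimately show ?thesis by (simp add: \<phi>_def C_def app.diff_left flip: app_times)
qed

text \<open>On the domain \<open>B n g = J n w\<close> converges, so \<open>T_diff_bound\<close>
  controls the difference of the semigroups there; uniform contractivity extends this to all
  vectors.\<close>

lemma Cauchy_T:
  assumes t: "0 \<le> t"
  shows "Cauchy (\<lambda>n. app (T (real (Suc n)) t) f)"
proof (rule CauchyI)
  fix e :: real assume e: "0 < e"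
  obtain g w where gw: "(g, w) \<in> A" and g: "norm (f - g) < e / 3"
    using dense e closure_approachable[of f "fst ` A"]
    by (metis (no_types, lifting) UNIV_I dist_norm divide_pos_pos imageE norm_minus_commute
        prod.collapse zero_less_numeral)
  have "Cauchy (\<lambda>n. app (J (real (Suc n))) w)"
    by (rule LIMSEQ_imp_Cauchy[OF J_tendsto])
  \<comment> \<open>The summand \<open>1\<close> keeps the denominator positive at
    \<open>t = 0\<close>.\<close>
  moreover have "0 < e / (3 * (t + 1))" using e t by simp
  ultimately obtain M where M: "\<And>m n. M \<le> m \<Longrightarrow> M \<le> n \<Longrightarrow>
      norm (app (J (real (Suc m))) w - app (J (real (Suc n))) w) < e / (3 * (t + 1))"
    using CauchyD by blast
  have "norm (app (T (real (Suc m)) t) f - app (T (real (Suc n)) t) f) < e"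
    if mn: "M \<le> m" "M \<le> n" for m n
  proof -
    let ?m = "real (Suc m)" and ?n = "real (Suc n)"
    have "norm (app (T ?m t) g - app (T ?n t) g) \<le> t * norm (app (J ?n) w - app (J ?m) w)"
      using T_diff_bound[of ?m ?n t g] t by (simp add: B_eq_J[OF _ gw])
    also have "\<dots> \<le> t * (e / (3 * (t + 1)))"
      using M[OF mn(2,1)] t by (intro mult_left_mono) auto
    also have "\<dots> \<le> e / 3" using t e by (simp add: field_simps)
    finally have 1: "norm (app (T ?m t) g - app (T ?n t) g) \<le> e / 3" .
    have 2: "norm (app (T ?m t) (f - g)) < e / 3" "norm (app (T ?n t) (f - g)) < e / 3"
      using norm_app_T[of ?m t "f - g"] norm_app_T[of ?n t "f - g"] t g by auto
    have *: "app (T ?m t) f - app (T ?n t) f =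
        app (T ?m t) (f - g) - app (T ?n t) (f - g) + (app (T ?m t) g - app (T ?n t) g)"
      by (simp add: app.diff_right)
    show ?thesis
      unfolding *
      using 1 2 norm_triangle_ineq[of "app (T ?m t) (f - g) - app (T ?n t) (f - g)"
          "app (T ?m t) g - app (T ?n t) g"]
        norm_triangle_ineq4[of "app (T ?m t) (f - g)" "app (T ?n t) (f - g)"] by linarith
  qed
  then show "\<exists>M. \<forall>m\<ge>M. \<forall>n\<ge>M.
      norm (app (T (real (Suc m)) t) f - app (T (real (Suc n)) t) f) < e" by blast
qed

section \<open>The limit semigroup and its generator\<close>

definition S :: "real \<Rightarrow> 'a \<Rightarrow> 'a" where "S t f = lim (\<lambda>n. app (T (real (Suc n)) t) f)"

lemma S_tendsto: "0 \<le> t \<Longrightarrow> (\<lambda>n. app (T (real (Suc n)) t) f) \<longlonglongrightarrow> S t f"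
  unfolding S_def using Cauchy_T Cauchy_convergent_iff convergent_LIMSEQ_iff by blast

lemma norm_S: "0 \<le> t \<Longrightarrow> norm (S t f) \<le> norm f"
  by (rule LIMSEQ_le_const2[OF tendsto_norm[OF S_tendsto]]) (auto simp: norm_app_T)

lemma bounded_linear_S:
  assumes t: "0 \<le> t" shows "bounded_linear (S t)"
proof (rule bounded_linear_intro[where K=1])
  fix x y r
  have "(\<lambda>n. app (T (real (Suc n)) t) (x + y)) \<longlonglongrightarrow> S t x + S t y"
    unfolding app.add_right by (intro tendsto_add S_tendsto t)
  then show "S t (x + y) = S t x + S t y"
    using LIMSEQ_unique S_tendsto t by blast
  have "(\<lambda>n. app (T (real (Suc n)) t) (r *\<^sub>R x)) \<longlonglongrightarrow> r *\<^sub>R S t x"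
    unfolding app.scaleR_right by (intro tendsto_intros S_tendsto t)
  then show "S t (r *\<^sub>R x) = r *\<^sub>R S t x"
    using LIMSEQ_unique S_tendsto t by blast
  show "norm (S t x) \<le> norm x * 1" using norm_S t by simp
qed

lemma S_add:
  assumes s: "0 \<le> s" and t: "0 \<le> t"
  shows "S (s + t) f = S s (S t f)"
proof -
  let ?N = "\<lambda>n. real (Suc n)"
  \<comment> \<open>Both factors vary with \<open>n\<close>; contractivity of the outer one, uniform
    in \<open>n\<close>, reduces the product to convergence of the inner one.\<close>
  have "(\<lambda>n. app (T (?N n) s) (app (T (?N n) t) f - S t f)) \<longlonglongrightarrow> 0"
  proof (rule Lim_null_comparison)
    show "\<forall>\<^sub>F n in sequentially. norm (app (T (?N n) s) (app (T (?N n) t) f - S t f))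
        \<le> norm (app (T (?N n) t) f - S t f)"
      using norm_app_T s by (intro always_eventually) auto
    show "(\<lambda>n. norm (app (T (?N n) t) f - S t f)) \<longlonglongrightarrow> 0"
      using S_tendsto[OF t, of f] by (simp add: LIM_zero tendsto_norm_zero)
  qed
  from tendsto_add[OF this S_tendsto[OF s, of "S t f"]]
  have "(\<lambda>n. app (T (?N n) (s + t)) f) \<longlonglongrightarrow> S s (S t f)"
    by (simp add: app.diff_right T_add)
  then show ?thesis using LIMSEQ_unique S_tendsto s t by (metis add_nonneg_nonneg)
qed

text \<open>Uniformity in \<open>n\<close> is the point: the estimate survives the limit that
  defines \<open>S\<close>. On the domain it holds because the derivative of \<open>T n s g\<close>
  is bounded by \<open>norm w\<close>.\<close>

lemma T_equicontinuous:
  assumes e: "0 < e"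
  obtains d where "0 < d" "\<And>n s. 0 < n \<Longrightarrow> 0 \<le> s \<Longrightarrow> s \<le> d \<Longrightarrow> norm (app (T n s) u - u) \<le> e"
proof -
  obtain g w where gw: "(g, w) \<in> A" and g: "norm (u - g) < e / 3"
    using dense e closure_approachable[of u "fst ` A"]
    by (metis (no_types, lifting) UNIV_I dist_norm divide_pos_pos imageE norm_minus_commute
        prod.collapse zero_less_numeral)
  define d where "d = e / (3 * (norm w + 1))"
  have "norm (app (T n s) u - u) \<le> e" if n: "0 < n" and s: "0 \<le> s" "s \<le> d" for n s
  proof -
    have "norm (app (T n s) g - app (T n 0) g) \<le> s * norm w"
    proof (rule vector_derivative_growth[OF s(1)])
      show "((\<lambda>s. app (T n s) g) has_vector_derivative - app (T n r) (app (B n) g)) (at r)" for r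
        by (rule T_derivative)
      show "norm (- app (T n r) (app (B n) g)) \<le> norm w" if "0 \<le> r" for r
        using norm_app_T[OF n that] norm_app_J[OF n, of w] by (simp add: B_eq_J[OF n gw] order_trans[of _ "norm (app (J n) w)"])
    qed
    also have "\<dots> \<le> d * (norm w + 1)"
      using s by (intro mult_mono) auto
    also have "\<dots> = e / 3" 
      using norm_ge_zero[of w] unfolding d_def by (simp add: field_simps del: norm_ge_zero)
    finally have 1: "norm (app (T n s) g - g) \<le> e / 3" by simp
    have 2: "norm (app (T n s) (u - g)) \<le> e / 3" using norm_app_T[OF n s(1), of "u - g"] g by simp
    have *: "app (T n s) u - u = app (T n s) (u - g) + (app (T n s) g - g) - (u - g)"
      by (simp add: app.diff_right)
    show ?thesis
      unfolding *
      using 1 2 g norm_triangle_ineq4[of "app (T n s) (u - g) + (app (T n s) g - g)" "u - g"]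
        norm_triangle_ineq[of "app (T n s) (u - g)" "app (T n s) g - g"] by linarith
  qed
  moreover have "0 < d" unfolding d_def using e by (simp add: add_nonneg_pos)
  ultimately show ?thesis using that by blast
qed

lemma S_continuous_0: "((\<lambda>t. S t f) \<longlongrightarrow> f) (at_right 0)"
proof (rule tendstoI)
  fix e :: real assume e: "0 < e"
  obtain d where d: "0 < d"
    "\<And>n s. 0 < n \<Longrightarrow> 0 \<le> s \<Longrightarrow> s \<le> d \<Longrightarrow> norm (app (T n s) f - f) \<le> e / 2"
    using T_equicontinuous[of "e / 2"] e by (metis half_gt_zero)
  have "norm (S s f - f) \<le> e / 2" if "0 \<le> s" "s \<le> d" for s
    using that d(2)
    by (intro LIMSEQ_le_const2[OF tendsto_norm[OF tendsto_diff[OF S_tendsto tendsto_const]]]) auto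
  then have "dist (S s f) f < e" if "0 < s" "s < d" for s
    using that e by (simp add: dist_norm) (smt (verit) field_sum_of_halves)
  then show "\<forall>\<^sub>F x in at_right 0. dist (S x f) f < e"
    using d(1) by (auto simp: eventually_at_right_field)
qed

text \<open>Adding \<open>s *\<^sub>R app (B n) f\<close> to \<open>T n s f\<close> gives a path
  with derivative \<open>(1 - T n s) (B n f)\<close>. This is small for small \<open>s\<close>
  uniformly in \<open>n\<close>, up to the error \<open>B n f - u\<close>, which vanishes as
  \<open>n\<close> grows. The estimate therefore passes to \<open>S\<close>.\<close>

lemma A_subset_generator:
  assumes fu: "(f, u) \<in> A" shows "(f, - u) \<in> generator S"
proof -
  let ?N = "\<lambda>n. real (Suc n)"
  have "((\<lambda>t. (S t f - f) /\<^sub>R t) \<longlongrightarrow> - u) (at_right 0)"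
  proof (rule tendstoI)
    fix e :: real assume e: "0 < e"
    obtain d where d: "0 < d"
      "\<And>n s. 0 < n \<Longrightarrow> 0 \<le> s \<Longrightarrow> s \<le> d \<Longrightarrow> norm (app (T n s) u - u) \<le> e / 2"
      using T_equicontinuous[of "e / 2"] e by (metis half_gt_zero)
    have "norm (S t f - f + t *\<^sub>R u) \<le> t * (e / 2)" if t: "0 \<le> t" "t \<le> d" for t
    proof -
      have est: "norm (app (T n t) f - f + t *\<^sub>R app (B n) f) \<le> t * (e / 2 + 2 * norm (app (B n) f - u))"
        if n: "0 < n" for n
      proof -
        let ?b = "app (B n) f"
        have "norm ((app (T n t) f + t *\<^sub>R ?b) - (app (T n 0) f + 0 *\<^sub>R ?b))
            \<le> t * (e / 2 + 2 * norm (?b - u))"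
        proof (rule vector_derivative_growth[OF t(1)])
          fix r
          show "((\<lambda>s. app (T n s) f + s *\<^sub>R ?b) has_vector_derivative
              (- app (T n r) ?b + ?b)) (at r)"
            by (rule has_vector_derivative_eq_rhs, rule has_vector_derivative_add, rule T_derivative,
                rule has_vector_derivative_scaleR, rule DERIV_ident, rule has_vector_derivative_const) simp
          assume r: "0 \<le> r" "r \<le> t"
          have "- app (T n r) ?b + ?b = (?b - u) - app (T n r) (?b - u) - (app (T n r) u - u)"
            by (simp add: app.diff_right)
          also have "norm \<dots> \<le> norm (?b - u) + norm (app (T n r) (?b - u)) + norm (app (T n r) u - u)"
            by (smt (verit) norm_triangle_ineq4)
          also have "\<dots> \<le> norm (?b - u) + norm (?b - u) + e / 2"
            using norm_app_T[OF n r(1)] d(2)[OF n r(1)] r t by (intro add_mono) auto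
          finally show "norm (- app (T n r) ?b + ?b) \<le> e / 2 + 2 * norm (?b - u)" by simp
        qed
        then show ?thesis by (simp add: algebra_simps)
      qed
      have B: "(\<lambda>n. app (B (?N n)) f) \<longlonglongrightarrow> u"
        using J_tendsto[of u] by (simp add: B_eq_J[OF _ fu] del: of_nat_Suc)
      have "(\<lambda>n. norm (app (T (?N n) t) f - f + t *\<^sub>R app (B (?N n)) f)) \<longlonglongrightarrow> norm (S t f - f + t *\<^sub>R u)"
        by (intro tendsto_intros S_tendsto t B)
      moreover have "(\<lambda>n. t * (e / 2 + 2 * norm (app (B (?N n)) f - u))) \<longlonglongrightarrow> t * (e / 2 + 2 * norm (u - u))"
        by (intro tendsto_intros B)
      ultimately have "norm (S t f - f + t *\<^sub>R u) \<le> t * (e / 2 + 2 * norm (u - u))"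
        by (rule LIMSEQ_le) (use est in auto)
      then show ?thesis by simp
    qed
    then have "dist ((S t f - f) /\<^sub>R t) (- u) < e" if "0 < t" "t < d" for t
    proof -
      have "(S t f - f) /\<^sub>R t - - u = (S t f - f + t *\<^sub>R u) /\<^sub>R t"
        using that by (simp add: algebra_simps)
      then have "dist ((S t f - f) /\<^sub>R t) (- u) = norm (S t f - f + t *\<^sub>R u) / t"
        using that by (simp add: dist_norm divide_inverse mult.commute)
      also have "\<dots> \<le> t * (e / 2) / t"
        using that \<open>\<And>t. 0 \<le> t \<Longrightarrow> t \<le> d \<Longrightarrow> norm (S t f - f + t *\<^sub>R u) \<le> t * (e / 2)\<close>
        by (intro divide_right_mono) auto
      finally show ?thesis using that e by simp
    qed
    then show "\<forall>\<^sub>F t in at_right 0. dist ((S t f - f) /\<^sub>R t) (- u) < e"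
      using d(1) by (auto simp: eventually_at_right_field)
  qed
  then show ?thesis by (simp add: generator_def)
qed

text \<open>The range condition leaves no room for a proper extension. With \<open>g\<close> solving
  \<open>A g + g = f - w\<close>, the generator maps \<open>k = f - g\<close> to \<open>k\<close>
  itself, while contractivity of \<open>S\<close> makes the generator dissipative; hence
  \<open>k \<bullet> k \<le> 0\<close>.\<close>

lemma generator_subset_A:
  assumes fw: "(f, w) \<in> generator S" shows "(f, - w) \<in> A"
proof -
  obtain g where g: "(g, (f - w) - 1 *\<^sub>R g) \<in> A" using range_full[of 1] by fastforce
  define k where "k = f - g"
  have lim: "((\<lambda>t. (S t f - f) /\<^sub>R t) \<longlongrightarrow> w) (at_right 0)"
    "((\<lambda>t. (S t g - g) /\<^sub>R t) \<longlongrightarrow> - (f - w - g)) (at_right 0)"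
    using fw A_subset_generator[OF g] by (auto simp: generator_def)
  have "((\<lambda>t. (S t f - f) /\<^sub>R t - (S t g - g) /\<^sub>R t) \<longlongrightarrow> k) (at_right 0)"
    using tendsto_diff[OF lim] by (simp add: k_def)
  then have limk: "((\<lambda>t. ((S t f - f) /\<^sub>R t - (S t g - g) /\<^sub>R t) \<bullet> k) \<longlongrightarrow> k \<bullet> k) (at_right 0)"
    by (intro tendsto_intros)
  have "\<forall>\<^sub>F t in at_right 0. ((S t f - f) /\<^sub>R t - (S t g - g) /\<^sub>R t) \<bullet> k \<le> 0"
  proof (rule eventually_at_right_less[THEN eventually_mono])
    fix t :: real assume t: "0 < t"
    have "S t k = S t f - S t g"
      unfolding k_def using bounded_linear_S[of t] t by (simp add: bounded_linear.linear linear_diff)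
    then have "(S t f - f) /\<^sub>R t - (S t g - g) /\<^sub>R t = (S t k - k) /\<^sub>R t"
      by (simp add: k_def scaleR_diff_right)
    moreover have "S t k \<bullet> k \<le> k \<bullet> k"
      using norm_cauchy_schwarz[of "S t k" k] mult_right_mono[OF norm_S[of t k], of "norm k"] t
      by (simp add: dot_square_norm power2_eq_square)
    ultimately show "((S t f - f) /\<^sub>R t - (S t g - g) /\<^sub>R t) \<bullet> k \<le> 0"
      using t by (simp add: inner_diff_left mult_nonneg_nonpos)
  qed
  from tendsto_upperbound[OF limk this] have "k \<bullet> k \<le> 0" by simp
  then have "k = 0" by (metis inner_gt_zero_iff not_less)
  then show ?thesis using g by (simp add: k_def)
qed

theorem Hille_Yosida:
  "strongly_continuous_semigroup S" "generator S = {(f, - u) | f u. (f, u) \<in> A}"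
proof -
  have "S 0 f = f" for f using S_tendsto[of 0 f] by (simp add: LIMSEQ_const_iff)
  then show "strongly_continuous_semigroup S"
    by (simp add: strongly_continuous_semigroup_def bounded_linear_S S_add S_continuous_0)
  show "generator S = {(f, - u) | f u. (f, u) \<in> A}"
  proof (intro set_eqI iffI)
    fix p assume "p \<in> generator S"
    then obtain f w where "p = (f, - (- w))" "(f, - w) \<in> A" using generator_subset_A by (cases p) auto
    then show "p \<in> {(f, - u) | f u. (f, u) \<in> A}" by blast
  qed (use A_subset_generator in auto)
qed

end

section \<open>Uniform boundedness\<close>

text \<open>Sokal's gliding hump argument: of \<open>x + \<xi>\<close> and \<open>x - \<xi>\<close>, one has an image at least as large
  as that of \<open>\<xi>\<close>.\<close>

lemma uniform_boundedness:
  fixes T :: "nat \<Rightarrow> 'a::banach \<Rightarrow> 'b::real_normed_vector"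
  assumes T: "\<And>n. bounded_linear (T n)" and pointwise: "\<And>x. \<exists>K. \<forall>n. norm (T n x) \<le> K"
  shows "\<exists>K. \<forall>n x. norm (T n x) \<le> K * norm x"
proof (rule ccontr)
  assume unbounded: "\<not> ?thesis"
  \<comment> \<open>The operator norms outgrow the step lengths \<open>(1/3) ^ k\<close> chosen
    below, so the \<open>k\<close>-th step has an image of size at least a multiple of
    \<open>(4/3) ^ k\<close>.\<close>
  have "\<exists>n. 4 ^ k < onorm (T n)" for k :: nat
  proof (rule ccontr)
    assume "\<not> ?thesis"
    then have "norm (T n x) \<le> 4 ^ k * norm x" for n x
      using onorm[OF T, of n x] by (meson linorder_not_less mult_right_mono norm_ge_zero order_trans)
    then show False using unbounded by blast
  qed
  then obtain N where N: "\<And>k::nat. 4 ^ k < onorm (T (N k))" by metis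
  \<comment> \<open>Any factor strictly between \<open>1/2\<close> and \<open>1\<close> would serve
    in place of \<open>2/3\<close>: below \<open>1\<close> such a vector exists, and the later
    steps, of total length at most \<open>(1/3) ^ k / 2\<close>, can cancel only the fraction
    \<open>1/2\<close>. What remains is \<open>2/3 - 1/2 = 1/6\<close>.\<close>
  have "\<exists>\<xi>. norm \<xi> = (1/3) ^ k \<and> (2/3) * onorm (T (N k)) * norm \<xi> \<le> norm (T (N k) \<xi>)" for k
  proof -
    have pos: "0 < onorm (T (N k))" by (rule less_trans[OF _ N[of k]]) simp
    have "\<exists>\<zeta>. (2/3) * onorm (T (N k)) * norm \<zeta> < norm (T (N k) \<zeta>)"
    proof (rule ccontr)
      assume "\<not> ?thesis"
      then have "norm (T (N k) x) \<le> (2/3 * onorm (T (N k))) * norm x" for x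
        by (simp add: not_less)
      from onorm_bound[OF _ this] show False using pos by simp
    qed
    then obtain \<zeta> where \<zeta>: "(2/3) * onorm (T (N k)) * norm \<zeta> < norm (T (N k) \<zeta>)" by blast
    interpret bounded_linear "T (N k)" by (rule T)
    have "\<zeta> \<noteq> 0" using \<zeta> zero by auto
    then have "norm (((1/3) ^ k / norm \<zeta>) *\<^sub>R \<zeta>) = (1/3) ^ k" by simp
    moreover have "(2/3) * onorm (T (N k)) * (1/3) ^ k \<le> norm (T (N k) (((1/3) ^ k / norm \<zeta>) *\<^sub>R \<zeta>))"
    proof -
      have "(2/3) * onorm (T (N k)) * (1/3) ^ k
          = ((1/3) ^ k / norm \<zeta>) * ((2/3) * onorm (T (N k)) * norm \<zeta>)"
        using \<open>\<zeta> \<noteq> 0\<close> by simp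
      also have "\<dots> \<le> ((1/3) ^ k / norm \<zeta>) * norm (T (N k) \<zeta>)"
        using \<zeta> by (intro mult_left_mono) auto
      finally show ?thesis by (simp add: scaleR)
    qed
    ultimately show ?thesis by metis
  qed
  then obtain \<xi> where \<xi>: "\<And>k. norm (\<xi> k) = (1/3) ^ k"
    "\<And>k. (2/3) * onorm (T (N k)) * (1/3) ^ k \<le> norm (T (N k) (\<xi> k))" by metis
  define x where "x = rec_nat 0 (\<lambda>k x. if norm (T (N k) (\<xi> k)) \<le> norm (T (N k) (x + \<xi> k))
    then x + \<xi> k else x - \<xi> k)"
  have x_Suc: "x (Suc k) = (if norm (T (N k) (\<xi> k)) \<le> norm (T (N k) (x k + \<xi> k))
    then x k + \<xi> k else x k - \<xi> k)" for k by (simp add: x_def)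
  have x0: "x 0 = 0" by (simp add: x_def)
  define y where "y k = x (Suc k) - x k" for k
  have norm_y: "norm (y k) = (1/3) ^ k" for k by (simp add: y_def x_Suc \<xi>)
  have summable_y: "summable (\<lambda>j. norm (y (j + n)))" for n
    unfolding norm_y by (rule summable_ignore_initial_segment) simp
  have large: "norm (T (N k) (\<xi> k)) \<le> norm (T (N k) (x (Suc k)))" for k
  proof -
    interpret bounded_linear "T (N k)" by (rule T)
    have "2 *\<^sub>R T (N k) (\<xi> k) = T (N k) (x k + \<xi> k) - T (N k) (x k - \<xi> k)"
      by (simp add: add diff scaleR_2)
    then have "2 * norm (T (N k) (\<xi> k)) \<le> norm (T (N k) (x k + \<xi> k)) + norm (T (N k) (x k - \<xi> k))"
      by (metis norm_scaleR norm_triangle_ineq4 abs_numeral)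
    then show ?thesis by (auto simp: x_Suc)
  qed
  define z where "z = suminf y"
  have tail: "norm (z - x (Suc k)) \<le> (1/3) ^ k / 2" for k
  proof -
    have "x n = (\<Sum>j<n. y j)" for n by (induction n) (auto simp: x0 y_def)
    then have "z - x (Suc k) = (\<Sum>j. y (j + Suc k))"
      unfolding z_def using suminf_minus_initial_segment[of y "Suc k"] summable_norm_cancel[OF summable_y[of 0]]
      by simp
    also have "norm \<dots> \<le> (\<Sum>j. norm (y (j + Suc k)))"
      by (rule summable_norm[OF summable_y])
    also have "\<dots> = (1/3) ^ Suc k * (\<Sum>j. (1/3) ^ j)"
      unfolding norm_y power_add by (subst suminf_mult[symmetric]) (auto simp: mult.commute)
    also have "\<dots> = (1/3) ^ k / 2" by (simp add: suminf_geometric)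
    finally show ?thesis .
  qed
  obtain K where K: "\<And>n. norm (T n z) \<le> K" using pointwise by blast
  have "(4/3) ^ k / 6 \<le> K" for k
  proof -
    let ?o = "onorm (T (N k))"
    interpret bounded_linear "T (N k)" by (rule T)
    have "norm (T (N k) (z - x (Suc k))) \<le> ?o * ((1/3) ^ k / 2)"
      by (rule order_trans[OF onorm[OF T] mult_left_mono[OF tail onorm_pos_le[OF T]]])
    moreover have "norm (T (N k) (x (Suc k))) \<le> norm (T (N k) z) + norm (T (N k) (z - x (Suc k)))"
      by (metis diff norm_triangle_sub norm_minus_commute)
    ultimately have "(2/3) * ?o * (1/3) ^ k \<le> K + ?o * ((1/3) ^ k / 2)"
      using \<xi>(2)[of k] large[of k] K[of "N k"] by linarith
    moreover have "4 ^ k * (1/3) ^ k \<le> ?o * (1/3::real) ^ k"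
      using N[of k] by (intro mult_right_mono) auto
    ultimately show ?thesis by (simp add: power_divide)
  qed
  moreover obtain k where "6 * K < (4/3::real) ^ k"
    using real_arch_pow[of "4/3" "6 * K"] by auto
  ultimately show False by (metis linorder_not_less divide_le_eq_numeral1(1) mult.commute)
qed

section \<open>The time integral of a semigroup with coercive generator\<close>

text \<open>Stated for an arbitrary semigroup with generator \<open>- A\<close>, because the heat
  semigroup comes from a choice operator and only its generator is known. A norm bound has to be
  recovered from coercivity.\<close>

locale coercive_semigroup =
  fixes S :: "real \<Rightarrow> 'a::{real_inner, banach} \<Rightarrow> 'a" and A :: "('a \<times> 'a) set" and c :: real
  assumes semigroup: "strongly_continuous_semigroup S"
    and generator: "generator S = {(f, - u) | f u. (f, u) \<in> A}"
    and coercive: "(f, u) \<in> A \<Longrightarrow> c * (f \<bullet> f) \<le> u \<bullet> f"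
    and c_pos: "0 < c"
    and dense: "closure (fst ` A) = UNIV"
begin

section \<open>Regularity in time\<close>

lemma bounded_linear_S: "0 \<le> t \<Longrightarrow> bounded_linear (S t)"
  and S_zero: "S 0 f = f"
  and S_add: "0 \<le> s \<Longrightarrow> 0 \<le> t \<Longrightarrow> S (s + t) f = S s (S t f)"
  and S_tendsto_0: "((\<lambda>t. S t f) \<longlongrightarrow> f) (at_right 0)"
  using semigroup by (auto simp: strongly_continuous_semigroup_def)

lemma linear_S: "0 \<le> t \<Longrightarrow> linear (S t)"
  by (simp add: bounded_linear.linear bounded_linear_S)

lemma difference_quotient_tendsto:
  "(f, u) \<in> A \<Longrightarrow> ((\<lambda>t. (S t f - f) /\<^sub>R t) \<longlongrightarrow> - u) (at_right 0)"
  using generator by (auto simp: generator_def)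

text \<open>Otherwise there are times \<open>t n\<close> tending to \<open>0\<close> at which the
  operators have norms beyond every bound. Strong continuity at \<open>0\<close> bounds
  \<open>S (t n) g\<close> for each fixed \<open>g\<close>, contradicting uniform
  boundedness.\<close>

lemma locally_bounded_0:
  obtains d M where "0 < d" "1 \<le> M" "\<And>t f. 0 \<le> t \<Longrightarrow> t \<le> d \<Longrightarrow> norm (S t f) \<le> M * norm f"
proof (rule ccontr)
  assume neg: "\<not> thesis"
  have "\<exists>t f. 0 \<le> t \<and> t \<le> inverse (real (Suc n)) \<and> real (Suc n) * norm f < norm (S t f)" for n
  proof (rule ccontr)
    assume "\<not> ?thesis"
    then show False using neg that[of "inverse (real (Suc n))" "real (Suc n)"]
      by (force simp: not_less)
  qed
  then obtain t f where tf: "\<And>n. 0 \<le> t n" "\<And>n. t n \<le> inverse (real (Suc n))"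
    "\<And>n. real (Suc n) * norm (f n) < norm (S (t n) (f n))" by metis
  have "t n \<noteq> 0" for n
  proof
    assume "t n = 0"
    moreover have "1 * norm (f n) \<le> real (Suc n) * norm (f n)" by (intro mult_right_mono) auto
    ultimately show False using tf(3)[of n] S_zero by simp
  qed
  then have pos: "0 < t n" for n using tf(1)[of n] by (simp add: less_le)
  have "t \<longlonglongrightarrow> 0"
    by (rule tendsto_sandwich[OF _ _ tendsto_const LIMSEQ_inverse_real_of_nat])
      (auto intro!: always_eventually tf(1,2) simp del: of_nat_Suc)
  then have "filterlim t (at_right 0) sequentially"
    using pos by (simp add: filterlim_at less_imp_neq[symmetric] always_eventually)
  then have "(\<lambda>n. S (t n) g) \<longlonglongrightarrow> g" for g
    using S_tendsto_0 filterlim_compose by blast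
  then have "\<exists>K. \<forall>n. norm (S (t n) g) \<le> K" for g
    using convergentI convergent_imp_Bseq BseqE by metis
  then obtain K where K: "\<And>n g. norm (S (t n) g) \<le> K * norm g"
    using uniform_boundedness[of "\<lambda>n. S (t n)"] bounded_linear_S tf(1) by blast
  obtain n where "K \<le> real n" using real_arch_simple by blast
  then have "K * norm (f n) \<le> real (Suc n) * norm (f n)" by (intro mult_right_mono) auto
  then show False using K[of n "f n"] tf(3)[of n] by simp
qed

lemma locally_bounded:
  obtains M where "0 \<le> M" "\<And>t f. 0 \<le> t \<Longrightarrow> t \<le> b \<Longrightarrow> norm (S t f) \<le> M * norm f"
proof -
  obtain d M where d: "0 < d" and M: "1 \<le> M"
    and bound: "\<And>t f. 0 \<le> t \<Longrightarrow> t \<le> d \<Longrightarrow> norm (S t f) \<le> M * norm f"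
    using locally_bounded_0 by blast
  have *: "0 \<le> t \<Longrightarrow> t \<le> real k * d \<Longrightarrow> norm (S t f) \<le> M ^ Suc k * norm f" for k t f
  proof (induction k arbitrary: t f)
    case 0
    then show ?case using bound[of t f] d by auto
  next
    case (Suc k)
    show ?case
    proof (cases "t \<le> d")
      case True
      have "M * 1 \<le> M * M ^ Suc k" using M by (intro mult_left_mono one_le_power) auto
      then have "M * norm f \<le> M ^ Suc (Suc k) * norm f" by (intro mult_right_mono) auto
      then show ?thesis using bound[of t f] True Suc.prems by simp
    next
      case False
      have "norm (S (d + (t - d)) f) \<le> M * norm (S (t - d) f)"
        using S_add[of d "t - d" f] bound[of d] d False by simp
      also have "\<dots> \<le> M * (M ^ Suc k * norm f)"
        using Suc False M by (intro mult_left_mono Suc.IH) (auto simp: algebra_simps)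
      finally show ?thesis by (simp add: mult.assoc)
    qed
  qed
  obtain k :: nat where "b / d < real k" using reals_Archimedean2 by blast
  then have "b \<le> real k * d" using d by (simp add: field_simps)
  then show ?thesis using *[of _ k] M by (intro that[of "M ^ Suc k"]) auto
qed

lemma continuous_on_S: "continuous_on {0..} (\<lambda>t. S t f)"
  unfolding continuous_on_iff
proof (intro ballI allI impI)
  fix t e :: real assume t: "t \<in> {0..}" and e: "0 < e"
  obtain M where M: "0 \<le> M" "\<And>s f. 0 \<le> s \<Longrightarrow> s \<le> t + 1 \<Longrightarrow> norm (S s f) \<le> M * norm f"
    using locally_bounded by blast
  have "0 < e / (M + 1)" using e M by simp
  with S_tendsto_0[of f] obtain d where d: "0 < d"
    and small: "\<And>h. 0 < h \<Longrightarrow> h < d \<Longrightarrow> norm (S h f - f) < e / (M + 1)"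
    unfolding tendsto_iff eventually_at_right_field dist_norm by (metis (no_types, lifting) less_trans)
  \<comment> \<open>One estimate serves both sides: \<open>r = t\<close> gives continuity from the
    right, and \<open>r = s\<close> with \<open>h = t - s\<close> gives it from the left, where the
    operator \<open>S r\<close> moves and the local bound is essential.\<close>
  have key: "norm (S (r + h) f - S r f) < e" if "0 \<le> r" "0 < h" "h < d" "r \<le> t + 1" for r h
  proof -
    have "S (r + h) f - S r f = S r (S h f - f)"
      using that by (simp add: S_add linear_diff[OF linear_S])
    then have "norm (S (r + h) f - S r f) \<le> M * norm (S h f - f)" using M that by simp
    also have "\<dots> \<le> M * (e / (M + 1))"
      using small[of h] that M(1) by (intro mult_left_mono) auto
    also have "\<dots> < e" using e M(1) by (simp add: field_simps)
    finally show ?thesis .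
  qed
  show "\<exists>d>0. \<forall>s\<in>{0..}. dist s t < d \<longrightarrow> dist (S s f) (S t f) < e"
  proof (intro exI conjI ballI impI)
    show "0 < min d 1" using d by simp
    fix s :: real assume s: "s \<in> {0..}" "dist s t < min d 1"
    consider "s = t" | "s < t" | "t < s" by linarith
    then show "dist (S s f) (S t f) < e"
    proof cases
      case 2
      then show ?thesis using key[of s "t - s"] s
        by (simp add: dist_norm dist_real_def norm_minus_commute)
    next
      case 3
      then show ?thesis using key[of t "s - t"] s t by (simp add: dist_norm dist_real_def)
    qed (use e in simp)
  qed
qed

lemma isCont_S: "0 < t \<Longrightarrow> isCont (\<lambda>t. S t f) t"
  using continuous_on_S[of f] continuous_on_interior[of "{0..}" "\<lambda>t. S t f" t]
  by (simp add: interior_real_atLeast)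

lemma S_in_A:
  assumes fu: "(f, u) \<in> A" and t: "0 \<le> t"
  shows "(S t f, S t u) \<in> A"
proof -
  have "((\<lambda>h. S t ((S h f - f) /\<^sub>R h)) \<longlongrightarrow> S t (- u)) (at_right 0)"
    by (rule bounded_linear.tendsto[OF bounded_linear_S[OF t] difference_quotient_tendsto[OF fu]])
  moreover have "\<forall>\<^sub>F h in at_right 0. S t ((S h f - f) /\<^sub>R h) = (S h (S t f) - S t f) /\<^sub>R h"
  proof (rule eventually_mono[OF eventually_at_right_less])
    fix h :: real assume "0 < h"
    then show "S t ((S h f - f) /\<^sub>R h) = (S h (S t f) - S t f) /\<^sub>R h"
      using t S_add[of t h f] S_add[of h t f]
      by (simp add: linear_diff[OF linear_S] linear_cmul[OF linear_S] add.commute)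
  qed
  ultimately have "((\<lambda>h. (S h (S t f) - S t f) /\<^sub>R h) \<longlongrightarrow> S t (- u)) (at_right 0)"
    using Lim_transform_eventually by fastforce
  then have "(S t f, - S t u) \<in> generator S"
    by (simp add: generator_def linear_neg[OF linear_S[OF t]])
  then show ?thesis using generator by auto
qed

lemma has_vector_derivative_S:
  assumes fu: "(f, u) \<in> A" and t: "0 < t"
  shows "((\<lambda>t. S t f) has_vector_derivative - S t u) (at t)"
proof -
  let ?D = "\<lambda>h. (S h f - f) /\<^sub>R h"
  have right: "((\<lambda>h. (S (t + h) f - S t f) /\<^sub>R h) \<longlongrightarrow> - S t u) (at_right 0)"
  proof -
    have "((\<lambda>h. S t (?D h)) \<longlongrightarrow> S t (- u)) (at_right 0)"
      using t by (intro bounded_linear.tendsto[OF bounded_linear_S difference_quotient_tendsto[OF fu]]) auto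
    moreover have "\<forall>\<^sub>F h in at_right 0. S t (?D h) = (S (t + h) f - S t f) /\<^sub>R h"
      by (rule eventually_mono[OF eventually_at_right_less])
        (use t in \<open>simp add: S_add linear_diff[OF linear_S] linear_cmul[OF linear_S]\<close>)
    ultimately show ?thesis
      using Lim_transform_eventually t by (fastforce simp: linear_neg[OF linear_S])
  qed
  \<comment> \<open>From the left the quotient is \<open>S (t - k) (?D k)\<close>, with an operator
    that varies. Since \<open>?D k\<close> tends to \<open>- u\<close>, the local bound makes
    \<open>S (t - k) (?D k + u)\<close> vanish, and continuity in time handles
    \<open>S (t - k) u\<close>.\<close>
  have left: "((\<lambda>h. (S (t + h) f - S t f) /\<^sub>R h) \<longlongrightarrow> - S t u) (at_left 0)"
  proof -
    obtain M where M: "0 \<le> M" "\<And>s g. 0 \<le> s \<Longrightarrow> s \<le> t \<Longrightarrow> norm (S s g) \<le> M * norm g"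
      using locally_bounded by blast
    have *: "\<forall>\<^sub>F k in at_right 0. 0 < k \<and> k < t"
      using t by (auto simp: eventually_at_right_field)
    have "((\<lambda>k. S (t - k) (?D k + u)) \<longlongrightarrow> 0) (at_right 0)"
    proof (rule Lim_null_comparison)
      show "\<forall>\<^sub>F k in at_right 0. norm (S (t - k) (?D k + u)) \<le> M * norm (?D k + u)"
        using * by (rule eventually_mono) (auto intro!: M)
      show "((\<lambda>k. M * norm (?D k + u)) \<longlongrightarrow> 0) (at_right 0)"
        using tendsto_mult_left[OF tendsto_norm[OF tendsto_add[OF difference_quotient_tendsto[OF fu]
              tendsto_const[of u]]], of M] by simp
    qed
    moreover have "((\<lambda>k. S (t - k) u) \<longlongrightarrow> S t u) (at_right 0)"
    proof -
      have "((\<lambda>k. t - k) \<longlongrightarrow> t - 0) (at_right 0)" by (intro tendsto_intros)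
      then show ?thesis using isCont_tendsto_compose[OF isCont_S[OF t, of u]] by simp
    qed
    ultimately have "((\<lambda>k. S (t - k) (?D k + u) - S (t - k) u) \<longlongrightarrow> 0 - S t u) (at_right 0)"
      by (rule tendsto_diff)
    moreover have "\<forall>\<^sub>F k in at_right 0.
        S (t - k) (?D k + u) - S (t - k) u = (S (t + - k) f - S t f) /\<^sub>R (- k)"
      using *
    proof (rule eventually_mono)
      fix k assume k: "0 < k \<and> k < t"
      then have "S t f = S (t - k) (S k f)" using S_add[of "t - k" k f] by simp
      then show "S (t - k) (?D k + u) - S (t - k) u = (S (t + - k) f - S t f) /\<^sub>R (- k)"
        using k by (simp add: linear_diff[OF linear_S] linear_add[OF linear_S]
            linear_cmul[OF linear_S] scaleR_diff_right)
    qed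
    ultimately have "((\<lambda>k. (S (t + - k) f - S t f) /\<^sub>R (- k)) \<longlongrightarrow> - S t u) (at_right 0)"
      using Lim_transform_eventually by fastforce
    then show ?thesis
      using filterlim_at_left_to_right[of "\<lambda>h. (S (t + h) f - S t f) /\<^sub>R h" _ 0] by simp
  qed
  have "((\<lambda>h. (S (t + h) f - S t f) /\<^sub>R h) \<longlongrightarrow> - S t u) (at 0)"
    using left right by (simp add: filterlim_split_at)
  then have "((\<lambda>h. norm (S (t + h) f - S t f - h *\<^sub>R (- S t u)) / norm h) \<longlongrightarrow> 0) (at 0)"
  proof (rule Lim_transform_eventually[OF tendsto_norm_zero[OF LIM_zero]])
    show "\<forall>\<^sub>F h in at 0. norm ((S (t + h) f - S t f) /\<^sub>R h - - S t u)
        = norm (S (t + h) f - S t f - h *\<^sub>R (- S t u)) / norm h"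
      unfolding eventually_at_filter
    proof (intro always_eventually allI impI)
      fix h :: real assume "h \<noteq> 0"
      then have "(S (t + h) f - S t f) /\<^sub>R h - - S t u = (S (t + h) f - S t f - h *\<^sub>R (- S t u)) /\<^sub>R h"
        by (simp add: algebra_simps)
      then show "norm ((S (t + h) f - S t f) /\<^sub>R h - - S t u)
          = norm (S (t + h) f - S t f - h *\<^sub>R (- S t u)) / norm h"
        by (simp add: divide_inverse mult.commute)
    qed
  qed
  then show ?thesis
    unfolding has_vector_derivative_def has_derivative_at
    using bounded_linear_scaleR_left by blast
qed

text \<open>For \<open>g\<close> in the domain,
  \<open>exp (2 * c * s) * (norm (S s g))\<^sup>2\<close> decreases in \<open>s\<close>: coercivity
  at \<open>S s g\<close>, which stays in the domain, makes the derivative nonpositive. The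
  resulting bound is a closed condition on the vector, so density suffices.\<close>

lemma decay:
  assumes t: "0 \<le> t"
  shows "norm (S t f) \<le> exp (- (c * t)) * norm f"
proof -
  have "norm (S t g) \<le> exp (- (c * t)) * norm g" if gu: "(g, u) \<in> A" for g u
  proof -
    define \<phi> where "\<phi> s = exp (2 * c * s) * (S s g \<bullet> S s g)" for s
    have "\<phi> t \<le> \<phi> 0"
    proof (rule DERIV_nonpos_imp_decreasing_open[OF t])
      fix s :: real assume s: "0 < s" "s < t"
      have "((\<lambda>s. S s g \<bullet> S s g) has_vector_derivative (S s g \<bullet> - S s u + - S s u \<bullet> S s g)) (at s)"
        by (rule bounded_bilinear.has_vector_derivative[OF bounded_bilinear_inner])
          (rule has_vector_derivative_S[OF gu s(1)])+
      then have d: "((\<lambda>s. S s g \<bullet> S s g) has_real_derivative - (2 * (S s u \<bullet> S s g))) (at s)"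
        by (simp add: has_real_derivative_iff_has_vector_derivative inner_commute)
      have "((\<lambda>s. exp (2 * c * s)) has_real_derivative exp (2 * c * s) * (2 * c)) (at s)"
        by (auto intro!: derivative_eq_intros)
      from DERIV_mult[OF this d]
      have "(\<phi> has_real_derivative exp (2 * c * s) * (2 * (c * (S s g \<bullet> S s g) - S s u \<bullet> S s g))) (at s)"
        unfolding \<phi>_def by (simp add: algebra_simps)
      moreover have "exp (2 * c * s) * (2 * (c * (S s g \<bullet> S s g) - S s u \<bullet> S s g)) \<le> 0"
        using coercive[OF S_in_A[OF gu, of s]] s by (intro mult_nonneg_nonpos) auto
      ultimately show "\<exists>y. (\<phi> has_real_derivative y) (at s) \<and> y \<le> 0" by blast
    next
      show "continuous_on {0..t} \<phi>"
        unfolding \<phi>_def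
        by (intro continuous_intros continuous_on_subset[OF continuous_on_S]) auto
    qed
    then have "exp (2 * c * t) * (norm (S t g))\<^sup>2 \<le> (norm g)\<^sup>2"
      by (simp add: \<phi>_def S_zero dot_square_norm)
    moreover have "exp (2 * c * t) = (exp (c * t))\<^sup>2"
      by (simp add: power2_eq_square flip: exp_add)
    ultimately have "(exp (c * t) * norm (S t g))\<^sup>2 \<le> (norm g)\<^sup>2"
      by (simp add: power_mult_distrib)
    then have "exp (c * t) * norm (S t g) \<le> norm g" by (rule power2_le_imp_le) simp
    then show ?thesis by (simp add: exp_minus field_simps)
  qed
  then have "fst ` A \<subseteq> {f. norm (S t f) \<le> exp (- (c * t)) * norm f}" by auto
  moreover have "closed {f. norm (S t f) \<le> exp (- (c * t)) * norm f}"
    by (intro closed_Collect_le continuous_intros linear_continuous_on bounded_linear_S t)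
  ultimately have "closure (fst ` A) \<subseteq> {f. norm (S t f) \<le> exp (- (c * t)) * norm f}"
    by (rule closure_minimal)
  then show ?thesis using dense by auto
qed

text \<open>As \<open>A u = f\<close>, the function \<open>- (S t u \<bullet> w)\<close> is a
  primitive of the integrand; it vanishes at infinity by decay and tends to
  \<open>- (u \<bullet> w)\<close> at \<open>0\<close>. In weak form, the time integral of the
  semigroup inverts \<open>A\<close>.\<close>

theorem integral_S:
  assumes uf: "(u, f) \<in> A"
  shows "(LINT t:{0..}|lborel. S t f \<bullet> w) = u \<bullet> w"
proof -
  have exp_int: "set_integrable lborel (einterval 0 \<infinity>) (\<lambda>t. exp (- (c * t)))"
  proof (rule interval_integral_FTC_nonneg(1))
    show "((\<lambda>t. - exp (- (c * t)) / c) has_real_derivative exp (- (c * t))) (at t)" for t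
      using c_pos by (auto intro!: derivative_eq_intros)
    show "(((\<lambda>t. - exp (- (c * t)) / c) \<circ> real_of_ereal) \<longlongrightarrow> - exp (- (c * 0)) / c) (at_right 0)"
      unfolding zero_ereal_def ereal_tendsto_simps by (intro tendsto_intros) (use c_pos in auto)
    have "filterlim (\<lambda>t. c * t) at_top at_top"
      by (rule filterlim_tendsto_pos_mult_at_top[OF tendsto_const c_pos filterlim_ident])
    then have "((\<lambda>t. exp (- (c * t))) \<longlongrightarrow> 0) at_top"
      by (intro filterlim_compose[OF exp_at_bot]) (simp add: filterlim_uminus_at_bot)
    then have "((\<lambda>t. - exp (- (c * t)) / c) \<longlongrightarrow> - 0 / c) at_top"
      by (intro tendsto_intros) (use c_pos in auto)
    then show "(((\<lambda>t. - exp (- (c * t)) / c) \<circ> real_of_ereal) \<longlongrightarrow> 0) (at_left \<infinity>)"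
      unfolding ereal_tendsto_simps by simp
  qed (auto intro!: continuous_intros)
  have bound: "\<bar>S t g \<bullet> w\<bar> \<le> norm g * norm w * exp (- (c * t))" if "0 \<le> t" for t g
  proof -
    have "\<bar>S t g \<bullet> w\<bar> \<le> norm (S t g) * norm w" by (rule Cauchy_Schwarz_ineq2)
    also have "\<dots> \<le> exp (- (c * t)) * norm g * norm w"
      by (intro mult_right_mono decay that) auto
    finally show ?thesis by (simp add: mult_ac)
  qed
  have m: "(\<lambda>t. indicat_real U t *\<^sub>R (S t f \<bullet> w)) \<in> borel_measurable lborel"
    if "U \<in> sets borel" "U \<subseteq> {0..}" for U
  proof -
    have "continuous_on U (\<lambda>t. S t f \<bullet> w)"
      by (intro continuous_intros continuous_on_subset[OF continuous_on_S that(2)])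
    then show ?thesis using borel_measurable_continuous_on_indicator[OF that(1)]
      by (simp del: real_scaleR_def)
  qed
  have eint: "einterval 0 \<infinity> = {0<..}" by (auto simp: einterval_def)
  have int: "set_integrable lborel (einterval 0 \<infinity>) (\<lambda>t. S t f \<bullet> w)"
  proof (rule set_integrable_bound)
    show "set_integrable lborel (einterval 0 \<infinity>) (\<lambda>t. norm f * norm w * exp (- (c * t)))"
      using exp_int by simp
    show "set_borel_measurable lborel (einterval 0 \<infinity>) (\<lambda>t. S t f \<bullet> w)"
      unfolding set_borel_measurable_def eint by (rule m) auto
    show "AE t in lborel. t \<in> einterval 0 \<infinity> \<longrightarrow>
        norm (S t f \<bullet> w) \<le> norm (norm f * norm w * exp (- (c * t)))"
      unfolding eint using bound[of _ f] by (intro AE_I2 impI) (simp add: less_imp_le)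
  qed
  have "(LBINT t=0..\<infinity>. S t f \<bullet> w) = 0 - (- (u \<bullet> w))"
  proof (rule interval_integral_FTC_integrable[where F="\<lambda>t. - (S t u \<bullet> w)"])
    fix t assume "(0::ereal) < ereal t" "ereal t < \<infinity>"
    then have t: "0 < t" by simp
    show "((\<lambda>t. - (S t u \<bullet> w)) has_vector_derivative S t f \<bullet> w) (at t)"
      using has_vector_derivative_minus[OF bounded_linear.has_vector_derivative[OF
            bounded_linear_inner_left has_vector_derivative_S[OF uf t]], of w] by simp
    show "isCont (\<lambda>t. S t f \<bullet> w) t"
      by (intro continuous_intros isCont_S t)
  next
    show "((((\<lambda>t. - (S t u \<bullet> w))) \<circ> real_of_ereal) \<longlongrightarrow> - (u \<bullet> w)) (at_right 0)"
      unfolding zero_ereal_def ereal_tendsto_simps by (intro tendsto_intros S_tendsto_0)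
    have "((\<lambda>t. - (S t u \<bullet> w)) \<longlongrightarrow> 0) at_top"
    proof (rule Lim_null_comparison)
      show "\<forall>\<^sub>F t in at_top. norm (- (S t u \<bullet> w)) \<le> norm u * norm w * exp (- (c * t))"
        using bound[of _ u] by (auto intro: eventually_mono[OF eventually_ge_at_top[of 0]])
      have "filterlim (\<lambda>t. c * t) at_top at_top"
        by (rule filterlim_tendsto_pos_mult_at_top[OF tendsto_const c_pos filterlim_ident])
      then have "((\<lambda>t. exp (- (c * t))) \<longlongrightarrow> 0) at_top"
        by (intro filterlim_compose[OF exp_at_bot]) (simp add: filterlim_uminus_at_bot)
      then show "((\<lambda>t. norm u * norm w * exp (- (c * t))) \<longlongrightarrow> 0) at_top"
        by (rule tendsto_mult_right_zero)
    qed
    then show "((((\<lambda>t. - (S t u \<bullet> w))) \<circ> real_of_ereal) \<longlongrightarrow> 0) (at_left \<infinity>)"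
      unfolding ereal_tendsto_simps by simp
  qed (use int in auto)
  moreover have "(LBINT t=0..\<infinity>. S t f \<bullet> w) = (LINT t:{0<..}|lborel. S t f \<bullet> w)"
    unfolding zero_ereal_def by (rule interval_integral_to_infinity_eq)
  \<comment> \<open>The fundamental theorem of calculus concerns the open half-line,
    \<open>green\<close> the closed one; the endpoint is a null set.\<close>
  moreover have "(LINT t:{0<..}|lborel. S t f \<bullet> w) = (LINT t:{0..}|lborel. S t f \<bullet> w)"
    unfolding set_lebesgue_integral_def
  proof (rule integral_cong_AE)
    show "(\<lambda>t. indicat_real {0<..} t *\<^sub>R (S t f \<bullet> w)) \<in> borel_measurable lborel"
      "(\<lambda>t. indicat_real {0..} t *\<^sub>R (S t f \<bullet> w)) \<in> borel_measurable lborel"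
      by (rule m; auto)+
    show "AE t in lborel. indicat_real {0<..} t *\<^sub>R (S t f \<bullet> w) = indicat_real {0..} t *\<^sub>R (S t f \<bullet> w)"
      by (rule eventually_mono[OF AE_lborel_singleton[of 0]]) (auto simp: indicator_def)
  qed
  ultimately show ?thesis by simp
qed

end

section \<open>The Friedrichs extension\<close>

locale coercive_symmetric =
  fixes D :: "'a::{real_inner, banach} set" and T :: "'a \<Rightarrow> 'a" and c :: real
  assumes subspace_D: "subspace D"
    and T_add: "f \<in> D \<Longrightarrow> g \<in> D \<Longrightarrow> T (f + g) = T f + T g"
    and T_scale: "f \<in> D \<Longrightarrow> T (r *\<^sub>R f) = r *\<^sub>R T f"
    and T_symmetric: "f \<in> D \<Longrightarrow> g \<in> D \<Longrightarrow> T f \<bullet> g = f \<bullet> T g"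
    and T_coercive: "f \<in> D \<Longrightarrow> c * (f \<bullet> f) \<le> T f \<bullet> f"
    and c_pos: "0 < c"
    and D_dense: "closure D = UNIV"
begin

lemmas D_intros [simp, intro] =
  subspace_add[OF subspace_D] subspace_diff[OF subspace_D] subspace_scale[OF subspace_D]
  subspace_0[OF subspace_D]

lemma T_diff: "f \<in> D \<Longrightarrow> g \<in> D \<Longrightarrow> T (f - g) = T f - T g"
  using T_add[of f "(-1) *\<^sub>R g"] T_scale[of g "-1"] subspace_scale[OF subspace_D, of g "-1"] by simp

lemma form_nonneg: "f \<in> D \<Longrightarrow> 0 \<le> T f \<bullet> f"
  using T_coercive[of f] c_pos by (meson inner_ge_zero mult_nonneg_nonneg less_imp_le order_trans)

lemma norm_le_form: "f \<in> D \<Longrightarrow> norm f \<le> sqrt (T f \<bullet> f / c)"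
  using T_coercive[of f] c_pos
  by (intro real_le_rsqrt) (simp add: dot_square_norm[symmetric] field_simps)

lemma form_Cauchy_Schwarz:
  assumes f: "f \<in> D" and g: "g \<in> D"
  shows "\<bar>T f \<bullet> g\<bar> \<le> sqrt (T f \<bullet> f) * sqrt (T g \<bullet> g)"
proof (cases "T g \<bullet> g = 0")
  case True
  then have "g = 0" using norm_le_form[OF g] by simp
  then show ?thesis by simp
next
  case False
  then have pos: "0 < T g \<bullet> g" using form_nonneg[OF g] by simp
  \<comment> \<open>This \<open>r\<close> minimises the form at
    \<open>f - r *\<^sub>R g\<close>.\<close>
  define r where "r = (T f \<bullet> g) / (T g \<bullet> g)"
  have "0 \<le> T (f - r *\<^sub>R g) \<bullet> (f - r *\<^sub>R g)" using f g by (intro form_nonneg) auto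
  also have "\<dots> = T f \<bullet> f - 2 * r * (T f \<bullet> g) + r\<^sup>2 * (T g \<bullet> g)"
    using f g T_symmetric[OF f g]
    by (simp add: T_diff T_scale inner_diff_left inner_diff_right power2_eq_square
        inner_commute algebra_simps)
  also have "\<dots> = T f \<bullet> f - (T f \<bullet> g)\<^sup>2 / (T g \<bullet> g)"
    using pos by (simp add: r_def power2_eq_square field_simps)
  finally have "(T f \<bullet> g)\<^sup>2 \<le> (T f \<bullet> f) * (T g \<bullet> g)"
    using pos by (simp add: field_simps)
  then have "\<bar>T f \<bullet> g\<bar> \<le> sqrt ((T f \<bullet> f) * (T g \<bullet> g))"
    by (metis real_sqrt_abs real_sqrt_le_iff)
  then show ?thesis by (simp add: real_sqrt_mult)
qed

text \<open>The Cauchy condition stands in for convergence of the form, which has no prescribed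
  value at \<open>f\<close> outside \<open>D\<close>.\<close>

definition approx :: "(nat \<Rightarrow> 'a) \<Rightarrow> 'a \<Rightarrow> bool" where
  "approx \<phi> f \<longleftrightarrow> (\<forall>n. \<phi> n \<in> D) \<and> \<phi> \<longlonglongrightarrow> f \<and>
     (\<forall>\<epsilon>>0. \<exists>N. \<forall>i\<ge>N. \<forall>j\<ge>N. T (\<phi> i - \<phi> j) \<bullet> (\<phi> i - \<phi> j) < \<epsilon>)"

text \<open>The restriction of the adjoint of \<open>T\<close> to the closure of \<open>D\<close> in
  the form norm. This is the Friedrichs extension, described by testing against \<open>D\<close>
  alone, without values of the closed form.\<close>

definition A :: "('a \<times> 'a) set" where
  "A = {(f, u). (\<exists>\<phi>. approx \<phi> f) \<and> (\<forall>h\<in>D. f \<bullet> T h = u \<bullet> h)}"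

lemma approx_const: "f \<in> D \<Longrightarrow> approx (\<lambda>_. f) f"
  unfolding approx_def by auto

lemma T_subset_A: "f \<in> D \<Longrightarrow> (f, T f) \<in> A"
  unfolding A_def using approx_const T_symmetric by fastforce

lemma approx_bounded:
  assumes "approx \<phi> f"
  obtains K N where "0 \<le> K" "\<And>n. N \<le> n \<Longrightarrow> sqrt (T (\<phi> n) \<bullet> \<phi> n) \<le> K"
proof -
  have \<phi>: "\<phi> n \<in> D" for n using assms by (simp add: approx_def)
  obtain N where N: "\<And>i j. N \<le> i \<Longrightarrow> N \<le> j \<Longrightarrow> T (\<phi> i - \<phi> j) \<bullet> (\<phi> i - \<phi> j) < 1"
    using assms unfolding approx_def by (meson zero_less_one)
  define K where "K = 2 + 2 * (T (\<phi> N) \<bullet> \<phi> N)"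
  have "T (\<phi> n) \<bullet> \<phi> n \<le> K" if "N \<le> n" for n
  proof -
    \<comment> \<open>Parallelogram identity for \<open>\<phi> n - \<phi> N\<close> and
      \<open>\<phi> N\<close>: their sum is \<open>\<phi> n\<close>, and their difference
      contributes a nonnegative term.\<close>
    have "0 \<le> T (\<phi> n - 2 *\<^sub>R \<phi> N) \<bullet> (\<phi> n - 2 *\<^sub>R \<phi> N)"
      using \<phi> by (intro form_nonneg) auto
    moreover have "T (\<phi> n - \<phi> N) \<bullet> (\<phi> n - \<phi> N) < 1" using N that by blast
    ultimately show ?thesis
      using \<phi> T_symmetric[OF \<phi> \<phi>, of n N] unfolding K_def
      by (simp add: T_diff T_scale inner_diff_left inner_diff_right inner_commute algebra_simps)
  qed
  moreover have "0 \<le> K" unfolding K_def using form_nonneg[OF \<phi>] by simp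
  ultimately show ?thesis by (intro that[of "sqrt K" N]) auto
qed

text \<open>Freezing \<open>\<psi> M\<close> allows \<open>T\<close> to be moved onto it and the
  defining equation of \<open>A\<close> to be used; the error \<open>\<psi> n - \<psi> M\<close> is
  small in the form, where \<open>\<phi> n\<close> is bounded. So the limit depends on neither
  sequence, which later identifies the closed form.\<close>

lemma form_tendsto:
  assumes fu: "(f, u) \<in> A" and \<phi>f: "approx \<phi> f" and \<psi>h: "approx \<psi> h"
  shows "(\<lambda>n. T (\<phi> n) \<bullet> \<psi> n) \<longlonglongrightarrow> u \<bullet> h"
proof (rule LIMSEQ_I)
  fix e :: real assume e: "0 < e"
  have \<phi>: "\<phi> n \<in> D" "\<phi> \<longlonglongrightarrow> f" and \<psi>: "\<psi> n \<in> D" "\<psi> \<longlonglongrightarrow> h" for n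
    using \<phi>f \<psi>h by (auto simp: approx_def)
  obtain K N0 where K: "0 \<le> K" "\<And>n. N0 \<le> n \<Longrightarrow> sqrt (T (\<phi> n) \<bullet> \<phi> n) \<le> K"
    using approx_bounded[OF \<phi>f] by blast
  define d where "d = e / (3 * (K + 1))"
  have d: "0 < d" using e K by (simp add: d_def)
  then obtain N where N: "\<And>i j. N \<le> i \<Longrightarrow> N \<le> j \<Longrightarrow> T (\<psi> i - \<psi> j) \<bullet> (\<psi> i - \<psi> j) < d\<^sup>2"
    using \<psi>h unfolding approx_def by (metis zero_less_power)
  have "(\<lambda>n. u \<bullet> \<psi> n) \<longlonglongrightarrow> u \<bullet> h" by (intro tendsto_intros \<psi>)
  then obtain M where "N \<le> M" and M: "\<bar>u \<bullet> \<psi> M - u \<bullet> h\<bar> < e / 3"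
    using e LIMSEQ_D[of "\<lambda>n. u \<bullet> \<psi> n" "u \<bullet> h" "e / 3"] by (metis nle_le real_norm_def divide_pos_pos zero_less_numeral)
  have "(\<lambda>n. \<phi> n \<bullet> T (\<psi> M)) \<longlonglongrightarrow> f \<bullet> T (\<psi> M)" by (intro tendsto_intros \<phi>)
  also have "f \<bullet> T (\<psi> M) = u \<bullet> \<psi> M" using fu \<psi> by (auto simp: A_def)
  finally obtain N1 where N1: "\<And>n. N1 \<le> n \<Longrightarrow> \<bar>\<phi> n \<bullet> T (\<psi> M) - u \<bullet> \<psi> M\<bar> < e / 3"
    using e LIMSEQ_D[of "\<lambda>n. \<phi> n \<bullet> T (\<psi> M)" "u \<bullet> \<psi> M" "e / 3"] by auto
  have "\<bar>T (\<phi> n) \<bullet> \<psi> n - u \<bullet> h\<bar> < e" if n: "N0 \<le> n" "N \<le> n" "N1 \<le> n" for n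
  proof -
    have "\<bar>T (\<phi> n) \<bullet> (\<psi> n - \<psi> M)\<bar> \<le> sqrt (T (\<phi> n) \<bullet> \<phi> n) * sqrt (T (\<psi> n - \<psi> M) \<bullet> (\<psi> n - \<psi> M))"
      using \<phi> \<psi> by (intro form_Cauchy_Schwarz) auto
    also have "\<dots> \<le> K * d"
    proof (intro mult_mono K)
      have "sqrt (T (\<psi> n - \<psi> M) \<bullet> (\<psi> n - \<psi> M)) \<le> sqrt (d\<^sup>2)"
        using N[of n M] n \<open>N \<le> M\<close> by (intro real_sqrt_le_mono) simp
      then show "sqrt (T (\<psi> n - \<psi> M) \<bullet> (\<psi> n - \<psi> M)) \<le> d" using d by simp
    qed (use n form_nonneg \<phi> \<psi> in auto)
    also have "\<dots> < e / 3" using K(1) e by (simp add: d_def field_simps)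
    finally have 1: "\<bar>T (\<phi> n) \<bullet> (\<psi> n - \<psi> M)\<bar> < e / 3" .
    have "T (\<phi> n) \<bullet> \<psi> n - u \<bullet> h = T (\<phi> n) \<bullet> (\<psi> n - \<psi> M) + (\<phi> n \<bullet> T (\<psi> M) - u \<bullet> \<psi> M) + (u \<bullet> \<psi> M - u \<bullet> h)"
      using T_symmetric[OF \<phi>(1) \<psi>(1)] by (simp add: inner_diff_right)
    then show ?thesis using 1 M N1[OF n(3)] by linarith
  qed
  then show "\<exists>no. \<forall>n\<ge>no. norm (T (\<phi> n) \<bullet> \<psi> n - u \<bullet> h) < e"
    by (intro exI[of _ "max N0 (max N N1)"]) auto
qed

lemma A_symmetric:
  assumes fu: "(f, u) \<in> A" and gw: "(g, w) \<in> A"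
  shows "u \<bullet> g = f \<bullet> w"
proof -
  obtain \<phi> \<psi> where \<phi>: "approx \<phi> f" and \<psi>: "approx \<psi> g" using fu gw by (auto simp: A_def)
  have "(\<lambda>n. T (\<psi> n) \<bullet> \<phi> n) = (\<lambda>n. T (\<phi> n) \<bullet> \<psi> n)"
    using \<phi> \<psi> T_symmetric by (auto simp: approx_def inner_commute)
  then show ?thesis
    using form_tendsto[OF fu \<phi> \<psi>] form_tendsto[OF gw \<psi> \<phi>] LIMSEQ_unique by (metis inner_commute)
qed

lemma A_coercive:
  assumes fu: "(f, u) \<in> A"
  shows "c * (f \<bullet> f) \<le> u \<bullet> f"
proof -
  obtain \<phi> where \<phi>: "approx \<phi> f" using fu by (auto simp: A_def)
  then have "\<phi> \<longlonglongrightarrow> f" and "\<phi> n \<in> D" for n by (auto simp: approx_def)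
  then have "(\<lambda>n. c * (\<phi> n \<bullet> \<phi> n)) \<longlonglongrightarrow> c * (f \<bullet> f)" by (intro tendsto_intros)
  then show ?thesis
    by (rule LIMSEQ_le[OF _ form_tendsto[OF fu \<phi> \<phi>]]) (use T_coercive \<open>\<And>n. \<phi> n \<in> D\<close> in auto)
qed

lemma approx_add:
  assumes "approx \<phi> f" "approx \<psi> g"
  shows "approx (\<lambda>n. \<phi> n + \<psi> n) (f + g)"
proof -
  have \<phi>: "\<phi> n \<in> D" "\<phi> \<longlonglongrightarrow> f" and \<psi>: "\<psi> n \<in> D" "\<psi> \<longlonglongrightarrow> g" for n
    using assms by (auto simp: approx_def)
  have "\<exists>N. \<forall>i\<ge>N. \<forall>j\<ge>N. T (\<phi> i + \<psi> i - (\<phi> j + \<psi> j)) \<bullet> (\<phi> i + \<psi> i - (\<phi> j + \<psi> j)) < e"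
    if e: "0 < e" for e
  proof -
    obtain N M where N: "\<And>i j. N \<le> i \<Longrightarrow> N \<le> j \<Longrightarrow> T (\<phi> i - \<phi> j) \<bullet> (\<phi> i - \<phi> j) < e / 4"
      and M: "\<And>i j. M \<le> i \<Longrightarrow> M \<le> j \<Longrightarrow> T (\<psi> i - \<psi> j) \<bullet> (\<psi> i - \<psi> j) < e / 4"
      using assms e unfolding approx_def by (metis divide_pos_pos zero_less_numeral)
    have "T (\<phi> i + \<psi> i - (\<phi> j + \<psi> j)) \<bullet> (\<phi> i + \<psi> i - (\<phi> j + \<psi> j)) < e"
      if ij: "max N M \<le> i" "max N M \<le> j" for i j
    proof -
      define x y where "x = \<phi> i - \<phi> j" and "y = \<psi> i - \<psi> j"
      have xy: "x \<in> D" "y \<in> D" using \<phi> \<psi> by (auto simp: x_def y_def)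
      \<comment> \<open>The parallelogram identity disposes of the cross terms at the price of a
        factor \<open>2\<close>; with two summands this explains the share
        \<open>e / 4\<close>.\<close>
      have "T (x + y) \<bullet> (x + y) + T (x - y) \<bullet> (x - y) = 2 * (T x \<bullet> x) + 2 * (T y \<bullet> y)"
        using xy by (simp add: T_add T_diff inner_add_left inner_add_right inner_diff_left inner_diff_right)
      moreover have "0 \<le> T (x - y) \<bullet> (x - y)" using xy by (intro form_nonneg) auto
      moreover have "T x \<bullet> x < e / 4" "T y \<bullet> y < e / 4" using N M ij by (auto simp: x_def y_def)
      moreover have "\<phi> i + \<psi> i - (\<phi> j + \<psi> j) = x + y" by (simp add: x_def y_def)
      ultimately show ?thesis by simp
    qed
    then show ?thesis by blast
  qed
  then show ?thesis unfolding approx_def using \<phi> \<psi> by (auto intro: tendsto_add)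
qed

lemma approx_scale:
  assumes "approx \<phi> f"
  shows "approx (\<lambda>n. r *\<^sub>R \<phi> n) (r *\<^sub>R f)"
proof -
  have \<phi>: "\<phi> n \<in> D" "\<phi> \<longlonglongrightarrow> f" for n using assms by (auto simp: approx_def)
  have "\<exists>N. \<forall>i\<ge>N. \<forall>j\<ge>N. T (r *\<^sub>R \<phi> i - r *\<^sub>R \<phi> j) \<bullet> (r *\<^sub>R \<phi> i - r *\<^sub>R \<phi> j) < e"
    if e: "0 < e" for e
  proof -
    have "0 < e / (r\<^sup>2 + 1)" using e by (simp add: add_nonneg_pos)
    then obtain N where N: "\<And>i j. N \<le> i \<Longrightarrow> N \<le> j \<Longrightarrow> T (\<phi> i - \<phi> j) \<bullet> (\<phi> i - \<phi> j) < e / (r\<^sup>2 + 1)"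
      using assms unfolding approx_def by metis
    have "T (r *\<^sub>R \<phi> i - r *\<^sub>R \<phi> j) \<bullet> (r *\<^sub>R \<phi> i - r *\<^sub>R \<phi> j) < e" if "N \<le> i" "N \<le> j" for i j
    proof -
      have "T (r *\<^sub>R \<phi> i - r *\<^sub>R \<phi> j) \<bullet> (r *\<^sub>R \<phi> i - r *\<^sub>R \<phi> j) = r\<^sup>2 * (T (\<phi> i - \<phi> j) \<bullet> (\<phi> i - \<phi> j))"
        using \<phi> by (simp add: T_scale power2_eq_square flip: scaleR_diff_right)
      also have "\<dots> \<le> r\<^sup>2 * (e / (r\<^sup>2 + 1))"
        using N[OF that] by (intro mult_left_mono) auto
      also have "\<dots> < e" using e by (simp add: divide_less_eq add_nonneg_pos not_less)
      finally show ?thesis .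
    qed
    then show ?thesis by blast
  qed
  then show ?thesis unfolding approx_def using \<phi> by (auto intro: tendsto_scaleR)
qed

lemma subspace_A: "subspace A"
proof (rule subspaceI)
  show "0 \<in> A" using T_subset_A[of 0] T_scale[of 0 0] by (simp add: zero_prod_def)
next
  fix p q assume "p \<in> A" "q \<in> A"
  then show "p + q \<in> A"
    using approx_add by (cases p; cases q) (auto simp: A_def inner_add_left; blast)
next
  fix r p assume "p \<in> A"
  then show "r *\<^sub>R p \<in> A"
    using approx_scale by (cases p) (auto simp: A_def; blast)
qed

lemma A_dense: "closure (fst ` A) = UNIV"
proof -
  have "D \<subseteq> fst ` A" using T_subset_A by force
  then show ?thesis using closure_mono D_dense by blast
qed

text \<open>The equation \<open>A f + l f = h\<close> is solved by the limit of a minimising sequence of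
  \<open>\<phi> \<mapsto> \<langle>T \<phi>, \<phi>\<rangle> + l \<parallel>\<phi>\<parallel>\<^sup>2 - 2 \<langle>h, \<phi>\<rangle>\<close>.\<close>

lemma A_range:
  assumes l: "0 \<le> l"
  shows "\<exists>f. (f, h - l *\<^sub>R f) \<in> A"
proof -
  define q where "q \<phi> = T \<phi> \<bullet> \<phi> + l * (\<phi> \<bullet> \<phi>)" for \<phi>
  define J where "J \<phi> = q \<phi> - 2 * (h \<bullet> \<phi>)" for \<phi>
  \<comment> \<open>Completing the square: coercivity dominates the linear term.\<close>
  have bound: "- ((norm h)\<^sup>2 / c) \<le> J \<phi>" if "\<phi> \<in> D" for \<phi>
  proof -
    have "0 \<le> (sqrt c * norm \<phi> - norm h / sqrt c)\<^sup>2" by simp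
    also have "\<dots> = c * (\<phi> \<bullet> \<phi>) - 2 * (norm h * norm \<phi>) + (norm h)\<^sup>2 / c"
      using c_pos by (simp add: power2_diff power_mult_distrib power_divide dot_square_norm)
    also have "\<dots> \<le> J \<phi> + (norm h)\<^sup>2 / c"
      using T_coercive[OF that] norm_cauchy_schwarz[of h \<phi>] mult_nonneg_nonneg[OF l inner_ge_zero[of \<phi>]]
      unfolding J_def q_def by linarith
    finally show ?thesis by simp
  qed
  then have bdd: "bdd_below (J ` D)" by (auto intro!: bdd_belowI2)
  define I where "I = (INF \<phi>\<in>D. J \<phi>)"
  have I: "I \<le> J \<phi>" if "\<phi> \<in> D" for \<phi> unfolding I_def by (rule cINF_lower[OF bdd that])
  have "\<exists>\<phi>\<in>D. J \<phi> < I + inverse (real (Suc n))" for n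
    using subspace_0[OF subspace_D] cINF_less_iff[OF _ bdd, of "I + inverse (real (Suc n))"] unfolding I_def by (force simp del: of_nat_Suc)
  then obtain \<phi> where \<phi>: "\<And>n. \<phi> n \<in> D" and J: "\<And>n. J (\<phi> n) < I + inverse (real (Suc n))" by metis
  \<comment> \<open>The linear terms cancel against the midpoint, whose value is at least
    \<open>I\<close>. So near-minimisers are close to each other in the form, hence by coercivity
    also in norm.\<close>
  have parallelogram: "q (x - y) \<le> 2 * (J x - I) + 2 * (J y - I)" if xy: "x \<in> D" "y \<in> D" for x y
  proof -
    have "2 * J x + 2 * J y - 4 * J ((1/2) *\<^sub>R (x + y)) = q (x - y)"
      using xy T_symmetric[OF xy]
      by (simp add: J_def q_def T_add T_diff T_scale inner_add_left inner_add_right inner_diff_left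
          inner_diff_right inner_commute algebra_simps)
    moreover have "I \<le> J ((1/2) *\<^sub>R (x + y))" using xy by (intro I) auto
    ultimately show ?thesis by simp
  qed
  have small: "\<exists>N. \<forall>i\<ge>N. \<forall>j\<ge>N. q (\<phi> i - \<phi> j) < e" if e: "0 < e" for e
  proof -
    obtain N where N: "inverse (real (Suc N)) < e / 4"
      using e reals_Archimedean[of "e / 4"] by auto
    have J_less: "J (\<phi> i) < I + e / 4" if "N \<le> i" for i
      using that by (intro less_trans[OF J] add_strict_left_mono le_less_trans[OF _ N]) auto
    have "q (\<phi> i - \<phi> j) < e" if "N \<le> i" "N \<le> j" for i j
    proof -
      have "2 * (J (\<phi> i) - I) < 2 * (e / 4)" "2 * (J (\<phi> j) - I) < 2 * (e / 4)"
        using J_less[OF that(1)] J_less[OF that(2)] by (simp_all add: algebra_simps)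
      from add_strict_mono[OF this] have "2 * (J (\<phi> i) - I) + 2 * (J (\<phi> j) - I) < e" by simp
      then show ?thesis using parallelogram[OF \<phi>[of i] \<phi>[of j]] by (rule le_less_trans[rotated])
    qed
    then show ?thesis by blast
  qed
  have T_le_q: "T x \<bullet> x \<le> q x" for x using l by (simp add: q_def)
  have "Cauchy \<phi>"
  proof (rule CauchyI)
    fix e :: real assume e: "0 < e"
    then obtain N where N: "\<And>i j. N \<le> i \<Longrightarrow> N \<le> j \<Longrightarrow> q (\<phi> i - \<phi> j) < c * e\<^sup>2"
      using small[of "c * e\<^sup>2"] c_pos by (auto simp del: of_nat_Suc)
    have "norm (\<phi> i - \<phi> j) < e" if "N \<le> i" "N \<le> j" for i j
    proof -
      have "c * (norm (\<phi> i - \<phi> j))\<^sup>2 < c * e\<^sup>2"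
        using T_coercive[of "\<phi> i - \<phi> j"] T_le_q[of "\<phi> i - \<phi> j"] N[OF that] \<phi>
        by (simp add: dot_square_norm)
      then show ?thesis using c_pos e by (simp add: power2_less_imp_less)
    qed
    then show "\<exists>M. \<forall>m\<ge>M. \<forall>n\<ge>M. norm (\<phi> m - \<phi> n) < e" by blast
  qed
  then obtain f where f: "\<phi> \<longlonglongrightarrow> f" using Cauchy_convergent convergent_def by blast
  have "approx \<phi> f"
    unfolding approx_def using \<phi> f small T_le_q by (meson le_less_trans)
  moreover have "f \<bullet> T \<psi> = (h - l *\<^sub>R f) \<bullet> \<psi>" if \<psi>: "\<psi> \<in> D" for \<psi>
  proof -
    define a where "a = f \<bullet> T \<psi> + l * (f \<bullet> \<psi>) - h \<bullet> \<psi>"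
    \<comment> \<open>The variation in direction \<open>\<psi>\<close> is carried out at
      \<open>\<phi> n\<close> and not at \<open>f\<close>, which may lie outside \<open>D\<close>,
      where nothing is known about \<open>T\<close>. The defect
      \<open>inverse (real (Suc n))\<close> vanishes in the limit.\<close>
    have *: "0 \<le> 2 * t * a + t\<^sup>2 * q \<psi>" for t
    proof -
      have ge: "- inverse (real (Suc n)) \<le> 2 * t * (\<phi> n \<bullet> T \<psi> + l * (\<phi> n \<bullet> \<psi>) - h \<bullet> \<psi>) + t\<^sup>2 * q \<psi>" for n
      proof -
        have "J (\<phi> n + t *\<^sub>R \<psi>) - J (\<phi> n)
            = 2 * t * (\<phi> n \<bullet> T \<psi> + l * (\<phi> n \<bullet> \<psi>) - h \<bullet> \<psi>) + t\<^sup>2 * q \<psi>"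
          using \<phi>[of n] \<psi> T_symmetric[OF \<phi> \<psi>, of n]
          by (simp add: J_def q_def T_add T_scale inner_add_left inner_add_right
              inner_commute power2_eq_square algebra_simps)
        moreover have "I \<le> J (\<phi> n + t *\<^sub>R \<psi>)" using \<phi> \<psi> by (intro I) auto
        ultimately show ?thesis using J[of n] by linarith
      qed
      have "(\<lambda>n. 2 * t * (\<phi> n \<bullet> T \<psi> + l * (\<phi> n \<bullet> \<psi>) - h \<bullet> \<psi>) + t\<^sup>2 * q \<psi>) \<longlonglongrightarrow> 2 * t * a + t\<^sup>2 * q \<psi>"
        unfolding a_def by (intro tendsto_intros f)
      moreover have "(\<lambda>n. - inverse (real (Suc n))) \<longlonglongrightarrow> - 0"
        by (intro tendsto_minus LIMSEQ_inverse_real_of_nat)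
      ultimately show ?thesis by (intro LIMSEQ_le[of "\<lambda>n. - inverse (real (Suc n))"]) (use ge in auto)
    qed
    have q0: "0 \<le> q \<psi>" using T_le_q[of \<psi>] form_nonneg[OF \<psi>] by simp
    have "a = 0"
    proof (cases "q \<psi> = 0")
      case True
      then show ?thesis using *[of 1] *[of "-1"] by simp
    next
      case False
      \<comment> \<open>The value \<open>t = - a / q \<psi>\<close> minimises the quadratic
        polynomial in \<open>*\<close>.\<close>
      have "2 * (- a / q \<psi>) * a + (- a / q \<psi>)\<^sup>2 * q \<psi> = - (a\<^sup>2 / q \<psi>)"
        using False by (simp add: power2_eq_square field_simps)
      then have "a\<^sup>2 / q \<psi> \<le> 0" using *[of "- a / q \<psi>"] by simp
      then show ?thesis using False q0 by (simp add: divide_le_0_iff)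
    qed
    then show ?thesis by (simp add: a_def inner_diff_left)
  qed
  ultimately show ?thesis unfolding A_def by blast
qed

end

section \<open>The Hilbert space of square-summable sequences\<close>

lemma summable_mult_of_square_summable:
  fixes f g :: "nat \<Rightarrow> real"
  assumes "summable (\<lambda>n. (f n)\<^sup>2)" "summable (\<lambda>n. (g n)\<^sup>2)"
  shows "summable (\<lambda>n. f n * g n)"
proof (rule summable_comparison_test)
  show "summable (\<lambda>n. (f n)\<^sup>2 + (g n)\<^sup>2)" by (intro summable_add assms)
  have "\<bar>f n * g n\<bar> \<le> (f n)\<^sup>2 + (g n)\<^sup>2" for n
  proof -
    have "2 * \<bar>f n\<bar> * \<bar>g n\<bar> \<le> (f n)\<^sup>2 + (g n)\<^sup>2"
      using sum_squares_bound[of "\<bar>f n\<bar>" "\<bar>g n\<bar>"] by simp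
    moreover have "0 \<le> \<bar>f n\<bar> * \<bar>g n\<bar>" by simp
    ultimately show ?thesis unfolding abs_mult by linarith
  qed
  then show "\<exists>N. \<forall>n\<ge>N. norm (f n * g n) \<le> (f n)\<^sup>2 + (g n)\<^sup>2" by auto
qed

typedef l2 = "{f::nat \<Rightarrow> real. summable (\<lambda>n. (f n)\<^sup>2)}"
  morphisms nth_l2 Abs_l2
  by (rule exI[of _ "\<lambda>_. 0"]) simp

setup_lifting type_definition_l2

lemma summable_l2: "summable (\<lambda>n. nth_l2 f n * nth_l2 g n)"
  by (rule summable_mult_of_square_summable) (use nth_l2 in auto)

instantiation l2 :: real_inner
begin

lift_definition zero_l2 :: l2 is "\<lambda>_. 0" by simp

lift_definition plus_l2 :: "l2 \<Rightarrow> l2 \<Rightarrow> l2" is "\<lambda>f g n. f n + g n"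
proof -
  fix f g :: "nat \<Rightarrow> real"
  assume fg: "summable (\<lambda>n. (f n)\<^sup>2)" "summable (\<lambda>n. (g n)\<^sup>2)"
  have "summable (\<lambda>n. (f n)\<^sup>2 + 2 * (f n * g n) + (g n)\<^sup>2)"
    by (intro summable_add summable_mult fg summable_mult_of_square_summable)
  then show "summable (\<lambda>n. (f n + g n)\<^sup>2)" by (simp add: power2_sum algebra_simps)
qed

lift_definition scaleR_l2 :: "real \<Rightarrow> l2 \<Rightarrow> l2" is "\<lambda>r f n. r * f n"
  by (simp add: power_mult_distrib summable_mult)

definition uminus_l2 :: "l2 \<Rightarrow> l2" where "uminus_l2 f = (-1) *\<^sub>R f"
definition minus_l2 :: "l2 \<Rightarrow> l2 \<Rightarrow> l2" where "minus_l2 f g = f + - g"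

lift_definition inner_l2 :: "l2 \<Rightarrow> l2 \<Rightarrow> real" is "\<lambda>f g. \<Sum>n. f n * g n" .

definition norm_l2 :: "l2 \<Rightarrow> real" where "norm_l2 f = sqrt (f \<bullet> f)"
definition sgn_l2 :: "l2 \<Rightarrow> l2" where "sgn_l2 f = inverse (norm f) *\<^sub>R f"
definition dist_l2 :: "l2 \<Rightarrow> l2 \<Rightarrow> real" where "dist_l2 f g = norm (f - g)"
definition uniformity_l2 :: "(l2 \<times> l2) filter" where
  "uniformity_l2 = (INF e\<in>{0<..}. principal {(x, y). dist x y < e})"
definition open_l2 :: "l2 set \<Rightarrow> bool" where
  "open_l2 U = (\<forall>x\<in>U. \<forall>\<^sub>F (x', y) in uniformity. x' = x \<longrightarrow> y \<in> U)"

instance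
proof
  fix x y z :: l2 and r s :: real
  show "x + y + z = x + (y + z)" "x + y = y + x" "0 + x = x"
    by (transfer; simp add: add_ac)+
  show "- x + x = 0" unfolding uminus_l2_def by transfer simp
  show "x - y = x + - y" by (simp add: minus_l2_def)
  show "r *\<^sub>R (x + y) = r *\<^sub>R x + r *\<^sub>R y" "(r + s) *\<^sub>R x = r *\<^sub>R x + s *\<^sub>R x"
    "r *\<^sub>R s *\<^sub>R x = (r * s) *\<^sub>R x" "1 *\<^sub>R x = x"
    by (transfer; simp add: algebra_simps)+
  show "x \<bullet> y = y \<bullet> x" by transfer (simp add: mult.commute)
  show "(x + y) \<bullet> z = x \<bullet> z + y \<bullet> z"
    by (simp add: inner_l2.rep_eq plus_l2.rep_eq distrib_right suminf_add[OF summable_l2 summable_l2])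
  show "r *\<^sub>R x \<bullet> y = r * (x \<bullet> y)"
    by (simp add: inner_l2.rep_eq scaleR_l2.rep_eq mult.assoc suminf_mult[OF summable_l2])
  show "0 \<le> x \<bullet> x"
    unfolding inner_l2.rep_eq by (rule suminf_nonneg[OF summable_l2]) simp
  show "(x \<bullet> x = 0) = (x = 0)"
    unfolding inner_l2.rep_eq
    by (subst suminf_eq_zero_iff[OF summable_l2]) (auto simp: zero_l2.rep_eq nth_l2_inject[symmetric])
qed (simp_all add: norm_l2_def sgn_l2_def dist_l2_def uniformity_l2_def open_l2_def)

end

lemma nth_l2_minus: "nth_l2 (f - g) n = nth_l2 f n - nth_l2 g n"
  unfolding minus_l2_def uminus_l2_def plus_l2.rep_eq scaleR_l2.rep_eq by simp

lemma power2_norm_l2: "(norm f)\<^sup>2 = (\<Sum>n. (nth_l2 f n)\<^sup>2)"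
  unfolding power2_norm_eq_inner inner_l2.rep_eq by (simp add: power2_eq_square)

lemma sum_nth_l2_le: "finite K \<Longrightarrow> (\<Sum>n\<in>K. (nth_l2 f n)\<^sup>2) \<le> (norm f)\<^sup>2"
  unfolding power2_norm_l2 by (rule sum_le_suminf) (use nth_l2[of f] in simp_all)

lemma abs_nth_l2_le: "\<bar>nth_l2 f n\<bar> \<le> norm f"
  by (rule power2_le_imp_le) (use sum_nth_l2_le[of "{n}" f] in simp_all)

instance l2 :: banach
proof
  fix X :: "nat \<Rightarrow> l2" assume X: "Cauchy X"
  have "Cauchy (\<lambda>k. nth_l2 (X k) n)" for n
  proof (rule CauchyI)
    fix e :: real assume "0 < e"
    then obtain M where "\<And>i j. M \<le> i \<Longrightarrow> M \<le> j \<Longrightarrow> norm (X i - X j) < e" using CauchyD[OF X] by blast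
    moreover have "norm (nth_l2 (X i) n - nth_l2 (X j) n) \<le> norm (X i - X j)" for i j
      using abs_nth_l2_le[of "X i - X j" n] by (simp add: nth_l2_minus)
    ultimately show "\<exists>M. \<forall>i\<ge>M. \<forall>j\<ge>M. norm (nth_l2 (X i) n - nth_l2 (X j) n) < e"
      by (meson le_less_trans)
  qed
  then obtain g where g: "\<And>n. (\<lambda>k. nth_l2 (X k) n) \<longlonglongrightarrow> g n"
    unfolding Cauchy_convergent_iff convergent_def by metis
  \<comment> \<open>A Fatou argument: on each finite set of coordinates the Cauchy bound passes to
    the coordinatewise limit, and it is uniform in that set.\<close>
  have tail: "(\<Sum>n\<in>K. (nth_l2 (X i) n - g n)\<^sup>2) \<le> e\<^sup>2"
    if "finite K" and i: "\<And>j. M \<le> j \<Longrightarrow> norm (X i - X j) < e" for K M i e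
  proof (rule LIMSEQ_le_const2)
    show "(\<lambda>j. \<Sum>n\<in>K. (nth_l2 (X i) n - nth_l2 (X j) n)\<^sup>2) \<longlonglongrightarrow> (\<Sum>n\<in>K. (nth_l2 (X i) n - g n)\<^sup>2)"
      by (intro tendsto_intros g)
    show "\<exists>N. \<forall>j\<ge>N. (\<Sum>n\<in>K. (nth_l2 (X i) n - nth_l2 (X j) n)\<^sup>2) \<le> e\<^sup>2"
    proof (intro exI allI impI)
      fix j assume "M \<le> j"
      then have "(norm (X i - X j))\<^sup>2 \<le> e\<^sup>2" using i by (intro power_mono) (auto intro: less_imp_le)
      then show "(\<Sum>n\<in>K. (nth_l2 (X i) n - nth_l2 (X j) n)\<^sup>2) \<le> e\<^sup>2"
        using sum_nth_l2_le[OF \<open>finite K\<close>, of "X i - X j"] by (simp add: nth_l2_minus)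
    qed
  qed
  have diff_summable: "summable (\<lambda>n. (nth_l2 (X i) n - g n)\<^sup>2)"
    if i: "\<And>j. M \<le> j \<Longrightarrow> norm (X i - X j) < e" for M i e
  proof (rule summableI_nonneg_bounded)
    show "(\<Sum>n<k. (nth_l2 (X i) n - g n)\<^sup>2) \<le> e\<^sup>2" for k
      by (rule tail[where M=M]) (auto intro: i)
  qed simp
  obtain M where M: "\<And>i j. M \<le> i \<Longrightarrow> M \<le> j \<Longrightarrow> norm (X i - X j) < 1"
    using CauchyD[OF X zero_less_one] by blast
  have sq: "summable (\<lambda>n. (nth_l2 (X M) n)\<^sup>2)" using nth_l2[of "X M"] by simp
  \<comment> \<open>The limit \<open>g\<close> is written as \<open>X M\<close> minus the
    square-summable \<open>X M - g\<close>, and the square is expanded.\<close>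
  have "summable (\<lambda>n. (nth_l2 (X M) n)\<^sup>2 + (nth_l2 (X M) n - g n)\<^sup>2
      - 2 * (nth_l2 (X M) n * (nth_l2 (X M) n - g n)))"
    using diff_summable[where M=M and i=M, OF M[OF order_refl]]
    by (intro summable_add summable_diff summable_mult summable_mult_of_square_summable sq)
  moreover have "(\<lambda>n. (nth_l2 (X M) n)\<^sup>2 + (nth_l2 (X M) n - g n)\<^sup>2
      - 2 * (nth_l2 (X M) n * (nth_l2 (X M) n - g n))) = (\<lambda>n. (g n)\<^sup>2)"
    by (auto simp: power2_eq_square algebra_simps)
  ultimately have "summable (\<lambda>n. (g n)\<^sup>2)" by simp
  then have nth_g: "nth_l2 (Abs_l2 g) = g" by (simp add: Abs_l2_inverse)
  have "X \<longlonglongrightarrow> Abs_l2 g"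
  proof (rule LIMSEQ_I)
    fix e :: real assume e: "0 < e"
    then obtain M where M: "\<And>i j. M \<le> i \<Longrightarrow> M \<le> j \<Longrightarrow> norm (X i - X j) < e / 2"
      using CauchyD[OF X, of "e / 2"] by auto
    have "norm (X i - Abs_l2 g) < e" if "M \<le> i" for i
    proof -
      have d: "\<And>j. M \<le> j \<Longrightarrow> norm (X i - X j) < e / 2" using M that by blast
      have "(\<Sum>n. (nth_l2 (X i) n - g n)\<^sup>2) \<le> (e / 2)\<^sup>2"
      proof (rule suminf_le_const)
        show "summable (\<lambda>n. (nth_l2 (X i) n - g n)\<^sup>2)" by (rule diff_summable) (rule d)
        show "(\<Sum>n<k. (nth_l2 (X i) n - g n)\<^sup>2) \<le> (e / 2)\<^sup>2" for k
          by (rule tail[where M=M, OF _ d]) simp_all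
      qed
      then have "(norm (X i - Abs_l2 g))\<^sup>2 \<le> (e / 2)\<^sup>2"
        by (simp only: power2_norm_l2 nth_l2_minus nth_g)
      then have "norm (X i - Abs_l2 g) \<le> e / 2" by (rule power2_le_imp_le) (use e in simp)
      then show ?thesis using e by simp
    qed
    then show "\<exists>no. \<forall>i\<ge>no. norm (X i - Abs_l2 g) < e" by blast
  qed
  then show "convergent X" by (auto simp: convergent_def)
qed

lemma l2_nonzero: "\<exists>v::l2. v \<noteq> 0"
proof -
  define v where "v = Abs_l2 (\<lambda>n. if n = 0 then 1 else 0)"
  have "summable (\<lambda>n::nat. (if n = 0 then 1 else 0 :: real)\<^sup>2)"
    by (rule summable_finite[of "{0}"]) auto
  then have "nth_l2 v 0 = 1" unfolding v_def by (simp add: Abs_l2_inverse)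
  then have "v \<noteq> 0" by (metis zero_l2.rep_eq zero_neq_one)
  then show ?thesis ..
qed

text \<open>Makes the operators on \<open>l2\<close> a Banach algebra with unit, so that the Yosida
  construction applies.\<close>

instance l2 :: perfect_space
proof
  fix x :: l2
  obtain v :: l2 where v: "v \<noteq> 0" using l2_nonzero by blast
  show "\<not> open {x}"
  proof
    assume "open {x}"
    then have "\<exists>e>0. \<forall>y. dist y x < e \<longrightarrow> y \<in> {x}" unfolding open_dist by blast
    then obtain e where e: "0 < e" "\<And>y. dist y x < e \<Longrightarrow> y \<in> {x}" by blast
    have "norm ((e / 2 / norm v) *\<^sub>R v) = e / 2" using e(1) v by simp
    then have "dist (x + (e / 2 / norm v) *\<^sub>R v) x < e" using e(1) by (simp add: dist_norm)
    from e(2)[OF this] have "(e / 2 / norm v) *\<^sub>R v = 0" by simp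
    then show False using e(1) v by simp
  qed
qed

section \<open>Green's formula on weighted graphs\<close>

lemma has_sum_finite_sum:
  fixes f :: "'i \<Rightarrow> 'b \<Rightarrow> 'c::topological_comm_monoid_add"
  assumes "finite I" "\<And>i. i \<in> I \<Longrightarrow> (f i has_sum s i) A"
  shows "((\<lambda>x. \<Sum>i\<in>I. f i x) has_sum (\<Sum>i\<in>I. s i)) A"
  using assms by (induction I rule: finite_induct) (auto intro!: has_sum_add)

text \<open>Reduces a double series with finitely many nonzero rows to a finite sum of row sums, so
  that the energy is computed without exchanging two infinite sums.\<close>

lemma has_sum_Times_finite:
  fixes h :: "'b \<Rightarrow> 'c \<Rightarrow> real"
  assumes K: "finite K" "K \<subseteq> V" and h0: "\<And>x y. x \<in> V \<Longrightarrow> x \<notin> K \<Longrightarrow> y \<in> W \<Longrightarrow> h x y = 0"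
    and s: "\<And>x. x \<in> K \<Longrightarrow> (h x has_sum s x) W"
  shows "((\<lambda>(x, y). h x y) has_sum (\<Sum>x\<in>K. s x)) (V \<times> W)"
proof -
  have "((\<lambda>p. \<Sum>x\<in>K. if fst p = x then h x (snd p) else 0) has_sum (\<Sum>x\<in>K. s x)) (V \<times> W)"
  proof (rule has_sum_finite_sum[OF K(1)])
    fix x assume x: "x \<in> K"
    have "bij_betw (Pair x) W ({x} \<times> W)" by (auto simp: bij_betw_def inj_on_def)
    from has_sum_reindex_bij_betw[OF this, of "\<lambda>p. h x (snd p)"] s[OF x]
    have "((\<lambda>p. h x (snd p)) has_sum s x) ({x} \<times> W)" by simp
    then show "((\<lambda>p. if fst p = x then h x (snd p) else 0) has_sum s x) (V \<times> W)"
      by (rule has_sum_cong_neutral[THEN iffD1, rotated -1]) (use x K in auto)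
  qed
  then show ?thesis
    by (rule has_sum_cong[THEN iffD1, rotated]) (use K h0 in \<open>auto simp: sum.delta'\<close>)
qed

text \<open>Not normalised: its squared norm in \<open>ell2 V m\<close> is \<open>m x\<close>. This
  is the source of the factors \<open>m x\<close> and \<open>m v\<close> in the formulas for the
  heat kernel and the Green's function.\<close>

definition delta :: "'v \<Rightarrow> 'v \<Rightarrow> real" where "delta x y = (if y = x then 1 else 0)"

locale wgraph =
  fixes V :: "'v set" and b :: "'v \<Rightarrow> 'v \<Rightarrow> real" and m :: "'v \<Rightarrow> real"
  assumes weighted_graph: "weighted_graph V b m"
begin

lemma countable_V: "countable V" and infinite_V: "infinite V"
  and m_pos: "x \<in> V \<Longrightarrow> 0 < m x"
  and b_nonneg: "x \<in> V \<Longrightarrow> y \<in> V \<Longrightarrow> 0 \<le> b x y"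
  and b_refl: "x \<in> V \<Longrightarrow> b x x = 0"
  and b_sym: "x \<in> V \<Longrightarrow> y \<in> V \<Longrightarrow> b x y = b y x"
  and b_summable: "x \<in> V \<Longrightarrow> b x summable_on V"
  using weighted_graph by (auto simp: weighted_graph_def)

definition deg :: "'v \<Rightarrow> real" where "deg x = (\<Sum>\<^sub>\<infinity>y\<in>V. b x y)"

abbreviation Lap :: "('v \<Rightarrow> real) \<Rightarrow> 'v \<Rightarrow> real" where
  "Lap \<equiv> formal_laplacian V b m"

lemma deg_has_sum: "x \<in> V \<Longrightarrow> (b x has_sum deg x) V"
  unfolding deg_def by (rule has_sum_infsum[OF b_summable])

lemma fin_suppD: "\<phi> \<in> fin_supp V \<Longrightarrow> finite {x. \<phi> x \<noteq> 0}" "\<phi> \<in> fin_supp V \<Longrightarrow> {x. \<phi> x \<noteq> 0} \<subseteq> V"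
  by (auto simp: fin_supp_def)

lemma fin_supp_lincomb:
  assumes "\<phi> \<in> fin_supp V" "\<psi> \<in> fin_supp V"
  shows "(\<lambda>x. r * \<phi> x + s * \<psi> x) \<in> fin_supp V"
proof -
  have "{x. r * \<phi> x + s * \<psi> x \<noteq> 0} \<subseteq> {x. \<phi> x \<noteq> 0} \<union> {x. \<psi> x \<noteq> 0}" by auto
  then show ?thesis
    using assms unfolding fin_supp_def by (simp add: finite_subset) (blast dest: finite_subset)
qed

lemma fin_supp_diff:
  "\<phi> \<in> fin_supp V \<Longrightarrow> \<psi> \<in> fin_supp V \<Longrightarrow> (\<lambda>x. \<phi> x - \<psi> x) \<in> fin_supp V"
  using fin_supp_lincomb[of \<phi> \<psi> 1 "-1"] by simp

lemma delta_fin_supp: "x \<in> V \<Longrightarrow> delta x \<in> fin_supp V"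
  by (auto simp: fin_supp_def delta_def)

lemma fin_supp_ell2: "\<phi> \<in> fin_supp V \<Longrightarrow> \<phi> \<in> ell2 V m"
proof -
  assume \<phi>: "\<phi> \<in> fin_supp V"
  have "(\<lambda>x. (\<phi> x)\<^sup>2 * m x) summable_on V"
    using has_sum_finite_neutralI[OF fin_suppD[OF \<phi>], of "\<lambda>x. (\<phi> x)\<^sup>2 * m x"]
    by (auto intro!: has_sum_imp_summable)
  then show ?thesis using \<phi> by (auto simp: ell2_def fin_supp_def)
qed

lemma fin_supp_formal_domain: "\<phi> \<in> fin_supp V \<Longrightarrow> \<phi> \<in> formal_domain V b"
  unfolding formal_domain_def
  using has_sum_finite_neutralI[OF fin_suppD, of \<phi> "\<lambda>y. b _ y * \<bar>\<phi> y\<bar>"]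
  by (auto intro!: has_sum_imp_summable)

lemma has_sum_Lap:
  assumes f: "f \<in> formal_domain V b" and x: "x \<in> V"
  shows "((\<lambda>y. b x y * f y) has_sum (deg x * f x - m x * Lap f x)) V"
    and "((\<lambda>y. b x y * (f x - f y)) has_sum (m x * Lap f x)) V"
proof -
  have "(\<lambda>y. norm (b x y * f y)) summable_on V"
  proof (rule summable_on_cong[THEN iffD1])
    show "(\<lambda>y. b x y * \<bar>f y\<bar>) summable_on V" using f x by (simp add: formal_domain_def)
  qed (simp add: abs_mult b_nonneg[OF x])
  then have s: "((\<lambda>y. b x y * f y) has_sum (\<Sum>\<^sub>\<infinity>y\<in>V. b x y * f y)) V"
    by (rule has_sum_infsum[OF abs_summable_summable])
  have "((\<lambda>y. b x y * f x + - (b x y * f y)) has_sum (deg x * f x + - (\<Sum>\<^sub>\<infinity>y\<in>V. b x y * f y))) V"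
    by (intro has_sum_add has_sum_cmult_left deg_has_sum x has_sum_uminusI s)
  then have d: "((\<lambda>y. b x y * (f x - f y)) has_sum (deg x * f x - (\<Sum>\<^sub>\<infinity>y\<in>V. b x y * f y))) V"
    by (simp add: algebra_simps)
  then have "m x * Lap f x = deg x * f x - (\<Sum>\<^sub>\<infinity>y\<in>V. b x y * f y)"
    using m_pos[OF x] x by (simp add: formal_laplacian_def infsumI)
  then show "((\<lambda>y. b x y * f y) has_sum (deg x * f x - m x * Lap f x)) V"
    and "((\<lambda>y. b x y * (f x - f y)) has_sum (m x * Lap f x)) V"
    using s d by (simp_all only: diff_diff_eq2 add_diff_cancel_left')
qed

lemma Lap_fin_supp:
  assumes \<phi>: "\<phi> \<in> fin_supp V" and x: "x \<in> V"
  shows "m x * Lap \<phi> x = deg x * \<phi> x - (\<Sum>y | \<phi> y \<noteq> 0. b x y * \<phi> y)"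
proof -
  have "((\<lambda>y. b x y * \<phi> y) has_sum (\<Sum>y | \<phi> y \<noteq> 0. b x y * \<phi> y)) V"
    by (rule has_sum_finite_neutralI[OF fin_suppD[OF \<phi>]]) auto
  from has_sum_unique[OF this has_sum_Lap(1)[OF fin_supp_formal_domain[OF \<phi>] x]]
  show ?thesis by simp
qed

text \<open>\<open>Lap \<phi>\<close> can have infinite support when a vertex has infinitely many
  neighbors, so the left side is a genuine series. It is exchanged only with the sum over the
  support of \<open>\<phi>\<close>, which is finite.\<close>

lemma Green_has_sum:
  assumes \<phi>: "\<phi> \<in> fin_supp V" and f: "f \<in> formal_domain V b"
  shows "((\<lambda>x. Lap \<phi> x * f x * m x) has_sum (\<Sum>x | \<phi> x \<noteq> 0. \<phi> x * Lap f x * m x)) V"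
proof -
  let ?K = "{x. \<phi> x \<noteq> 0}"
  have K: "finite ?K" "?K \<subseteq> V" using fin_suppD[OF \<phi>] by auto
  have 1: "((\<lambda>x. deg x * \<phi> x * f x) has_sum (\<Sum>x\<in>?K. deg x * \<phi> x * f x)) V"
    by (rule has_sum_finite_neutralI[OF K]) auto
  have "((\<lambda>x. \<Sum>y\<in>?K. \<phi> y * (b y x * f x)) has_sum (\<Sum>y\<in>?K. \<phi> y * (deg y * f y - m y * Lap f y))) V"
    using K by (intro has_sum_finite_sum has_sum_cmult_right has_sum_Lap f) auto
  from has_sum_add[OF 1 has_sum_uminusI[OF this]]
  have "((\<lambda>x. deg x * \<phi> x * f x + - (\<Sum>y\<in>?K. \<phi> y * (b y x * f x))) has_sum
      (\<Sum>x\<in>?K. \<phi> x * Lap f x * m x)) V"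
    by (simp add: algebra_simps sum_subtractf sum.distrib)
  then show ?thesis
  proof (rule has_sum_cong[THEN iffD1, rotated])
    fix x assume x: "x \<in> V"
    have "(\<Sum>y\<in>?K. \<phi> y * (b y x * f x)) = (\<Sum>y\<in>?K. b x y * \<phi> y) * f x"
      unfolding sum_distrib_right using K x by (intro sum.cong refl) (auto simp: b_sym[of _ x])
    moreover have "Lap \<phi> x * f x * m x = (m x * Lap \<phi> x) * f x" by simp
    ultimately show "deg x * \<phi> x * f x + - (\<Sum>y\<in>?K. \<phi> y * (b y x * f x)) = Lap \<phi> x * f x * m x"
      by (simp add: Lap_fin_supp[OF \<phi> x] left_diff_distrib)
  qed
qed

lemma ell2_inner_fin_supp:
  assumes \<phi>: "\<phi> \<in> fin_supp V"
  shows "ell2_inner V m \<phi> f = (\<Sum>x | \<phi> x \<noteq> 0. \<phi> x * f x * m x)"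
  unfolding ell2_inner_def
  by (rule infsumI, rule has_sum_finite_neutralI[OF fin_suppD[OF \<phi>]]) auto

lemma Green_formula:
  assumes "\<phi> \<in> fin_supp V" "f \<in> formal_domain V b"
  shows "ell2_inner V m (Lap \<phi>) f = ell2_inner V m \<phi> (Lap f)"
  unfolding ell2_inner_fin_supp[OF assms(1)]
  unfolding ell2_inner_def by (rule infsumI[OF Green_has_sum[OF assms]])

lemma ell2_inner_commute: "ell2_inner V m f g = ell2_inner V m g f"
  unfolding ell2_inner_def by (simp add: mult.commute mult.left_commute)

text \<open>The factor \<open>\<psi> x - \<psi> y\<close> is split, so that one part has finitely
  many nonzero rows and the other finitely many nonzero columns. The first sums to the inner
  product, the second is its image under exchange of \<open>x\<close> and \<open>y\<close>; hence
  the factor \<open>2\<close>.\<close>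

lemma energy_has_sum:
  assumes \<phi>: "\<phi> \<in> fin_supp V" and \<psi>: "\<psi> \<in> fin_supp V"
  shows "((\<lambda>(x, y). b x y * ((\<phi> x - \<phi> y) * (\<psi> x - \<psi> y))) has_sum
    2 * ell2_inner V m (Lap \<phi>) \<psi>) (V \<times> V)"
proof -
  define s where "s = ell2_inner V m (Lap \<phi>) \<psi>"
  have s_eq: "s = (\<Sum>x | \<psi> x \<noteq> 0. \<psi> x * (m x * Lap \<phi> x))"
    unfolding s_def ell2_inner_commute[of "Lap \<phi>"] ell2_inner_fin_supp[OF \<psi>]
    by (simp add: mult_ac)
  have 1: "((\<lambda>(x, y). \<psi> x * (b x y * (\<phi> x - \<phi> y))) has_sum s) (V \<times> V)"
    unfolding s_eq using fin_suppD[OF \<psi>] fin_supp_formal_domain[OF \<phi>]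
    by (intro has_sum_Times_finite has_sum_cmult_right has_sum_Lap) auto
  then have 2: "((\<lambda>(x, y). \<psi> y * (b y x * (\<phi> y - \<phi> x))) has_sum s) (V \<times> V)"
    by (subst has_sum_swap) simp
  from has_sum_add[OF 1 2] have "((\<lambda>p. (case p of (x, y) \<Rightarrow> \<psi> x * (b x y * (\<phi> x - \<phi> y))) +
    (case p of (x, y) \<Rightarrow> \<psi> y * (b y x * (\<phi> y - \<phi> x)))) has_sum 2 * s) (V \<times> V)" by simp
  then show ?thesis
    unfolding s_def[symmetric]
    by (rule has_sum_cong[THEN iffD1, rotated]) (auto simp: b_sym algebra_simps)
qed

lemma energy_eq:
  "\<phi> \<in> fin_supp V \<Longrightarrow> \<psi> \<in> fin_supp V \<Longrightarrow> energy V b \<phi> \<psi> = ell2_inner V m (Lap \<phi>) \<psi>"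
  unfolding energy_def by (simp add: infsumI[OF energy_has_sum])

text \<open>A single term of a nonnegative double series. It turns vanishing energy into equality of
  values along an edge.\<close>

lemma edge_le_energy:
  assumes \<phi>: "\<phi> \<in> fin_supp V" and xy: "x \<in> V" "y \<in> V"
  shows "b x y * (\<phi> x - \<phi> y)\<^sup>2 \<le> 2 * ell2_inner V m (Lap \<phi>) \<phi>"
proof -
  have "sum (\<lambda>(x, y). b x y * ((\<phi> x - \<phi> y) * (\<phi> x - \<phi> y))) {(x, y)} \<le> 2 * ell2_inner V m (Lap \<phi>) \<phi>"
    by (rule finite_sum_le_has_sum[OF energy_has_sum[OF \<phi> \<phi>]]) (use xy b_nonneg in auto)
  then show ?thesis by (simp add: power2_eq_square)
qed

lemma energy_nonneg:
  assumes \<phi>: "\<phi> \<in> fin_supp V" shows "0 \<le> ell2_inner V m (Lap \<phi>) \<phi>"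
proof -
  obtain x where "x \<in> V" using infinite_V by fastforce
  then show ?thesis using edge_le_energy[OF \<phi>, of x x] by simp
qed

lemma Lap_outside: "x \<notin> V \<Longrightarrow> Lap f x = 0"
  by (simp add: formal_laplacian_def)

lemma Lap_lincomb:
  assumes \<phi>: "\<phi> \<in> fin_supp V" and \<psi>: "\<psi> \<in> fin_supp V"
  shows "Lap (\<lambda>x. r * \<phi> x + s * \<psi> x) = (\<lambda>x. r * Lap \<phi> x + s * Lap \<psi> x)"
proof
  fix x
  show "Lap (\<lambda>x. r * \<phi> x + s * \<psi> x) x = r * Lap \<phi> x + s * Lap \<psi> x"
  proof (cases "x \<in> V")
    case True
    let ?f = "\<lambda>x. r * \<phi> x + s * \<psi> x"
    have "((\<lambda>y. b x y * (?f x - ?f y)) has_sum (r * (m x * Lap \<phi> x) + s * (m x * Lap \<psi> x))) V"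
      using has_sum_add[OF has_sum_cmult_right[OF has_sum_Lap(2)[OF fin_supp_formal_domain[OF \<phi>] True], of r]
        has_sum_cmult_right[OF has_sum_Lap(2)[OF fin_supp_formal_domain[OF \<psi>] True], of s]]
      by (simp add: algebra_simps)
    from has_sum_unique[OF this has_sum_Lap(2)[OF fin_supp_formal_domain[OF fin_supp_lincomb[OF \<phi> \<psi>]] True]]
    have "m x * Lap ?f x = m x * (r * Lap \<phi> x + s * Lap \<psi> x)" by (simp add: algebra_simps)
    then show ?thesis using m_pos[OF True] by simp
  qed (simp add: Lap_outside)
qed

end

section \<open>Transfer to square-summable sequences\<close>

context wgraph
begin

definition vertex :: "nat \<Rightarrow> 'v" where "vertex = from_nat_into V"

lemma bij_vertex: "bij_betw vertex UNIV V"
  unfolding vertex_def by (rule bij_betw_from_nat_into[OF countable_V infinite_V])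

lemma vertex_in [simp]: "vertex n \<in> V"
  using bij_vertex by (auto simp: bij_betw_def)

lemma vertex_to_nat [simp]: "x \<in> V \<Longrightarrow> vertex (to_nat_on V x) = x"
  unfolding vertex_def by (rule from_nat_into_to_nat_on[OF countable_V])

lemma to_nat_vertex [simp]: "to_nat_on V (vertex n) = n"
  unfolding vertex_def by (rule to_nat_on_from_nat_into_infinite[OF countable_V infinite_V])

text \<open>The square root turns the weighted inner product into the plain one; \<open>U\<close>
  and \<open>W\<close> are inverse isometries between \<open>ell2 V m\<close> and \<open>l2\<close>.
  For functions that are not square-summable the value of \<open>U\<close> is unspecified.\<close>

definition U :: "('v \<Rightarrow> real) \<Rightarrow> l2" where
  "U f = Abs_l2 (\<lambda>n. f (vertex n) * sqrt (m (vertex n)))"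

definition W :: "l2 \<Rightarrow> 'v \<Rightarrow> real" where
  "W h x = (if x \<in> V then nth_l2 h (to_nat_on V x) / sqrt (m x) else 0)"

lemma ell2D: "f \<in> ell2 V m \<Longrightarrow> x \<notin> V \<Longrightarrow> f x = 0"
  "f \<in> ell2 V m \<Longrightarrow> (\<lambda>x. (f x)\<^sup>2 * m x) summable_on V"
  by (auto simp: ell2_def)

lemma summable_vertex_iff:
  "summable (\<lambda>n. (f (vertex n) * sqrt (m (vertex n)))\<^sup>2) \<longleftrightarrow> (\<lambda>x. (f x)\<^sup>2 * m x) summable_on V"
proof -
  have "(\<lambda>n. (f (vertex n) * sqrt (m (vertex n)))\<^sup>2) = (\<lambda>n. (f (vertex n))\<^sup>2 * m (vertex n))"
    using m_pos by (auto simp: power_mult_distrib less_imp_le)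
  moreover have "summable (\<lambda>n. (f (vertex n))\<^sup>2 * m (vertex n))
      \<longleftrightarrow> (\<lambda>n. (f (vertex n))\<^sup>2 * m (vertex n)) summable_on UNIV"
    using m_pos by (intro summable_on_UNIV_nonneg_real_iff[symmetric]) (auto simp: less_imp_le)
  moreover have "\<dots> \<longleftrightarrow> (\<lambda>x. (f x)\<^sup>2 * m x) summable_on V"
    by (rule summable_on_reindex_bij_betw[OF bij_vertex])
  ultimately show ?thesis by simp
qed

lemma nth_U: "f \<in> ell2 V m \<Longrightarrow> nth_l2 (U f) n = f (vertex n) * sqrt (m (vertex n))"
  unfolding U_def by (subst Abs_l2_inverse) (simp_all add: summable_vertex_iff ell2D)

lemma W_vertex: "W h (vertex n) * sqrt (m (vertex n)) = nth_l2 h n"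
  using m_pos[of "vertex n"] by (simp add: W_def)

lemma W_ell2: "W h \<in> ell2 V m"
proof -
  have "summable (\<lambda>n. (W h (vertex n) * sqrt (m (vertex n)))\<^sup>2)"
    unfolding W_vertex using nth_l2[of h] by simp
  then have "(\<lambda>x. (W h x)\<^sup>2 * m x) summable_on V" by (simp only: summable_vertex_iff)
  then show ?thesis by (simp add: ell2_def W_def)
qed

lemma U_W [simp]: "U (W h) = h"
  unfolding U_def W_vertex by (rule nth_l2_inverse)

lemma W_U [simp]: "f \<in> ell2 V m \<Longrightarrow> W (U f) = f"
proof
  fix x assume f: "f \<in> ell2 V m"
  show "W (U f) x = f x"
    using m_pos[of x] ell2D(1)[OF f] by (auto simp: W_def nth_U[OF f])
qed

lemma inner_has_sum:
  assumes f: "f \<in> ell2 V m" and g: "g \<in> ell2 V m"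
  shows "((\<lambda>x. f x * g x * m x) has_sum (U f \<bullet> U g)) V"
proof -
  have eq: "nth_l2 (U f) n * nth_l2 (U g) n = f (vertex n) * g (vertex n) * m (vertex n)" for n
  proof -
    have "sqrt (m (vertex n)) * sqrt (m (vertex n)) = m (vertex n)"
      using m_pos[of "vertex n"] by simp
    then show ?thesis unfolding nth_U[OF f] nth_U[OF g] by (simp add: mult_ac)
  qed
  have "summable (\<lambda>n. norm (nth_l2 (U f) n * nth_l2 (U g) n))"
    unfolding real_norm_def abs_mult
    by (rule summable_mult_of_square_summable) (use nth_l2[of "U f"] nth_l2[of "U g"] in simp_all)
  from norm_summable_imp_has_sum[OF this summable_sums[OF summable_norm_cancel[OF this]]]
  have "((\<lambda>n. f (vertex n) * g (vertex n) * m (vertex n)) has_sum (U f \<bullet> U g)) UNIV"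
    unfolding inner_l2.rep_eq eq .
  then show ?thesis
    using has_sum_reindex_bij_betw[OF bij_vertex, of "\<lambda>x. f x * g x * m x"] by simp
qed

lemma inner_U: "f \<in> ell2 V m \<Longrightarrow> g \<in> ell2 V m \<Longrightarrow> U f \<bullet> U g = ell2_inner V m f g"
  unfolding ell2_inner_def by (rule infsumI[symmetric]) (rule inner_has_sum)

lemma norm_U: "f \<in> ell2 V m \<Longrightarrow> norm (U f) = ell2_norm V m f"
  by (simp add: ell2_norm_def norm_eq_sqrt_inner inner_U)

lemma W_lincomb: "W (r *\<^sub>R h + s *\<^sub>R k) = (\<lambda>x. r * W h x + s * W k x)"
  by (auto simp: W_def plus_l2.rep_eq scaleR_l2.rep_eq add_divide_distrib)

lemma ell2_lincomb:
  assumes f: "f \<in> ell2 V m" and g: "g \<in> ell2 V m"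
  shows "(\<lambda>x. r * f x + s * g x) \<in> ell2 V m"
    and "U (\<lambda>x. r * f x + s * g x) = r *\<^sub>R U f + s *\<^sub>R U g"
proof -
  have eq: "(\<lambda>x. r * f x + s * g x) = W (r *\<^sub>R U f + s *\<^sub>R U g)"
    by (simp add: W_lincomb f g)
  show "(\<lambda>x. r * f x + s * g x) \<in> ell2 V m" "U (\<lambda>x. r * f x + s * g x) = r *\<^sub>R U f + s *\<^sub>R U g"
    unfolding eq by (rule W_ell2, rule U_W)
qed

lemma ell2_diff:
  assumes "f \<in> ell2 V m" "g \<in> ell2 V m"
  shows "(\<lambda>x. f x - g x) \<in> ell2 V m" "U (\<lambda>x. f x - g x) = U f - U g"
  using ell2_lincomb[OF assms, of 1 "-1"] by simp_all

lemma ell2_tendsto_iff: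
  "ell2_tendsto V m \<phi> f F \<longleftrightarrow>
    f \<in> ell2 V m \<and> (\<forall>\<^sub>F i in F. \<phi> i \<in> ell2 V m) \<and> ((\<lambda>i. U (\<phi> i)) \<longlongrightarrow> U f) F"
proof -
  have "((\<lambda>i. ell2_norm V m (\<lambda>x. \<phi> i x - f x)) \<longlongrightarrow> 0) F \<longleftrightarrow> ((\<lambda>i. U (\<phi> i)) \<longlongrightarrow> U f) F"
    if f: "f \<in> ell2 V m" and \<phi>: "\<forall>\<^sub>F i in F. \<phi> i \<in> ell2 V m"
  proof -
    have "\<forall>\<^sub>F i in F. ell2_norm V m (\<lambda>x. \<phi> i x - f x) = norm (U (\<phi> i) - U f)"
      using \<phi> by (rule eventually_mono) (simp add: ell2_diff f flip: norm_U)
    from tendsto_cong[OF this] show ?thesis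
      by (simp add: tendsto_norm_zero_iff LIM_zero_iff)
  qed
  then show ?thesis unfolding ell2_tendsto_def by blast
qed

lemma delta_ell2: "x \<in> V \<Longrightarrow> delta x \<in> ell2 V m"
  by (rule fin_supp_ell2[OF delta_fin_supp])

lemma inner_U_delta:
  assumes "x \<in> V" "f \<in> ell2 V m" shows "U f \<bullet> U (delta x) = f x * m x"
proof -
  have "{y. delta x y \<noteq> 0} = {x}" by (auto simp: delta_def)
  then have "ell2_inner V m (delta x) f = f x * m x"
    using ell2_inner_fin_supp[OF delta_fin_supp[OF assms(1)], of f] by (simp add: delta_def)
  then show ?thesis
    using assms by (simp add: inner_U delta_ell2 ell2_inner_commute[of f])
qed

text \<open>Expansion in the orthogonal family \<open>U (delta y)\<close>. It yields both the
  density of finitely supported functions and the kernel of the heat operators.\<close>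

lemma U_has_sum:
  assumes f: "f \<in> ell2 V m"
  shows "((\<lambda>y. f y *\<^sub>R U (delta y)) has_sum U f) V"
proof -
  \<comment> \<open>Pythagoras: the error is exactly the part of the squared norm outside
    \<open>F\<close>.\<close>
  have sq: "(norm ((\<Sum>y\<in>F. f y *\<^sub>R U (delta y)) - U f))\<^sup>2 = U f \<bullet> U f - (\<Sum>y\<in>F. f y * f y * m y)"
    if F: "finite F" "F \<subseteq> V" for F
  proof -
    let ?s = "\<Sum>y\<in>F. f y *\<^sub>R U (delta y)"
    have 1: "U f \<bullet> ?s = (\<Sum>y\<in>F. f y * f y * m y)"
      unfolding inner_sum_right using F
      by (intro sum.cong refl) (auto simp: inner_U_delta f)
    have "U (delta y) \<bullet> ?s = f y * m y" if "y \<in> F" for y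
    proof -
      have "U (delta y) \<bullet> ?s = (\<Sum>x\<in>F. if x = y then f y * m y else 0)"
        unfolding inner_sum_right using F that
        by (intro sum.cong refl) (auto simp: inner_U_delta[OF subsetD[OF F(2)]] delta_ell2[OF subsetD[OF F(2)]] delta_def)
      then show ?thesis using F that by simp
    qed
    then have "?s \<bullet> ?s = (\<Sum>y\<in>F. f y * f y * m y)"
      unfolding inner_sum_left by (intro sum.cong refl) (simp add: mult_ac)
    then show ?thesis
      using 1 by (simp add: power2_norm_eq_inner inner_diff_left inner_diff_right inner_commute)
  qed
  have "((\<lambda>F. U f \<bullet> U f - (\<Sum>y\<in>F. f y * f y * m y)) \<longlongrightarrow> U f \<bullet> U f - U f \<bullet> U f) (finite_subsets_at_top V)"
    using inner_has_sum[OF f f] unfolding has_sum_def by (intro tendsto_intros)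
  moreover have "\<forall>\<^sub>F F in finite_subsets_at_top V.
      U f \<bullet> U f - (\<Sum>y\<in>F. f y * f y * m y) = (norm ((\<Sum>y\<in>F. f y *\<^sub>R U (delta y)) - U f))\<^sup>2"
    using sq by (intro eventually_finite_subsets_at_top_weakI) auto
  ultimately have "((\<lambda>F. (norm ((\<Sum>y\<in>F. f y *\<^sub>R U (delta y)) - U f))\<^sup>2) \<longlongrightarrow> 0) (finite_subsets_at_top V)"
    using Lim_transform_eventually by fastforce
  from tendsto_real_sqrt[OF this] show ?thesis
    unfolding has_sum_def by (simp add: tendsto_norm_zero_iff LIM_zero_iff)
qed

end

section \<open>The Laplacian as a Friedrichs extension\<close>

locale gap_graph = wgraph V b m for V :: "'v set" and b m +
  assumes Lap_ell2: "formal_laplacian V b m ` fin_supp V \<subseteq> ell2 V m"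
    and gap: "spectral_bottom V b m > 0"
begin

lemma spectral_gap:
  assumes \<phi>: "\<phi> \<in> fin_supp V"
  shows "spectral_bottom V b m * ell2_inner V m \<phi> \<phi> \<le> ell2_inner V m (Lap \<phi>) \<phi>"
proof (cases "\<phi> = (\<lambda>_. 0)")
  case True
  then show ?thesis by (simp add: ell2_inner_def)
next
  case False
  let ?R = "\<lambda>\<phi>. energy V b \<phi> \<phi> / (ell2_norm V m \<phi>)\<^sup>2"
  have sq: "(ell2_norm V m \<phi>)\<^sup>2 = ell2_inner V m \<phi> \<phi>"
    using norm_U[OF fin_supp_ell2[OF \<phi>]] inner_U[OF fin_supp_ell2[OF \<phi>] fin_supp_ell2[OF \<phi>]]
    by (metis power2_norm_eq_inner)
  have "U \<phi> \<noteq> 0"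
  proof
    assume "U \<phi> = 0"
    then have "\<phi> = W 0" using W_U[OF fin_supp_ell2[OF \<phi>]] by simp
    then show False using False by (auto simp: W_def zero_l2.rep_eq)
  qed
  then have pos: "0 < ell2_inner V m \<phi> \<phi>"
    using inner_U[OF fin_supp_ell2[OF \<phi>] fin_supp_ell2[OF \<phi>]] by (metis inner_gt_zero_iff)
  have "bdd_below (?R ` (fin_supp V - {\<lambda>_. 0}))"
    by (rule bdd_belowI2[where m=0]) (auto simp: energy_eq energy_nonneg)
  then have "spectral_bottom V b m \<le> ?R \<phi>"
    unfolding spectral_bottom_def using \<phi> False by (intro cINF_lower) auto
  then show ?thesis using pos by (simp add: sq energy_eq \<phi> field_simps)
qed

definition D :: "l2 set" where "D = U ` fin_supp V"
definition T :: "l2 \<Rightarrow> l2" where "T h = U (Lap (W h))"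

lemma U_in_D: "\<phi> \<in> fin_supp V \<Longrightarrow> U \<phi> \<in> D" by (simp add: D_def)

lemma W_in_fin_supp: "h \<in> D \<Longrightarrow> W h \<in> fin_supp V"
  by (auto simp: D_def fin_supp_ell2)

lemma Lap_fin_supp_ell2: "\<phi> \<in> fin_supp V \<Longrightarrow> Lap \<phi> \<in> ell2 V m"
  using Lap_ell2 by blast

lemma T_U: "\<phi> \<in> fin_supp V \<Longrightarrow> T (U \<phi>) = U (Lap \<phi>)"
  by (simp add: T_def fin_supp_ell2)

lemma D_lincomb:
  assumes "h \<in> D" "k \<in> D"
  shows "r *\<^sub>R h + s *\<^sub>R k \<in> D" "T (r *\<^sub>R h + s *\<^sub>R k) = r *\<^sub>R T h + s *\<^sub>R T k"
proof -
  obtain \<phi> \<psi> where \<phi>: "\<phi> \<in> fin_supp V" "h = U \<phi>" and \<psi>: "\<psi> \<in> fin_supp V" "k = U \<psi>"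
    using assms by (auto simp: D_def)
  have eq: "r *\<^sub>R h + s *\<^sub>R k = U (\<lambda>x. r * \<phi> x + s * \<psi> x)"
    using \<phi> \<psi> by (simp add: ell2_lincomb fin_supp_ell2)
  show "r *\<^sub>R h + s *\<^sub>R k \<in> D"
    unfolding eq by (intro U_in_D fin_supp_lincomb \<phi> \<psi>)
  show "T (r *\<^sub>R h + s *\<^sub>R k) = r *\<^sub>R T h + s *\<^sub>R T k"
    unfolding eq using \<phi> \<psi>
    by (simp add: T_U fin_supp_lincomb Lap_lincomb ell2_lincomb Lap_fin_supp_ell2)
qed

lemma inner_T:
  assumes "\<phi> \<in> fin_supp V" "\<psi> \<in> fin_supp V"
  shows "T (U \<phi>) \<bullet> U \<psi> = ell2_inner V m (Lap \<phi>) \<psi>"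
  using assms by (simp add: T_U inner_U Lap_fin_supp_ell2 fin_supp_ell2)

sublocale friedrichs: coercive_symmetric D T "spectral_bottom V b m"
proof
  show "subspace D"
  proof (rule subspaceI)
    have "(\<lambda>_. 0) \<in> fin_supp V" by (simp add: fin_supp_def)
    moreover have "U (\<lambda>_. 0) = 0"
      using ell2_lincomb(2)[OF W_ell2 W_ell2, of 0 _ 0] by simp
    ultimately show "0 \<in> D" unfolding D_def by (metis imageI)
  next
    fix h k r assume "h \<in> D" "k \<in> D"
    then show "h + k \<in> D" using D_lincomb(1)[of h k 1 1] by simp
  next
    fix h r assume "h \<in> D"
    then show "r *\<^sub>R h \<in> D" using D_lincomb(1)[of h h r 0] by simp
  qed
  fix f g :: l2 and r
  assume f: "f \<in> D"
  then show "T (r *\<^sub>R f) = r *\<^sub>R T f" using D_lincomb(2)[of f f r 0] by simp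
  obtain \<phi> where \<phi>: "\<phi> \<in> fin_supp V" "f = U \<phi>" using f by (auto simp: D_def)
  show "spectral_bottom V b m * (f \<bullet> f) \<le> T f \<bullet> f"
    unfolding \<phi>(2) inner_T[OF \<phi>(1) \<phi>(1)] inner_U[OF fin_supp_ell2[OF \<phi>(1)] fin_supp_ell2[OF \<phi>(1)]]
    by (rule spectral_gap[OF \<phi>(1)])
  assume g: "g \<in> D"
  show "T (f + g) = T f + T g" using D_lincomb(2)[OF f g, of 1 1] by simp
  obtain \<psi> where \<psi>: "\<psi> \<in> fin_supp V" "g = U \<psi>" using g by (auto simp: D_def)
  have "T f \<bullet> g = ell2_inner V m (Lap \<phi>) \<psi>" by (simp add: inner_T \<phi> \<psi>)
  also have "\<dots> = ell2_inner V m \<phi> (Lap \<psi>)"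
    by (rule Green_formula[OF \<phi>(1) fin_supp_formal_domain[OF \<psi>(1)]])
  also have "\<dots> = f \<bullet> T g" by (simp add: inner_T \<phi> \<psi> inner_commute[of "U \<phi>"] ell2_inner_commute[of \<phi>])
  finally show "T f \<bullet> g = f \<bullet> T g" .
next
  show "0 < spectral_bottom V b m" by (rule gap)
  show "closure D = UNIV"
  proof (intro set_eqI iffI UNIV_I)
    fix h
    have "((\<lambda>y. W h y *\<^sub>R U (delta y)) has_sum h) V" using U_has_sum[OF W_ell2, of h] by simp
    then have lim: "((\<lambda>F. \<Sum>y\<in>F. W h y *\<^sub>R U (delta y)) \<longlongrightarrow> h) (finite_subsets_at_top V)"
      by (simp add: has_sum_def)
    have "(\<Sum>y\<in>F. W h y *\<^sub>R U (delta y)) \<in> D" if "finite F" "F \<subseteq> V" for F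
      using that
    proof (induction F rule: finite_induct)
      case empty
      have "(\<lambda>_. 0) \<in> fin_supp V" by (simp add: fin_supp_def)
      moreover have "U (\<lambda>_. 0) = 0"
        using ell2_lincomb(2)[OF W_ell2 W_ell2, of 0 _ 0] by simp
      ultimately show ?case unfolding D_def by (simp add: rev_image_eqI)
    next
      case (insert y F)
      then show ?case
        using D_lincomb(1)[OF U_in_D[OF delta_fin_supp[of y]], of _ "W h y" 1] by simp
    qed
    then have "\<forall>\<^sub>F F in finite_subsets_at_top V. (\<Sum>y\<in>F. W h y *\<^sub>R U (delta y)) \<in> closure D"
      using closure_subset by (intro eventually_finite_subsets_at_top_weakI) blast
    from Lim_in_closed_set[OF closed_closure this _ lim] show "h \<in> closure D" by simp
  qed
qed

sublocale yosida: m_accretive friedrichs.A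
proof
  show "subspace friedrichs.A" by (rule friedrichs.subspace_A)
  show "0 \<le> u \<bullet> f" if "(f, u) \<in> friedrichs.A" for f u
    using friedrichs.A_coercive[OF that] gap
    by (meson inner_ge_zero less_imp_le mult_nonneg_nonneg order_trans)
  show "\<exists>f. (f, h - l *\<^sub>R f) \<in> friedrichs.A" if "0 < l" for h l
    using that by (intro friedrichs.A_range) simp
  show "closure (fst ` friedrichs.A) = UNIV" by (rule friedrichs.A_dense)
qed

section \<open>Closed form and Laplacian in terms of the Friedrichs extension\<close>

lemma form_approx_iff:
  "form_approx V b m \<phi> f \<longleftrightarrow>
    (\<forall>n. \<phi> n \<in> fin_supp V) \<and> f \<in> ell2 V m \<and> friedrichs.approx (\<lambda>n. U (\<phi> n)) (U f)"
proof -
  have "energy V b (\<lambda>x. \<phi> i x - \<phi> j x) (\<lambda>x. \<phi> i x - \<phi> j x) = T (U (\<phi> i) - U (\<phi> j)) \<bullet> (U (\<phi> i) - U (\<phi> j))"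
    if "\<forall>n. \<phi> n \<in> fin_supp V" for i j
  proof -
    have "U (\<phi> i) - U (\<phi> j) = U (\<lambda>x. \<phi> i x - \<phi> j x)" using that by (simp add: ell2_diff fin_supp_ell2)
    then show ?thesis using that by (simp add: energy_eq inner_T fin_supp_diff)
  qed
  then show ?thesis
    unfolding form_approx_def friedrichs.approx_def ell2_tendsto_iff
    by (auto simp: U_in_D fin_supp_ell2)
qed

lemma closed_form_domain_iff:
  "f \<in> closed_form_domain V b m \<longleftrightarrow> f \<in> ell2 V m \<and> (\<exists>\<phi>. friedrichs.approx \<phi> (U f))"
proof
  assume "f \<in> closed_form_domain V b m"
  then show "f \<in> ell2 V m \<and> (\<exists>\<phi>. friedrichs.approx \<phi> (U f))"
    by (auto simp: closed_form_domain_def form_approx_iff)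
next
  assume "f \<in> ell2 V m \<and> (\<exists>\<phi>. friedrichs.approx \<phi> (U f))"
  then obtain \<phi> where f: "f \<in> ell2 V m" and \<phi>: "friedrichs.approx \<phi> (U f)" by blast
  have "form_approx V b m (\<lambda>n. W (\<phi> n)) f"
    unfolding form_approx_iff using f \<phi> by (simp add: W_in_fin_supp friedrichs.approx_def)
  then show "f \<in> closed_form_domain V b m" by (auto simp: closed_form_domain_def)
qed

lemma closed_form_eqI:
  assumes f: "f \<in> closed_form_domain V b m" and h: "h \<in> closed_form_domain V b m"
    and lim: "\<And>\<phi> \<psi>. form_approx V b m \<phi> f \<Longrightarrow> form_approx V b m \<psi> h \<Longrightarrow>
      (\<lambda>n. energy V b (\<phi> n) (\<psi> n)) \<longlonglongrightarrow> c"
  shows "closed_form V b m f h = c"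
  unfolding closed_form_def
proof (rule the_equality)
  show "\<forall>\<phi> \<psi>. form_approx V b m \<phi> f \<longrightarrow> form_approx V b m \<psi> h \<longrightarrow>
      (\<lambda>n. energy V b (\<phi> n) (\<psi> n)) \<longlonglongrightarrow> c" using lim by blast
next
  fix c' assume c': "\<forall>\<phi> \<psi>. form_approx V b m \<phi> f \<longrightarrow> form_approx V b m \<psi> h \<longrightarrow>
      (\<lambda>n. energy V b (\<phi> n) (\<psi> n)) \<longlonglongrightarrow> c'"
  obtain \<phi> \<psi> where "form_approx V b m \<phi> f" "form_approx V b m \<psi> h"
    using f h by (auto simp: closed_form_domain_def)
  then show "c' = c" using c' lim LIMSEQ_unique by blast
qed

lemma energy_U: "\<phi> \<in> fin_supp V \<Longrightarrow> \<psi> \<in> fin_supp V \<Longrightarrow> energy V b \<phi> \<psi> = T (U \<phi>) \<bullet> U \<psi>"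
  by (simp add: energy_eq inner_T)

text \<open>\<open>friedrichs.A\<close> tests against finitely supported functions,
  \<open>laplacian\<close> against the whole form domain. In each direction one argument of the
  closed form lies in the domain of \<open>A\<close>, so \<open>form_tendsto\<close> provides the
  limit that the description in \<open>closed_form\<close> asks for.\<close>

lemma laplacian_iff:
  "(f, u) \<in> laplacian V b m \<longleftrightarrow> f \<in> ell2 V m \<and> u \<in> ell2 V m \<and> (U f, U u) \<in> friedrichs.A"
proof
  assume *: "f \<in> ell2 V m \<and> u \<in> ell2 V m \<and> (U f, U u) \<in> friedrichs.A"
  then have f: "f \<in> closed_form_domain V b m"
    by (auto simp: closed_form_domain_iff friedrichs.A_def)
  have "closed_form V b m f h = ell2_inner V m u h" if h: "h \<in> closed_form_domain V b m" for h
  proof (rule closed_form_eqI[OF f h])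
    fix \<phi> \<psi> assume \<phi>: "form_approx V b m \<phi> f" and \<psi>: "form_approx V b m \<psi> h"
    have "(\<lambda>n. T (U (\<phi> n)) \<bullet> U (\<psi> n)) \<longlonglongrightarrow> U u \<bullet> U h"
      using * \<phi> \<psi> by (intro friedrichs.form_tendsto) (auto simp: form_approx_iff)
    then show "(\<lambda>n. energy V b (\<phi> n) (\<psi> n)) \<longlonglongrightarrow> ell2_inner V m u h"
      using * \<phi> \<psi> by (simp add: form_approx_iff energy_U inner_U)
  qed
  then show "(f, u) \<in> laplacian V b m" using * f by (simp add: laplacian_def)
next
  assume "(f, u) \<in> laplacian V b m"
  then have f: "f \<in> closed_form_domain V b m" "f \<in> ell2 V m" and u: "u \<in> ell2 V m"
    and form: "\<And>h. h \<in> closed_form_domain V b m \<Longrightarrow> closed_form V b m f h = ell2_inner V m u h"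
    by (auto simp: laplacian_def closed_form_domain_iff)
  have "U f \<bullet> T k = U u \<bullet> k" if k: "k \<in> D" for k
  proof -
    obtain \<eta> where \<eta>: "\<eta> \<in> fin_supp V" "k = U \<eta>" using k by (auto simp: D_def)
    then have dom: "\<eta> \<in> closed_form_domain V b m"
      using friedrichs.approx_const[OF k] by (auto simp: closed_form_domain_iff fin_supp_ell2)
    have "closed_form V b m f \<eta> = U f \<bullet> T k"
    proof (rule closed_form_eqI[OF f(1) dom])
      fix \<phi> \<psi> assume \<phi>: "form_approx V b m \<phi> f" and \<psi>: "form_approx V b m \<psi> \<eta>"
      have "(\<lambda>n. T (U (\<psi> n)) \<bullet> U (\<phi> n)) \<longlonglongrightarrow> T k \<bullet> U f"
        using \<phi> \<psi> \<eta>(2) by (intro friedrichs.form_tendsto[OF friedrichs.T_subset_A[OF k]])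
          (auto simp: form_approx_iff)
      moreover have "T (U (\<psi> n)) \<bullet> U (\<phi> n) = energy V b (\<phi> n) (\<psi> n)" for n
        using \<phi> \<psi> friedrichs.T_symmetric[OF U_in_D U_in_D, of "\<psi> n" "\<phi> n"]
        by (simp add: form_approx_iff energy_U inner_commute)
      ultimately show "(\<lambda>n. energy V b (\<phi> n) (\<psi> n)) \<longlonglongrightarrow> U f \<bullet> T k"
        by (simp add: inner_commute)
    qed
    then show ?thesis using form[OF dom] u \<eta> by (simp add: inner_U fin_supp_ell2)
  qed
  then show "f \<in> ell2 V m \<and> u \<in> ell2 V m \<and> (U f, U u) \<in> friedrichs.A"
    using f u by (auto simp: friedrichs.A_def closed_form_domain_iff)
qed

end

section \<open>The Green's function\<close>

lemma bounded_linear_nth_l2: "bounded_linear (\<lambda>h. nth_l2 h n)"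
  by (rule bounded_linear_intro[where K=1]) (simp_all add: plus_l2.rep_eq scaleR_l2.rep_eq abs_nth_l2_le)

lemma uminus_graph_iff:
  fixes w :: "'v \<Rightarrow> real"
  shows "(f, w) \<in> {(f, \<lambda>x. - u x) | f u. (f, u) \<in> R} \<longleftrightarrow> (f, \<lambda>x. - w x) \<in> R"
  by (auto intro!: exI[of _ "\<lambda>x. - w x"])

context wgraph
begin

section \<open>Transfer of semigroups and generators\<close>

lemma ell2_uminus:
  assumes "f \<in> ell2 V m"
  shows "(\<lambda>x. - f x) \<in> ell2 V m" "U (\<lambda>x. - f x) = - U f"
  using ell2_lincomb[OF assms assms, of "-1" 0] by simp_all

lemma semigroup_generator_iff:
  assumes S: "\<And>t f. 0 \<le> t \<Longrightarrow> f \<in> ell2 V m \<Longrightarrow> S t f \<in> ell2 V m"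
  shows "(f, u) \<in> semigroup_generator V m S \<longleftrightarrow>
    f \<in> ell2 V m \<and> u \<in> ell2 V m \<and> (U f, U u) \<in> generator (\<lambda>t h. U (S t (W h)))"
proof -
  have "ell2_tendsto V m (\<lambda>t x. (S t f x - f x) / t) u (at_right 0) \<longleftrightarrow>
      u \<in> ell2 V m \<and> (U f, U u) \<in> generator (\<lambda>t h. U (S t (W h)))" if f: "f \<in> ell2 V m"
  proof -
    have q: "(\<lambda>x. (S t f x - f x) / t) \<in> ell2 V m"
      "U (\<lambda>x. (S t f x - f x) / t) = (U (S t f) - U f) /\<^sub>R t" if "0 < t" for t
      using ell2_lincomb[OF S[OF less_imp_le[OF that] f] f, of "1 / t" "- (1 / t)"]
      by (simp_all add: diff_divide_distrib scaleR_diff_right inverse_eq_divide)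
    have "\<forall>\<^sub>F t in at_right 0. (\<lambda>x. (S t f x - f x) / t) \<in> ell2 V m"
      using eventually_at_right_less by (rule eventually_mono) (rule q)
    moreover have "((\<lambda>t. U (\<lambda>x. (S t f x - f x) / t)) \<longlongrightarrow> U u) (at_right 0) \<longleftrightarrow>
        ((\<lambda>t. (U (S t f) - U f) /\<^sub>R t) \<longlongrightarrow> U u) (at_right 0)"
      by (rule tendsto_cong, rule eventually_mono[OF eventually_at_right_less]) (rule q)
    ultimately show ?thesis by (simp add: ell2_tendsto_iff generator_def f)
  qed
  then show ?thesis by (auto simp: semigroup_generator_def)
qed

lemma strongly_continuous_semigroup_of_C0:
  assumes S: "C0_semigroup V m S"
  shows "strongly_continuous_semigroup (\<lambda>t h. U (S t (W h)))"
proof -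
  have mem: "S t f \<in> ell2 V m" if "0 \<le> t" "f \<in> ell2 V m" for t f
    using S that by (simp add: C0_semigroup_def)
  have lin: "U (S t (\<lambda>x. r * f x + s * g x)) = r *\<^sub>R U (S t f) + s *\<^sub>R U (S t g)"
    if "0 \<le> t" "f \<in> ell2 V m" "g \<in> ell2 V m" for t f g r s
    using S that by (simp add: C0_semigroup_def ell2_lincomb mem)
  have "bounded_linear (\<lambda>h. U (S t (W h)))" if t: "0 \<le> t" for t
  proof -
    have "\<forall>t\<ge>0. \<exists>C. \<forall>f\<in>ell2 V m. ell2_norm V m (S t f) \<le> C * ell2_norm V m f"
      using S by (simp add: C0_semigroup_def)
    then obtain C where C: "\<And>f. f \<in> ell2 V m \<Longrightarrow> ell2_norm V m (S t f) \<le> C * ell2_norm V m f"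
      using t by meson
    show ?thesis
    proof (rule bounded_linear_intro[where K=C])
      fix h k r
      show "U (S t (W (h + k))) = U (S t (W h)) + U (S t (W k))"
        using lin[OF t W_ell2 W_ell2, of 1 h 1 k] W_lincomb[of 1 h 1 k] by simp
      show "U (S t (W (r *\<^sub>R h))) = r *\<^sub>R U (S t (W h))"
        using lin[OF t W_ell2 W_ell2, of r h 0 h] W_lincomb[of r h 0 h] by simp
      show "norm (U (S t (W h))) \<le> norm h * C"
        using C[OF W_ell2, of h] norm_U[OF W_ell2, of h] by (simp add: norm_U mem t W_ell2 mult.commute)
    qed
  qed
  moreover have "((\<lambda>t. U (S t (W h))) \<longlongrightarrow> h) (at_right 0)" for h
  proof -
    have "\<forall>f\<in>ell2 V m. ell2_tendsto V m (\<lambda>t. S t f) f (at_right 0)"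
      using S unfolding C0_semigroup_def by (elim conjE)
    from bspec[OF this W_ell2, of h] show ?thesis by (simp add: ell2_tendsto_iff)
  qed
  moreover have "U (S (s + t) (W h)) = U (S s (W (U (S t (W h)))))" if "0 \<le> s" "0 \<le> t" for s t h
  proof -
    have "\<forall>s\<ge>0. \<forall>t\<ge>0. \<forall>f\<in>ell2 V m. S (s + t) f = S s (S t f)"
      using S unfolding C0_semigroup_def by (elim conjE)
    then show ?thesis using that by (simp add: W_ell2 mem)
  qed
  moreover have "U (S 0 (W h)) = h" for h
  proof -
    have "\<forall>f\<in>ell2 V m. S 0 f = f"
      using S unfolding C0_semigroup_def by (elim conjE)
    then show ?thesis by (simp add: W_ell2)
  qed
  ultimately show ?thesis
    unfolding strongly_continuous_semigroup_def by blast
qed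

lemma C0_semigroup_of_strongly_continuous:
  assumes S: "strongly_continuous_semigroup S"
  shows "C0_semigroup V m (\<lambda>t f. W (S t (U f)))"
  unfolding C0_semigroup_def
proof (intro conjI allI ballI impI)
  have bl: "bounded_linear (S t)" if "0 \<le> t" for t
    using S that by (simp add: strongly_continuous_semigroup_def)
  fix t :: real assume t: "0 \<le> t"
  interpret bounded_linear "S t" by (rule bl[OF t])
  obtain K where K: "\<And>h. norm (S t h) \<le> norm h * K" using bounded by blast
  show "\<exists>C. \<forall>f\<in>ell2 V m. ell2_norm V m (W (S t (U f))) \<le> C * ell2_norm V m f"
  proof (intro exI ballI)
    fix f assume "f \<in> ell2 V m"
    then show "ell2_norm V m (W (S t (U f))) \<le> K * ell2_norm V m f"
      using K[of "U f"] norm_U[OF W_ell2, of "S t (U f)"] by (simp add: norm_U mult.commute)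
  qed
  fix f g \<alpha> \<beta> assume f: "f \<in> ell2 V m"
  show "W (S t (U f)) \<in> ell2 V m" by (rule W_ell2)
  assume g: "g \<in> ell2 V m"
  show "W (S t (U (\<lambda>x. \<alpha> * f x + \<beta> * g x))) = (\<lambda>x. \<alpha> * W (S t (U f)) x + \<beta> * W (S t (U g)) x)"
    by (simp add: ell2_lincomb f g add scaleR W_lincomb)
next
  fix s t :: real and f assume "0 \<le> s" "0 \<le> t" "f \<in> ell2 V m"
  then show "W (S (s + t) (U f)) = W (S s (U (W (S t (U f)))))"
    using S by (simp add: strongly_continuous_semigroup_def)
next
  fix f assume f: "f \<in> ell2 V m"
  then show "W (S 0 (U f)) = f" using S by (simp add: strongly_continuous_semigroup_def)
  show "ell2_tendsto V m (\<lambda>t. W (S t (U f))) f (at_right 0)"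
    using S f by (simp add: ell2_tendsto_iff W_ell2 strongly_continuous_semigroup_def)
qed

end

context gap_graph
begin

abbreviation P :: "real \<Rightarrow> ('v \<Rightarrow> real) \<Rightarrow> 'v \<Rightarrow> real" where
  "P \<equiv> exp_semigroup V m (laplacian V b m)"

text \<open>The transported Yosida semigroup witnesses the choice in \<open>exp_semigroup\<close>.
  Afterwards \<open>P\<close> is used only through these two properties.\<close>

lemma exp_semigroup_laplacian:
  "C0_semigroup V m P"
  "semigroup_generator V m P = {(f, \<lambda>x. - u x) | f u. (f, u) \<in> laplacian V b m}"
proof -
  let ?S = "\<lambda>t f. W (yosida.S t (U f))"
  have 1: "C0_semigroup V m ?S"
    by (rule C0_semigroup_of_strongly_continuous[OF yosida.Hille_Yosida(1)])
  have "(f, w) \<in> semigroup_generator V m ?S \<longleftrightarrow>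
      (f, w) \<in> {(f, \<lambda>x. - u x) | f u. (f, u) \<in> laplacian V b m}" for f w
  proof -
    have "(f, w) \<in> semigroup_generator V m ?S \<longleftrightarrow>
        f \<in> ell2 V m \<and> w \<in> ell2 V m \<and> (U f, U w) \<in> generator yosida.S"
      by (subst semigroup_generator_iff) (simp_all add: W_ell2)
    also have "\<dots> \<longleftrightarrow> f \<in> ell2 V m \<and> w \<in> ell2 V m \<and> (U f, - U w) \<in> friedrichs.A"
      unfolding yosida.Hille_Yosida(2) by (auto simp: equation_minus_iff)
    also have "\<dots> \<longleftrightarrow> (f, \<lambda>x. - w x) \<in> laplacian V b m"
    proof -
      have "w \<in> ell2 V m \<longleftrightarrow> (\<lambda>x. - w x) \<in> ell2 V m"
        using ell2_uminus(1)[of w] ell2_uminus(1)[of "\<lambda>x. - w x"] by auto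
      then show ?thesis by (auto simp: laplacian_iff ell2_uminus)
    qed
    also have "\<dots> \<longleftrightarrow> (f, w) \<in> {(f, \<lambda>x. - u x) | f u. (f, u) \<in> laplacian V b m}"
      by (simp only: uminus_graph_iff)
    finally show ?thesis .
  qed
  then have 2: "semigroup_generator V m ?S = {(f, \<lambda>x. - u x) | f u. (f, u) \<in> laplacian V b m}"
    by (intro set_eqI) (simp only: split_paired_all)
  let ?Q = "\<lambda>S. C0_semigroup V m S \<and>
      semigroup_generator V m S = {(f, \<lambda>x. - u x) | f u. (f, u) \<in> laplacian V b m}"
  have "?Q P"
    unfolding exp_semigroup_def by (rule someI[of ?Q ?S]) (intro conjI 1 2)
  then show "C0_semigroup V m P"
    "semigroup_generator V m P = {(f, \<lambda>x. - u x) | f u. (f, u) \<in> laplacian V b m}"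
    by (rule conjunct1, rule conjunct2)
qed

lemma P_ell2: "0 \<le> t \<Longrightarrow> f \<in> ell2 V m \<Longrightarrow> P t f \<in> ell2 V m"
  using exp_semigroup_laplacian(1) by (simp add: C0_semigroup_def)

sublocale heat: coercive_semigroup "\<lambda>t h. U (P t (W h))" friedrichs.A "spectral_bottom V b m"
proof
  show "strongly_continuous_semigroup (\<lambda>t h. U (P t (W h)))"
    by (rule strongly_continuous_semigroup_of_C0[OF exp_semigroup_laplacian(1)])
  show "generator (\<lambda>t h. U (P t (W h))) = {(f, - u) | f u. (f, u) \<in> friedrichs.A}"
  proof (intro set_eqI)
    fix p :: "l2 \<times> l2"
    obtain h k where p: "p = (h, k)" by (cases p)
    have "p \<in> generator (\<lambda>t h. U (P t (W h))) \<longleftrightarrow> (W h, W k) \<in> semigroup_generator V m P"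
      unfolding p by (subst semigroup_generator_iff) (simp_all add: P_ell2 W_ell2)
    also have "\<dots> \<longleftrightarrow> (W h, \<lambda>x. - W k x) \<in> laplacian V b m"
      unfolding exp_semigroup_laplacian(2) by (simp only: uminus_graph_iff)
    also have "\<dots> \<longleftrightarrow> (h, - k) \<in> friedrichs.A"
      by (simp add: laplacian_iff W_ell2 ell2_uminus)
    also have "\<dots> \<longleftrightarrow> p \<in> {(f, - u) | f u. (f, u) \<in> friedrichs.A}"
      unfolding p by (auto simp: equation_minus_iff)
    finally show "p \<in> generator (\<lambda>t h. U (P t (W h))) \<longleftrightarrow> p \<in> {(f, - u) | f u. (f, u) \<in> friedrichs.A}" .
  qed
  show "spectral_bottom V b m * (f \<bullet> f) \<le> u \<bullet> f" if "(f, u) \<in> friedrichs.A" for f u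
    using that by (rule friedrichs.A_coercive)
qed (rule gap friedrichs.A_dense)+

text \<open>Evaluation of \<open>P t\<close> at \<open>x\<close> is a bounded functional, so the
  expansion of \<open>f\<close> along \<open>delta y\<close> shows that
  \<open>P t (delta y) x / m y\<close> is a kernel and the choice is meaningful. The chosen kernel
  is then determined by testing with \<open>delta y\<close>.\<close>

lemma heat_kernel_eq:
  assumes t: "0 \<le> t" and x: "x \<in> V" and y: "y \<in> V"
  shows "heat_kernel V b m t x y * m y = P t (delta y) x"
proof -
  let ?Q = "\<lambda>p. \<forall>t\<ge>0. \<forall>f\<in>ell2 V m. \<forall>x\<in>V. ((\<lambda>y. p t x y * f y * m y) has_sum P t f x) V"
  have "?Q (\<lambda>t x y. P t (delta y) x / m y)"
  proof (intro allI ballI impI)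
    fix t f x assume t: "(0::real) \<le> t" and f: "f \<in> ell2 V m" and x: "x \<in> V"
    define l where "l h = nth_l2 (U (P t (W h))) (to_nat_on V x) / sqrt (m x)" for h
    have l_eq: "l h = P t (W h) x" for h
      unfolding l_def using W_U[OF P_ell2[OF t W_ell2], of h] x by (metis W_def)
    have bl: "bounded_linear l"
      unfolding l_def using t
      by (intro bounded_linear_divide[THEN bounded_linear_compose]
          bounded_linear_nth_l2[THEN bounded_linear_compose] heat.bounded_linear_S)
    have "((\<lambda>y. l (f y *\<^sub>R U (delta y))) has_sum P t f x) V"
      using has_sum_bounded_linear[OF bl U_has_sum[OF f]] by (simp add: l_eq f)
    moreover have "l (f y *\<^sub>R U (delta y)) = f y * P t (delta y) x" if "y \<in> V" for y
      using linear_cmul[OF bounded_linear.linear[OF bl], of "f y" "U (delta y)"] l_eq[of "U (delta y)"] that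
      by (simp add: delta_ell2)
    ultimately have "((\<lambda>y. f y * P t (delta y) x) has_sum P t f x) V"
      by (simp cong: has_sum_cong)
    moreover have "P t (delta y) x / m y * f y * m y = f y * P t (delta y) x" if "y \<in> V" for y
      using m_pos[OF that] by simp
    ultimately show "((\<lambda>y. P t (delta y) x / m y * f y * m y) has_sum P t f x) V"
      by (simp cong: has_sum_cong)
  qed
  then have "?Q (heat_kernel V b m)"
    unfolding heat_kernel_def by (rule someI[of ?Q])
  from this[rule_format, OF t delta_ell2[OF y] x]
  have "((\<lambda>z. heat_kernel V b m t x z * delta y z * m z) has_sum P t (delta y) x) V" .
  moreover have "((\<lambda>z. heat_kernel V b m t x z * delta y z * m z) has_sum heat_kernel V b m t x y * m y) V"
    by (rule has_sum_finite_neutralI[of "{y}"]) (use y in \<open>auto simp: delta_def\<close>)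
  ultimately show ?thesis using has_sum_unique by blast
qed

text \<open>The kernel at \<open>v\<close> and \<open>x\<close>, times \<open>m x * m v\<close>, is
  the pairing of the evolved \<open>delta x\<close> with \<open>delta v\<close>. Integration over
  time turns the evolved \<open>delta x\<close> into the solution \<open>u\<close> of
  \<open>A u = delta x\<close>, and symmetry of \<open>A\<close> trades it for the solution
  \<open>w\<close> with datum \<open>delta v\<close>. That \<open>u\<close> exists is the case
  \<open>l = 0\<close> of \<open>A_range\<close>, which rests on the spectral gap.\<close>

lemma green_eq:
  assumes v: "v \<in> V" and x: "x \<in> V" and w: "(w, U (delta v)) \<in> friedrichs.A"
  shows "green V b m v x = W w x / m v"
proof -
  obtain u where u: "(u, U (delta x)) \<in> friedrichs.A"
    using friedrichs.A_range[of 0 "U (delta x)"] by auto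
  have "U (P t (W (U (delta x)))) \<bullet> U (delta v) = heat_kernel V b m t v x * (m x * m v)"
    if "0 \<le> t" for t
    using that heat_kernel_eq[OF that v x] by (simp add: inner_U_delta P_ell2 delta_ell2 v x mult.assoc[symmetric])
  then have "(LINT t:{0..}|lborel. U (P t (W (U (delta x)))) \<bullet> U (delta v))
      = (LINT t:{0..}|lborel. heat_kernel V b m t v x * (m x * m v))"
    by (intro set_lebesgue_integral_cong) auto
  also have "\<dots> = green V b m v x * (m x * m v)"
    unfolding green_def set_lebesgue_integral_def by (simp flip: mult.assoc)
  finally have "u \<bullet> U (delta v) = green V b m v x * (m x * m v)"
    using heat.integral_S[OF u, of "U (delta v)"] by simp
  moreover have "U (delta x) \<bullet> w = u \<bullet> U (delta v)"
    by (rule friedrichs.A_symmetric[OF u w])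
  moreover have "w \<bullet> U (delta x) = W w x * m x"
    using inner_U_delta[OF x W_ell2, of w] by simp
  ultimately show ?thesis
    using m_pos[OF v] m_pos[OF x] by (simp add: inner_commute field_simps)
qed

text \<open>Away from \<open>y\<close>, the product \<open>m x * Lap (delta y) x\<close> is
  \<open>- b y x\<close>. So the series is dominated by the pairing of two square-summable
  functions; square-summability of \<open>Lap (delta y)\<close> is what \<open>Lap_ell2\<close>
  provides.\<close>

lemma ell2_formal_domain:
  assumes f: "f \<in> ell2 V m" shows "f \<in> formal_domain V b"
  unfolding formal_domain_def
proof (intro CollectI ballI)
  fix y assume y: "y \<in> V"
  have "(\<lambda>x. norm (Lap (delta y) x * f x * m x)) summable_on V"
    by (rule summable_on_iff_abs_summable_on_real[THEN iffD1],
        rule has_sum_imp_summable, rule inner_has_sum[OF Lap_fin_supp_ell2[OF delta_fin_supp[OF y]] f])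
  then show "(\<lambda>x. b y x * \<bar>f x\<bar>) summable_on V"
  proof (rule summable_on_comparison_test)
    fix x assume x: "x \<in> V"
    show "0 \<le> b y x * \<bar>f x\<bar>" using b_nonneg x y by simp
    show "b y x * \<bar>f x\<bar> \<le> norm (Lap (delta y) x * f x * m x)"
    proof (cases "x = y")
      case False
      have "{z. delta y z \<noteq> 0} = {y}" by (auto simp: delta_def)
      then have "m x * Lap (delta y) x = - b y x"
        using Lap_fin_supp[OF delta_fin_supp[OF y] x] False by (simp add: delta_def b_sym[OF x y])
      moreover have "Lap (delta y) x * f x * m x = (m x * Lap (delta y) x) * f x" by simp
      ultimately have "Lap (delta y) x * f x * m x = - (b y x * f x)" by simp
      then show ?thesis using b_nonneg x y by (simp add: abs_mult)
    qed (use b_refl y in simp)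
  qed
qed

text \<open>The solution \<open>w\<close> satisfies \<open>A w = delta v\<close> only weakly.
  Testing with \<open>delta x\<close> and moving the Laplacian by Green's formula, permitted because
  square-summable functions lie in the formal domain, gives the pointwise equation.\<close>

theorem green_function:
  assumes v: "v \<in> V"
  obtains g where "g \<in> ell2 V m" "g \<in> formal_domain V b"
    "\<And>x. x \<in> V \<Longrightarrow> Lap g x = delta v x / m v" "\<And>x. x \<in> V \<Longrightarrow> green V b m v x = g x"
proof -
  obtain w where w: "(w, U (delta v)) \<in> friedrichs.A"
    using friedrichs.A_range[of 0 "U (delta v)"] by auto
  define g where "g = W ((1 / m v) *\<^sub>R w)"
  have g: "g \<in> ell2 V m" by (simp add: g_def W_ell2)
  have "Lap g x = delta v x / m v" if x: "x \<in> V" for x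
  proof -
    have "{z. delta x z \<noteq> 0} = {x}" by (auto simp: delta_def)
    then have "Lap g x * m x = ell2_inner V m (delta x) (Lap g)"
      using ell2_inner_fin_supp[OF delta_fin_supp[OF x], of "Lap g"] by (simp add: delta_def)
    also have "\<dots> = ell2_inner V m (Lap (delta x)) g"
      by (rule Green_formula[OF delta_fin_supp[OF x] ell2_formal_domain[OF g], symmetric])
    also have "\<dots> = U g \<bullet> T (U (delta x))"
      by (simp add: T_U delta_fin_supp x inner_U Lap_fin_supp_ell2 g ell2_inner_commute)
    also have "\<dots> = (1 / m v) * (w \<bullet> T (U (delta x)))" by (simp add: g_def)
    also have "w \<bullet> T (U (delta x)) = U (delta v) \<bullet> U (delta x)"
      using w U_in_D[OF delta_fin_supp[OF x]] by (auto simp: friedrichs.A_def)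
    also have "\<dots> = delta v x * m x" by (rule inner_U_delta[OF x delta_ell2[OF v]])
    finally have "Lap g x * m x = (delta v x / m v) * m x" by simp
    then show ?thesis using m_pos[OF x] by (simp only: mult_right_cancel less_imp_neq[symmetric] not_False_eq_True)
  qed
  moreover have "green V b m v x = g x" if "x \<in> V" for x
    using green_eq[OF v that w] W_lincomb[of "1 / m v" w 0 w] by (simp add: g_def)
  ultimately show ?thesis using that g ell2_formal_domain[OF g] by blast
qed

end

section \<open>Harmonic functions and essential self-adjointness\<close>

context wgraph
begin

lemma component_of:
  assumes p: "p \<in> V"
  defines "Z \<equiv> {q \<in> V. (\<lambda>u w. u \<in> V \<and> w \<in> V \<and> b u w > 0)\<^sup>*\<^sup>* p q}"
  shows "graph_component V b Z"
proof -
  let ?R = "\<lambda>A u w. u \<in> A \<and> w \<in> A \<and> b u w > 0"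
  have sym: "symp (?R Z)"
  proof (rule sympI)
    fix x y assume "?R Z x y"
    then show "?R Z y x" using b_sym[of x y] by (simp add: Z_def)
  qed
  have Z: "Z \<subseteq> V" by (auto simp: Z_def)
  \<comment> \<open>\<open>graph_connected\<close> asks for paths inside \<open>Z\<close> itself;
    every intermediate vertex of a path from \<open>p\<close> is again reachable from
    \<open>p\<close>.\<close>
  have path: "(?R Z)\<^sup>*\<^sup>* p q" if "(?R V)\<^sup>*\<^sup>* p q" for q
    using that
  proof (induction rule: rtranclp_induct)
    case (step y z)
    have "?R Z y z"
      using step.hyps rtranclp.rtrancl_into_rtrancl[OF step.hyps] by (simp add: Z_def)
    then show ?case by (rule rtranclp.rtrancl_into_rtrancl[OF step.IH])
  qed simp
  have "graph_connected Z b"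
    unfolding graph_connected_def
  proof (intro ballI)
    fix x y assume "x \<in> Z" "y \<in> Z"
    then have "(?R Z)\<^sup>*\<^sup>* p x" "(?R Z)\<^sup>*\<^sup>* p y" using path by (auto simp: Z_def)
    moreover have "(?R Z)\<^sup>*\<^sup>* x p"
      using sympD[OF symp_rtranclp[OF sym]] calculation(1) by blast
    ultimately show "(?R Z)\<^sup>*\<^sup>* x y" by simp
  qed
  moreover have "Z' = Z" if Z': "Z \<subseteq> Z'" "Z' \<subseteq> V" "graph_connected Z' b" for Z'
  proof (intro equalityI subsetI)
    fix q assume q: "q \<in> Z'"
    have "p \<in> Z'" using p Z' by (auto simp: Z_def)
    then have "(?R Z')\<^sup>*\<^sup>* p q" using Z'(3) q by (simp add: graph_connected_def)
    then have "(?R V)\<^sup>*\<^sup>* p q"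
      by (rule rtranclp_mono[THEN predicate2D, rotated]) (use Z'(2) in auto)
    then show "q \<in> Z" using q Z'(2) by (auto simp: Z_def)
  qed (use Z' in auto)
  moreover have "Z \<noteq> {}" using p by (auto simp: Z_def)
  ultimately show ?thesis using Z unfolding graph_component_def by blast
qed

lemma ell2_tendsto_pointwise:
  assumes "ell2_tendsto V m \<phi> f F" "x \<in> V"
  shows "((\<lambda>i. \<phi> i x) \<longlongrightarrow> f x) F"
proof -
  have f: "f \<in> ell2 V m" and \<phi>: "\<forall>\<^sub>F i in F. \<phi> i \<in> ell2 V m"
    and lim: "((\<lambda>i. U (\<phi> i)) \<longlongrightarrow> U f) F"
    using assms(1) by (auto simp: ell2_tendsto_iff)
  have "((\<lambda>i. U (\<phi> i) \<bullet> U (delta x) / m x) \<longlongrightarrow> U f \<bullet> U (delta x) / m x) F"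
    using m_pos[OF assms(2)] by (intro tendsto_intros lim) auto
  moreover have "U f \<bullet> U (delta x) / m x = f x"
    using inner_U_delta[OF assms(2) f] m_pos[OF assms(2)] by simp
  moreover have "\<forall>\<^sub>F i in F. U (\<phi> i) \<bullet> U (delta x) / m x = \<phi> i x"
    using \<phi> by (rule eventually_mono) (use inner_U_delta[OF assms(2)] m_pos[OF assms(2)] in simp)
  ultimately show ?thesis using Lim_transform_eventually by fastforce
qed

text \<open>A square-summable harmonic \<open>f\<close> is in the kernel of the adjoint of the minimal Laplacian. If
  the closure were self-adjoint, then finitely supported \<open>\<phi>\<^sub>n \<rightarrow> f\<close> with \<open>\<L>\<phi>\<^sub>n \<rightarrow> 0\<close> would have
  energies \<open>\<langle>\<L>\<phi>\<^sub>n, \<phi>\<^sub>n\<rangle> \<rightarrow> 0\<close>, so that \<open>f\<close> would be constant along edges.\<close>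

lemma not_essentially_self_adjoint:
  assumes f: "f \<in> ell2 V m" and harm: "harmonic V b m f"
    and xy: "x \<in> V" "y \<in> V" "0 < b x y" "f x \<noteq> f y"
  shows "\<not> essentially_self_adjoint V m (minimal_laplacian V b m)"
proof
  let ?C = "operator_closure V m (minimal_laplacian V b m)"
  assume "essentially_self_adjoint V m (minimal_laplacian V b m)"
  then have sa: "operator_adjoint V m ?C = ?C"
    by (simp add: essentially_self_adjoint_def self_adjoint_def)
  have dom: "f \<in> formal_domain V b" and Lf: "Lap f = (\<lambda>_. 0)"
    using harm Lap_outside[of _ f] by (auto simp: harmonic_def)
  have zero: "(\<lambda>_. 0) \<in> ell2 V m" by (simp add: ell2_def)
  have U_zero: "U (\<lambda>_. 0) = 0"
    using ell2_lincomb(2)[OF f f, of 0 0] by simp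
  have "(f, \<lambda>_. 0) \<in> operator_adjoint V m ?C"
    unfolding operator_adjoint_def
  proof (clarsimp simp: f zero)
    fix \<phi> \<psi> assume "(\<phi>, \<psi>) \<in> ?C"
    then obtain \<Phi> \<Psi> where T: "\<And>n. (\<Phi> n, \<Psi> n) \<in> minimal_laplacian V b m"
      and lim: "ell2_tendsto V m \<Psi> \<psi> sequentially"
      by (auto simp: operator_closure_def)
    have \<Psi>: "\<psi> \<in> ell2 V m" "\<forall>\<^sub>F n in sequentially. \<Psi> n \<in> ell2 V m" "(\<lambda>n. U (\<Psi> n)) \<longlonglongrightarrow> U \<psi>"
      using lim by (auto simp: ell2_tendsto_iff)
    have "ell2_inner V m (\<Psi> n) f = 0" for n
    proof -
      have "\<Phi> n \<in> fin_supp V" "\<Psi> n = Lap (\<Phi> n)" using T[of n] by (auto simp: minimal_laplacian_def)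
      then show ?thesis using Green_formula[OF _ dom, of "\<Phi> n"] by (simp add: Lf ell2_inner_def)
    qed
    then have "\<forall>\<^sub>F n in sequentially. U (\<Psi> n) \<bullet> U f = 0"
      using \<Psi>(2) by (auto elim!: eventually_mono simp: inner_U f)
    with tendsto_inner[OF \<Psi>(3) tendsto_const[of "U f"]]
    have "(\<lambda>n. 0) \<longlonglongrightarrow> U \<psi> \<bullet> U f" by (rule Lim_transform_eventually)
    then have "U \<psi> \<bullet> U f = 0" by (simp add: LIMSEQ_const_iff)
    then show "ell2_inner V m \<psi> f = ell2_inner V m \<phi> (\<lambda>_. 0)"
      using inner_U[OF \<Psi>(1) f] by (simp add: ell2_inner_def)
  qed
  then have "(f, \<lambda>_. 0) \<in> ?C" unfolding sa .
  then obtain \<Phi> \<Psi> where T: "\<And>n. (\<Phi> n, \<Psi> n) \<in> minimal_laplacian V b m"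
    and lim: "ell2_tendsto V m \<Phi> f sequentially" "ell2_tendsto V m \<Psi> (\<lambda>_. 0) sequentially"
    by (auto simp: operator_closure_def)
  have \<Phi>: "\<Phi> n \<in> fin_supp V" and \<Psi>: "\<Psi> n = Lap (\<Phi> n)" for n
    using T[of n] by (auto simp: minimal_laplacian_def)
  have "(\<lambda>n. 2 * (U (\<Psi> n) \<bullet> U (\<Phi> n))) \<longlonglongrightarrow> 2 * (0 \<bullet> U f)"
    using lim U_zero by (intro tendsto_intros) (auto simp: ell2_tendsto_iff)
  moreover have "(\<lambda>n. b x y * (\<Phi> n x - \<Phi> n y)\<^sup>2) \<longlonglongrightarrow> b x y * (f x - f y)\<^sup>2"
    by (intro tendsto_intros ell2_tendsto_pointwise[OF lim(1)] xy)
  moreover have "\<forall>\<^sub>F n in sequentially. b x y * (\<Phi> n x - \<Phi> n y)\<^sup>2 \<le> 2 * (U (\<Psi> n) \<bullet> U (\<Phi> n))"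
  proof -
    have "\<forall>\<^sub>F n in sequentially. \<Psi> n \<in> ell2 V m" using lim(2) by (simp add: ell2_tendsto_iff)
    then show ?thesis
      using edge_le_energy[OF \<Phi> xy(1,2)] by (auto elim!: eventually_mono simp: inner_U fin_supp_ell2 \<Phi> \<Psi>)
  qed
  ultimately have "b x y * (f x - f y)\<^sup>2 \<le> 2 * (0 \<bullet> U f)"
    by (intro tendsto_le[OF sequentially_bot])
  then show False using xy(3,4) by (simp add: mult_le_0_iff)
qed

end

section \<open>The modified graph\<close>

locale modified = gap_graph X b m for X :: "'a set" and b m +
  fixes v :: 'a and b\<^sub>o :: "'a vertex \<Rightarrow> 'a vertex \<Rightarrow> real" and m\<^sub>o :: "'a vertex \<Rightarrow> real"
  assumes v: "v \<in> X"
    and finite_neighbors: "finite (neighbors X b v)"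
    and modified_graph: "modified_graph X b m v b\<^sub>o m\<^sub>o"
    and ray_summable: "x \<in> ray_neighbors X b m v \<Longrightarrow>
      (\<lambda>r. (\<Sum>n=1..r. 1 / b\<^sub>o (Ray x n) (Ray x (n + 1)))\<^sup>2 * m\<^sub>o (Ray x (r + 1))) summable_on {1..}"
begin

abbreviation "N \<equiv> ray_neighbors X b m v"
abbreviation "K \<equiv> cap_neighbors X b m v"
abbreviation "Y \<equiv> modified_vertices X b m v"

lemma N_subset: "x \<in> N \<Longrightarrow> x \<in> X \<and> x \<noteq> v \<and> 0 < b v x"
  using b_refl[OF v] by (auto simp: ray_neighbors_def neighbors_def)

lemma K_subset: "x \<in> K \<Longrightarrow> x \<in> X \<and> x \<noteq> v \<and> 0 < b v x"
  using b_refl[OF v] by (auto simp: cap_neighbors_def neighbors_def)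

lemma N_K_disjoint: "x \<in> N \<Longrightarrow> x \<notin> K"
  by (auto simp: ray_neighbors_def cap_neighbors_def)

lemma N_K_cover: "x \<in> X \<Longrightarrow> 0 < b v x \<Longrightarrow> x \<in> N \<or> x \<in> K"
  by (auto simp: ray_neighbors_def cap_neighbors_def neighbors_def)

lemma finite_N: "finite N" and finite_K: "finite K"
  using finite_neighbors by (auto simp: ray_neighbors_def cap_neighbors_def)

lemma Old_in_Y [simp]: "Old x \<in> Y \<longleftrightarrow> x \<in> X \<and> x \<noteq> v"
  and Ray_in_Y [simp]: "Ray x n \<in> Y \<longleftrightarrow> x \<in> N \<and> 1 \<le> n"
  and Cap_in_Y [simp]: "Cap x \<in> Y \<longleftrightarrow> x \<in> K"
  by (auto simp: modified_vertices_def)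

lemma
  shows bo_nonneg: "p \<in> Y \<Longrightarrow> q \<in> Y \<Longrightarrow> 0 \<le> b\<^sub>o p q"
    and bo_sym: "p \<in> Y \<Longrightarrow> q \<in> Y \<Longrightarrow> b\<^sub>o p q = b\<^sub>o q p"
    and bo_Old_Old: "x \<in> X \<Longrightarrow> x \<noteq> v \<Longrightarrow> y \<in> X \<Longrightarrow> y \<noteq> v \<Longrightarrow> b\<^sub>o (Old x) (Old y) = b x y"
    and bo_Old_Ray_pos: "x \<in> N \<Longrightarrow> 0 < b\<^sub>o (Old x) (Ray x 1)"
    and bo_Ray_Ray_iff: "x \<in> N \<Longrightarrow> 1 \<le> j \<Longrightarrow> 1 \<le> k \<Longrightarrow>
      0 < b\<^sub>o (Ray x j) (Ray x k) \<longleftrightarrow> \<bar>int j - int k\<bar> = 1"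
    and bo_Old_Cap_pos: "x \<in> K \<Longrightarrow> 0 < b\<^sub>o (Old x) (Cap x)"
    and bo_Old_Ray_zero: "y \<in> X \<Longrightarrow> y \<noteq> v \<Longrightarrow> x \<in> N \<Longrightarrow> 1 \<le> j \<Longrightarrow> \<not> (y = x \<and> j = 1) \<Longrightarrow>
      b\<^sub>o (Old y) (Ray x j) = 0"
    and bo_Old_Cap_zero: "y \<in> X \<Longrightarrow> y \<noteq> v \<Longrightarrow> x \<in> K \<Longrightarrow> y \<noteq> x \<Longrightarrow> b\<^sub>o (Old y) (Cap x) = 0"
    and bo_Ray_Ray_zero: "x \<in> N \<Longrightarrow> y \<in> N \<Longrightarrow> 1 \<le> j \<Longrightarrow> 1 \<le> k \<Longrightarrow> x \<noteq> y \<Longrightarrow>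
      b\<^sub>o (Ray x j) (Ray y k) = 0"
    and bo_Ray_Cap: "x \<in> N \<Longrightarrow> 1 \<le> j \<Longrightarrow> y \<in> K \<Longrightarrow> b\<^sub>o (Ray x j) (Cap y) = 0"
    and bo_Cap_Cap: "x \<in> K \<Longrightarrow> y \<in> K \<Longrightarrow> b\<^sub>o (Cap x) (Cap y) = 0"
    and mo_Old: "x \<in> X \<Longrightarrow> x \<noteq> v \<Longrightarrow> m\<^sub>o (Old x) = m x"
    and mo_pos: "p \<in> Y \<Longrightarrow> 0 < m\<^sub>o p"
proof -
  note mg = modified_graph[unfolded modified_graph_def Let_def]
  note mg1 = mg[THEN conjunct1] and mgs1 = mg[THEN conjunct2]
  note mg2 = mgs1[THEN conjunct1] and mgs2 = mgs1[THEN conjunct2]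
  note mg3 = mgs2[THEN conjunct1] and mgs3 = mgs2[THEN conjunct2]
  note mg4 = mgs3[THEN conjunct1] and mgs4 = mgs3[THEN conjunct2]
  note mg5 = mgs4[THEN conjunct1] and mgs5 = mgs4[THEN conjunct2]
  note mg6 = mgs5[THEN conjunct1] and mgs6 = mgs5[THEN conjunct2]
  note mg7 = mgs6[THEN conjunct1] and mgs7 = mgs6[THEN conjunct2]
  note mg8 = mgs7[THEN conjunct1] and mgs8 = mgs7[THEN conjunct2]
  note mg9 = mgs8[THEN conjunct1] and mgs9 = mgs8[THEN conjunct2]
  note mg10 = mgs9[THEN conjunct1] and mgs10 = mgs9[THEN conjunct2]
  note mg11 = mgs10[THEN conjunct1] and mg12 = mgs10[THEN conjunct2]
  show "p \<in> Y \<Longrightarrow> q \<in> Y \<Longrightarrow> 0 \<le> b\<^sub>o p q" "p \<in> Y \<Longrightarrow> q \<in> Y \<Longrightarrow> b\<^sub>o p q = b\<^sub>o q p"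
    using mg1 by blast+
  show "x \<in> X \<Longrightarrow> x \<noteq> v \<Longrightarrow> y \<in> X \<Longrightarrow> y \<noteq> v \<Longrightarrow> b\<^sub>o (Old x) (Old y) = b x y"
    using mg2 by blast
  show "x \<in> N \<Longrightarrow> 0 < b\<^sub>o (Old x) (Ray x 1)" using mg3 by blast
  show "x \<in> N \<Longrightarrow> 1 \<le> j \<Longrightarrow> 1 \<le> k \<Longrightarrow> 0 < b\<^sub>o (Ray x j) (Ray x k) \<longleftrightarrow> \<bar>int j - int k\<bar> = 1"
    using mg4 by blast
  show "x \<in> K \<Longrightarrow> 0 < b\<^sub>o (Old x) (Cap x)" using mg5 by blast
  show "y \<in> X \<Longrightarrow> y \<noteq> v \<Longrightarrow> x \<in> N \<Longrightarrow> 1 \<le> j \<Longrightarrow> \<not> (y = x \<and> j = 1) \<Longrightarrow> b\<^sub>o (Old y) (Ray x j) = 0"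
    using mg6 by blast
  show "y \<in> X \<Longrightarrow> y \<noteq> v \<Longrightarrow> x \<in> K \<Longrightarrow> y \<noteq> x \<Longrightarrow> b\<^sub>o (Old y) (Cap x) = 0"
    using mg7 by blast
  show "x \<in> N \<Longrightarrow> y \<in> N \<Longrightarrow> 1 \<le> j \<Longrightarrow> 1 \<le> k \<Longrightarrow> x \<noteq> y \<Longrightarrow> b\<^sub>o (Ray x j) (Ray y k) = 0"
    using mg8 by blast
  show "x \<in> N \<Longrightarrow> 1 \<le> j \<Longrightarrow> y \<in> K \<Longrightarrow> b\<^sub>o (Ray x j) (Cap y) = 0" using mg9 by blast
  show "x \<in> K \<Longrightarrow> y \<in> K \<Longrightarrow> b\<^sub>o (Cap x) (Cap y) = 0" using mg10 by blast
  show "x \<in> X \<Longrightarrow> x \<noteq> v \<Longrightarrow> m\<^sub>o (Old x) = m x" using mg11 by blast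
  show "p \<in> Y \<Longrightarrow> 0 < m\<^sub>o p" using mg12 by blast
qed

section \<open>Row sums of the modified edge weight\<close>

lemma Y_cases [consumes 1, case_names Old Ray Cap]:
  assumes "p \<in> Y"
  obtains x where "p = Old x" "x \<in> X" "x \<noteq> v"
  | x n where "p = Ray x n" "x \<in> N" "1 \<le> n"
  | x where "p = Cap x" "x \<in> K"
  using assms by (cases p) auto

text \<open>An old vertex keeps its row without \<open>v\<close> and gains at most one new neighbor.
  The function \<open>a\<close> is arbitrary, so the same computation serves for summability of rows
  and for the harmonic equation.\<close>

lemma row_Old:
  assumes y: "y \<in> X" "y \<noteq> v" and s: "((\<lambda>x. b y x * a (Old x)) has_sum s) (X - {v})"
  shows "((\<lambda>q. b\<^sub>o (Old y) q * a q) has_sum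
    (s + ((if y \<in> N then b\<^sub>o (Old y) (Ray y 1) * a (Ray y 1) else 0) +
      (if y \<in> K then b\<^sub>o (Old y) (Cap y) * a (Cap y) else 0)))) Y"
proof -
  let ?h = "\<lambda>q. b\<^sub>o (Old y) q * a q"
  let ?O = "Old ` (X - {v})"
  let ?B = "(if y \<in> N then {Ray y 1} else {}) \<union> (if y \<in> K then {Cap y} else {})"
  have "((\<lambda>x. ?h (Old x)) has_sum s) (X - {v})"
    using s by (rule has_sum_cong[THEN iffD1, rotated]) (use y bo_Old_Old in auto)
  then have 1: "(?h has_sum s) ?O"
    using has_sum_reindex[of Old "X - {v}" ?h s] by (simp add: o_def inj_on_def)
  have zero: "b\<^sub>o (Old y) q = 0" if "q \<in> Y - ?O - ?B" for q
  proof -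
    have "q \<in> Y" using that by simp
    then show ?thesis
    proof (cases rule: Y_cases)
      case (Ray x n)
      then show ?thesis using that bo_Old_Ray_zero[OF y, of x n] by (auto split: if_splits)
    next
      case (Cap x)
      then show ?thesis using that bo_Old_Cap_zero[OF y, of x] by (auto split: if_splits)
    qed (use that in auto)
  qed
  have "(?h has_sum sum ?h ?B) (Y - ?O)"
  proof (rule has_sum_finite_neutralI)
    show "?B \<subseteq> Y - ?O" by auto
  qed (use zero in auto)
  from has_sum_Un_disjoint[OF 1 this]
  have "(?h has_sum (s + sum ?h ?B)) (?O \<union> (Y - ?O))" by simp
  moreover have "?O \<union> (Y - ?O) = Y" by auto
  moreover have "sum ?h ?B = (if y \<in> N then b\<^sub>o (Old y) (Ray y 1) * a (Ray y 1) else 0) +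
      (if y \<in> K then b\<^sub>o (Old y) (Cap y) * a (Cap y) else 0)"
    using N_K_disjoint by auto
  ultimately show ?thesis by simp
qed

text \<open>Ray numbering starts at \<open>1\<close>, so the vertex preceding \<open>Ray x 1\<close>
  is \<open>Old x\<close> and not \<open>Ray x 0\<close>.\<close>

definition pred_vertex :: "'a \<Rightarrow> nat \<Rightarrow> 'a vertex" where
  "pred_vertex x n = (if n = 1 then Old x else Ray x (n - 1))"

lemma row_Ray:
  assumes x: "x \<in> N" and n: "1 \<le> n"
  shows "((\<lambda>q. b\<^sub>o (Ray x n) q * a q) has_sum
    (b\<^sub>o (Ray x n) (pred_vertex x n) * a (pred_vertex x n) +
     b\<^sub>o (Ray x n) (Ray x (n + 1)) * a (Ray x (n + 1)))) Y"
proof -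
  let ?B = "{pred_vertex x n, Ray x (n + 1)}"
  have "b\<^sub>o (Ray x n) q = 0" if q: "q \<in> Y - ?B" for q
  proof -
    have "q \<in> Y" using q by simp
    then show ?thesis
    proof (cases rule: Y_cases)
      case (Old y)
      then show ?thesis
        using q x n bo_Old_Ray_zero[of y x n] bo_sym[of "Ray x n" "Old y"]
        by (auto simp: pred_vertex_def split: if_splits)
    next
      case (Ray y k)
      show ?thesis
      proof (cases "x = y")
        case True
        have "\<bar>int n - int k\<bar> \<noteq> 1"
          using q Ray n True by (auto simp: pred_vertex_def split: if_splits)
        then have "\<not> 0 < b\<^sub>o (Ray x n) (Ray x k)" using bo_Ray_Ray_iff[OF x n, of k] Ray by simp
        then show ?thesis using bo_nonneg[of "Ray x n" "Ray x k"] Ray x n True by simp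
      next
        case False
        then show ?thesis using bo_Ray_Ray_zero[of x y n k] Ray x n by simp
      qed
    next
      case (Cap y)
      then show ?thesis using bo_Ray_Cap[OF x n] by simp
    qed
  qed
  then show ?thesis
    by (intro has_sum_finite_neutralI[of ?B]) (use x n N_subset[OF x] in \<open>auto simp: pred_vertex_def\<close>)
qed

lemma row_Cap:
  assumes x: "x \<in> K"
  shows "((\<lambda>q. b\<^sub>o (Cap x) q * a q) has_sum (b\<^sub>o (Cap x) (Old x) * a (Old x))) Y"
proof (rule has_sum_finite_neutralI[of "{Old x}"])
  fix q assume q: "q \<in> Y - {Old x}"
  then have "q \<in> Y" by simp
  then have "b\<^sub>o (Cap x) q = 0"
  proof (cases rule: Y_cases)
    case (Old y)
    then show ?thesis using q x bo_Old_Cap_zero[of y x] bo_sym[of "Cap x" "Old y"] by auto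
  next
    case (Ray y k)
    then show ?thesis using x bo_Ray_Cap[of y k x] bo_sym[of "Cap x" "Ray y k"] by auto
  qed (use x bo_Cap_Cap in auto)
  then show "b\<^sub>o (Cap x) q * a q = 0" by simp
qed (use K_subset[OF x] in auto)

lemma has_sum_remove_v:
  fixes h :: "'a \<Rightarrow> real"
  assumes "(h has_sum s) X"
  shows "(h has_sum (s - h v)) (X - {v})"
proof -
  have "h summable_on (X - {v})"
    by (rule summable_on_subset_banach[OF has_sum_imp_summable[OF assms]]) auto
  then have 1: "(h has_sum infsum h (X - {v})) (X - {v})" by (rule has_sum_infsum)
  have "(h has_sum (h v + infsum h (X - {v}))) (insert v (X - {v}))"
    by (rule has_sum_insert[OF _ 1]) simp
  then have "h v + infsum h (X - {v}) = s"
    using has_sum_unique assms v by (metis insert_Diff)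
  then have "s - h v = infsum h (X - {v})" by simp
  then show ?thesis using 1 by simp
qed

lemma row_summable:
  assumes p: "p \<in> Y" and a: "(\<lambda>x. a (Old x)) \<in> formal_domain X b"
  shows "(\<lambda>q. b\<^sub>o p q * \<bar>a q\<bar>) summable_on Y"
  using p
proof (cases rule: Y_cases)
  case (Old y)
  have "(\<lambda>x. b y x * \<bar>a (Old x)\<bar>) summable_on X"
    using a Old by (auto simp: formal_domain_def)
  then show ?thesis
    unfolding Old(1)
    by (rule has_sum_imp_summable[OF row_Old[OF Old(2,3) has_sum_remove_v[OF has_sum_infsum]]])
next
  case (Ray x n)
  show ?thesis unfolding Ray(1) by (rule has_sum_imp_summable[OF row_Ray[OF Ray(2,3)]])
next
  case (Cap x)
  show ?thesis unfolding Cap(1) by (rule has_sum_imp_summable[OF row_Cap[OF Cap(2)]])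
qed

sublocale new: wgraph Y b\<^sub>o m\<^sub>o
proof
  have "countable Y"
  proof -
    have "Y \<subseteq> Old ` X \<union> (\<lambda>(x, n). Ray x n) ` (N \<times> (UNIV :: nat set)) \<union> Cap ` K"
      by (auto simp: modified_vertices_def)
    moreover have "countable (Old ` X \<union> (\<lambda>(x, n). Ray x n) ` (N \<times> (UNIV :: nat set)) \<union> Cap ` K)"
      using countable_V finite_N finite_K by (intro countable_Un countable_image countable_SIGMA) (auto intro: countable_finite)
    ultimately show ?thesis by (rule countable_subset)
  qed
  moreover have "infinite Y"
  proof -
    have "infinite (Old ` (X - {v}))"
      using infinite_V by (subst finite_image_iff) (auto simp: inj_on_def)
    then show ?thesis by (rule infinite_super[rotated]) auto
  qed
  moreover have "b\<^sub>o p p = 0" if "p \<in> Y" for p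
    using that
  proof (cases rule: Y_cases)
    case (Ray x n)
    then have "\<not> 0 < b\<^sub>o p p" using bo_Ray_Ray_iff[of x n n] by simp
    then show ?thesis using bo_nonneg[OF that that] by simp
  qed (use bo_Old_Old b_refl bo_Cap_Cap in auto)
  moreover have "b\<^sub>o p summable_on Y" if "p \<in> Y" for p
  proof -
    have "(\<lambda>q. b\<^sub>o p q * \<bar>1\<bar>) summable_on Y"
      by (rule row_summable[OF that]) (use b_summable in \<open>auto simp: formal_domain_def\<close>)
    then show ?thesis by simp
  qed
  ultimately show "weighted_graph Y b\<^sub>o m\<^sub>o"
    unfolding weighted_graph_def using mo_pos bo_nonneg bo_sym by blast
qed

text \<open>The flux into the ray at \<open>x\<close> replaces the flux \<open>b x v * (g x - g v)\<close> from \<open>x\<close> to the removed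
  vertex; it is constant along the ray.\<close>

lemma harmonic_extension:
  obtains f where "f \<in> ell2 Y m\<^sub>o" "harmonic Y b\<^sub>o m\<^sub>o f" "N \<noteq> {}"
    "\<And>x. x \<in> N \<Longrightarrow> f (Ray x 1) \<noteq> f (Ray x 2)"
proof -
  obtain g where g: "g \<in> ell2 X m" "g \<in> formal_domain X b"
    and Lg: "\<And>x. x \<in> X \<Longrightarrow> Lap g x = delta v x / m v"
    and green: "\<And>x. x \<in> X \<Longrightarrow> green X b m v x = g x"
    by (rule green_function[OF v], rule that)
  have N: "g x \<noteq> g v" if "x \<in> N" for x
  proof -
    have "green X b m v x \<noteq> green X b m v v" using that by (simp add: ray_neighbors_def)
    then show ?thesis using N_subset[OF that] by (simp add: green v)
  qed
  have K: "g x = g v" if "x \<in> K" for x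
  proof -
    have "green X b m v x = green X b m v v" using that by (simp add: cap_neighbors_def)
    then show ?thesis using K_subset[OF that] by (simp add: green v)
  qed
  \<comment> \<open>This vanishes on \<open>K\<close> and at every old vertex that is not a neighbor
    of \<open>v\<close>, so all old vertices obey the same balance equation.\<close>
  define \<kappa> where "\<kappa> x = b x v * (g x - g v)" for x
  define c where "c x = b\<^sub>o (Old x) (Ray x 1)" for x
  define r where "r x n = b\<^sub>o (Ray x n) (Ray x (n + 1))" for x n
  define s where "s x n = (\<Sum>i=1..n. 1 / r x i)" for x n
  \<comment> \<open>Constant flux \<open>\<kappa> x\<close> means a drop of
    \<open>\<kappa> x / c x\<close> on the first edge and of \<open>\<kappa> x / r x i\<close> on
    the edge after \<open>Ray x i\<close>. The vertex \<open>Ray x n\<close> lies behind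
    \<open>n - 1\<close> edges of the second kind, hence \<open>s x (n - 1)\<close>. The default
    \<open>0\<close> off \<open>Y\<close> is what \<open>ell2\<close> asks for.\<close>
  define f where "f p = (if p \<in> Y then case p of Old x \<Rightarrow> g x
    | Ray x n \<Rightarrow> g x - \<kappa> x * (1 / c x + s x (n - 1)) | Cap x \<Rightarrow> g x else 0)" for p
  have f_Old: "f (Old x) = g x" if "x \<in> X" "x \<noteq> v" for x using that by (simp add: f_def)
  have f_Ray: "f (Ray x n) = g x - \<kappa> x * (1 / c x + s x (n - 1))" if "x \<in> N" "1 \<le> n" for x n
    using that by (simp add: f_def)
  have f_Cap: "f (Cap x) = g x" if "x \<in> K" for x using that by (simp add: f_def)
  have c: "0 < c x" if "x \<in> N" for x using bo_Old_Ray_pos[OF that] by (simp add: c_def)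
  have r: "0 < r x n" if "x \<in> N" "1 \<le> n" for x n
    using bo_Ray_Ray_iff[OF that, of "n + 1"] by (simp add: r_def)
  have \<kappa>: "\<kappa> x \<noteq> 0" if "x \<in> N" for x
    using N_subset[OF that] N[OF that] b_sym[OF v, of x] by (simp add: \<kappa>_def)
  have s_Suc: "s x (Suc n) = s x n + 1 / r x (Suc n)" for x n by (simp add: s_def)
  have flux: "r x n * (f (Ray x n) - f (Ray x (n + 1))) = \<kappa> x" if "x \<in> N" "1 \<le> n" for x n
  proof -
    obtain k where k: "n = Suc k" using \<open>1 \<le> n\<close> by (cases n) auto
    have "f (Ray x n) - f (Ray x (n + 1)) = \<kappa> x / r x n"
      using that by (simp add: f_Ray s_Suc k algebra_simps)
    then show ?thesis using r[OF that] by simp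
  qed
  have flux0: "c x * (f (Old x) - f (Ray x 1)) = \<kappa> x" if "x \<in> N" for x
    using c[OF that] N_subset[OF that] that by (simp add: f_Old f_Ray s_def)
  have nonempty: "N \<noteq> {}"
  proof
    assume empty: "N = {}"
    have "((\<lambda>y. b v y * (g v - g y)) has_sum 0) X"
    proof (rule has_sum_0)
      fix y assume y: "y \<in> X"
      show "b v y * (g v - g y) = 0"
      proof (cases "0 < b v y")
        case True
        then have "y \<in> K" using N_K_cover[OF y] empty by simp
        then show ?thesis using K by simp
      qed (use b_nonneg[OF v y] in simp)
    qed
    from has_sum_unique[OF this has_sum_Lap(2)[OF g(2) v]] Lg[OF v] m_pos[OF v]
    show False by (simp add: delta_def)
  qed
  have ray: "f (Ray x 1) \<noteq> f (Ray x 2)" if "x \<in> N" for x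
    using flux[OF that, of 1] \<kappa>[OF that] by (auto simp: numeral_2_eq_2)
  have harm: "harmonic Y b\<^sub>o m\<^sub>o f"
  proof -
    have dom: "f \<in> formal_domain Y b\<^sub>o"
      unfolding formal_domain_def
    proof (intro CollectI ballI)
      fix p assume "p \<in> Y"
      have "(\<lambda>x. f (Old x)) \<in> formal_domain X b"
        unfolding formal_domain_def
      proof (intro CollectI ballI)
        fix x assume "x \<in> X"
        then have "(\<lambda>y. b x y * \<bar>g y\<bar>) summable_on X" using g(2) by (simp add: formal_domain_def)
        then show "(\<lambda>y. b x y * \<bar>f (Old y)\<bar>) summable_on X"
          by (rule summable_on_comparison_test) (use b_nonneg \<open>x \<in> X\<close> in \<open>auto simp: f_def\<close>)
      qed
      then show "(\<lambda>q. b\<^sub>o p q * \<bar>f q\<bar>) summable_on Y" by (rule row_summable[OF \<open>p \<in> Y\<close>])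
    qed
    have "((\<lambda>q. b\<^sub>o p q * (f p - f q)) has_sum 0) Y" if "p \<in> Y" for p
      using that
    proof (cases rule: Y_cases)
      case (Old y)
      \<comment> \<open>\<open>Lap g\<close> vanishes at \<open>y\<close>, so deleting the term of
        \<open>v\<close> from the row leaves the deficit \<open>- \<kappa> y\<close>, which the edge
        to a new vertex must balance.\<close>
      have "((\<lambda>x. b y x * (g y - g x)) has_sum (0 - \<kappa> y)) (X - {v})"
        using has_sum_remove_v[OF has_sum_Lap(2)[OF g(2) Old(2)]] Old Lg[OF Old(2)]
        by (simp add: \<kappa>_def delta_def)
      then have "((\<lambda>x. b y x * (f (Old y) - f (Old x))) has_sum (0 - \<kappa> y)) (X - {v})"
        by (rule has_sum_cong[THEN iffD1, rotated]) (use Old in \<open>auto simp: f_Old\<close>)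
      from row_Old[OF Old(2,3), of "\<lambda>q. f (Old y) - f q", OF this]
      have "((\<lambda>q. b\<^sub>o p q * (f p - f q)) has_sum (- \<kappa> y +
        ((if y \<in> N then c y * (f (Old y) - f (Ray y 1)) else 0) +
        (if y \<in> K then b\<^sub>o (Old y) (Cap y) * (f (Old y) - f (Cap y)) else 0)))) Y"
        by (simp only: Old(1) c_def diff_0)
      moreover have "- \<kappa> y + ((if y \<in> N then c y * (f (Old y) - f (Ray y 1)) else 0) +
        (if y \<in> K then b\<^sub>o (Old y) (Cap y) * (f (Old y) - f (Cap y)) else 0)) = 0"
      proof -
        consider "y \<in> N" | "y \<in> K" | "\<not> 0 < b v y" using N_K_cover[OF Old(2)] by blast
        then show ?thesis
        proof cases
          case 1
          then show ?thesis using flux0[OF 1] N_K_disjoint[OF 1] by simp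
        next
          case 2
          then have "y \<notin> N" using N_K_disjoint by blast
          then show ?thesis using 2 Old K[OF 2] by (simp add: f_Old f_Cap \<kappa>_def)
        next
          case 3
          then have "y \<notin> N" "y \<notin> K" using N_subset K_subset by blast+
          moreover have "b y v = 0" using 3 b_nonneg[OF v Old(2)] b_sym[OF v Old(2)] by simp
          ultimately show ?thesis by (simp add: \<kappa>_def)
        qed
      qed
      ultimately show ?thesis by simp
    next
      case (Ray x n)
      have x: "x \<in> X" "x \<noteq> v" using N_subset[OF Ray(2)] by auto
      have "b\<^sub>o (Ray x n) (pred_vertex x n) * (f (Ray x n) - f (pred_vertex x n)) = - \<kappa> x"
      proof (cases "n = 1")
        case True
        have "b\<^sub>o (Ray x 1) (Old x) = c x"
          unfolding c_def using x Ray by (intro bo_sym) auto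
        then have "b\<^sub>o (Ray x 1) (Old x) * (f (Ray x 1) - f (Old x)) = - (c x * (f (Old x) - f (Ray x 1)))"
          by (simp add: algebra_simps)
        then show ?thesis using flux0[OF Ray(2)] True by (simp add: pred_vertex_def)
      next
        case False
        then have n: "1 \<le> n - 1" "n - 1 + 1 = n" using Ray(3) by auto
        have "b\<^sub>o (Ray x n) (Ray x (n - 1)) = r x (n - 1)"
          unfolding r_def n(2) using Ray n by (intro bo_sym) auto
        then have "b\<^sub>o (Ray x n) (Ray x (n - 1)) * (f (Ray x n) - f (Ray x (n - 1)))
            = - (r x (n - 1) * (f (Ray x (n - 1)) - f (Ray x n)))"
          by (simp add: algebra_simps)
        then show ?thesis using flux[OF Ray(2) n(1)] False unfolding n(2) by (simp add: pred_vertex_def)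
      qed
      moreover have "b\<^sub>o (Ray x n) (Ray x (n + 1)) * (f (Ray x n) - f (Ray x (n + 1))) = \<kappa> x"
        using flux[OF Ray(2,3)] by (simp only: r_def)
      ultimately show ?thesis
        using row_Ray[OF Ray(2,3), of "\<lambda>q. f p - f q"] by (simp only: Ray(1) add.left_inverse)
    next
      case (Cap x)
      have "f (Cap x) - f (Old x) = 0" using Cap K_subset[OF Cap(2)] by (simp add: f_Cap f_Old)
      then show ?thesis
        using row_Cap[OF Cap(2), of "\<lambda>q. f p - f q"] by (simp only: Cap(1) mult_zero_right)
    qed
    then have "formal_laplacian Y b\<^sub>o m\<^sub>o f p = 0" if "p \<in> Y" for p
      using that by (simp add: formal_laplacian_def infsumI)
    then show ?thesis using dom by (simp add: harmonic_def)
  qed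
  have "f \<in> ell2 Y m\<^sub>o"
  proof -
    let ?h = "\<lambda>p. (f p)\<^sup>2 * m\<^sub>o p"
    have 1: "?h summable_on Old ` (X - {v})"
    proof -
      have "(\<lambda>x. (g x)\<^sup>2 * m x) summable_on (X - {v})"
        by (rule summable_on_subset_banach[OF ell2D(2)[OF g(1)]]) auto
      then have "(?h \<circ> Old) summable_on (X - {v})"
        by (rule summable_on_cong[THEN iffD1, rotated]) (auto simp: f_Old mo_Old)
      then show ?thesis by (subst summable_on_reindex) (auto simp: inj_on_def)
    qed
    have ray: "?h summable_on Ray x ` {1..}" if x: "x \<in> N" for x
    proof -
      \<comment> \<open>The summability hypothesis controls \<open>s\<close>, while the values on
        the ray also contain the constant \<open>g x - \<kappa> x / c x\<close>. Since
        \<open>1 \<le> r x 1 * s x n\<close>, that constant is absorbed at the price of the factor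
        \<open>r x 1\<close>.\<close>
      define C where "C = (\<bar>g x - \<kappa> x / c x\<bar> * r x 1 + \<bar>\<kappa> x\<bar>)\<^sup>2"
      have "(\<lambda>n. (s x n)\<^sup>2 * m\<^sub>o (Ray x (n + 1))) summable_on {1..}"
        using ray_summable[OF x] by (simp only: s_def r_def)
      then have "(\<lambda>n. C * ((s x n)\<^sup>2 * m\<^sub>o (Ray x (n + 1)))) summable_on {1..}"
        by (rule summable_on_cmult_right)
      then have "(\<lambda>n. ?h (Ray x (n + 1))) summable_on {1..}"
      proof (rule summable_on_comparison_test)
        fix n :: nat assume n: "n \<in> {1..}"
        have mo: "0 < m\<^sub>o (Ray x (n + 1))" using x by (intro mo_pos) auto
        show "0 \<le> ?h (Ray x (n + 1))" using mo by simp
        have "1 / r x 1 \<le> s x n"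
        proof -
          have "(\<Sum>i\<in>{1}. 1 / r x i) \<le> s x n"
            unfolding s_def using n r[OF x] by (intro sum_mono2) (auto simp: less_imp_le)
          then show ?thesis by simp
        qed
        then have s1: "1 \<le> r x 1 * s x n" using r[OF x, of 1] by (simp add: field_simps)
        then have s0: "0 \<le> s x n" 
          unfolding s_def using r[OF x] by (intro sum_nonneg) (auto simp: less_imp_le)
        have "\<bar>f (Ray x (n + 1))\<bar> = \<bar>(g x - \<kappa> x / c x) - \<kappa> x * s x n\<bar>"
          using x by (simp add: f_Ray algebra_simps)
        also have "\<dots> \<le> \<bar>g x - \<kappa> x / c x\<bar> * 1 + \<bar>\<kappa> x\<bar> * s x n"
          using s0 abs_triangle_ineq4[of "g x - \<kappa> x / c x" "\<kappa> x * s x n"] by (simp add: abs_mult)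
        also have "\<dots> \<le> \<bar>g x - \<kappa> x / c x\<bar> * (r x 1 * s x n) + \<bar>\<kappa> x\<bar> * s x n"
          using s1 by (intro add_right_mono mult_left_mono) auto
        also have "\<dots> = (\<bar>g x - \<kappa> x / c x\<bar> * r x 1 + \<bar>\<kappa> x\<bar>) * s x n"
          by (simp add: algebra_simps)
        finally have "\<bar>f (Ray x (n + 1))\<bar>\<^sup>2 \<le> ((\<bar>g x - \<kappa> x / c x\<bar> * r x 1 + \<bar>\<kappa> x\<bar>) * s x n)\<^sup>2"
          by (intro power_mono) auto
        then have "(f (Ray x (n + 1)))\<^sup>2 \<le> C * (s x n)\<^sup>2"
          by (simp only: C_def power_mult_distrib power2_abs)
        then have "?h (Ray x (n + 1)) \<le> (C * (s x n)\<^sup>2) * m\<^sub>o (Ray x (n + 1))"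
          using mo by (intro mult_right_mono) auto
        then show "?h (Ray x (n + 1)) \<le> C * ((s x n)\<^sup>2 * m\<^sub>o (Ray x (n + 1)))"
          by (simp only: mult.assoc)
      qed
      then have "?h summable_on (\<lambda>n. Ray x (n + 1)) ` {1..}"
        by (subst summable_on_reindex) (auto simp: inj_on_def o_def)
      \<comment> \<open>The hypothesis concerns the measure from \<open>Ray x 2\<close> on; the
        first ray vertex is added separately.\<close>
      then have "?h summable_on insert (Ray x 1) ((\<lambda>n. Ray x (n + 1)) ` {1..})"
        by (simp only: summable_on_insert_iff)
      moreover have "insert (Ray x 1) ((\<lambda>n. Ray x (n + 1)) ` {1..}) = Ray x ` {1..}"
      proof (intro equalityI subsetI)
        fix p assume "p \<in> Ray x ` {1..}"
        then obtain k where "p = Ray x k" "1 \<le> k" by auto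
        then show "p \<in> insert (Ray x 1) ((\<lambda>n. Ray x (n + 1)) ` {1..})"
          by (cases "k = 1") (auto intro!: image_eqI[of _ _ "k - 1"])
      qed auto
      ultimately show ?thesis by simp
    qed
    have "?h summable_on (\<Union>x\<in>M. Ray x ` {1..})" if "finite M" "M \<subseteq> N" for M
      using that by (induction M rule: finite_induct) (auto intro!: summable_on_union ray[unfolded One_nat_def])
    note rays = this[OF finite_N order_refl]
    have "?h summable_on (Old ` (X - {v}) \<union> (\<Union>x\<in>N. Ray x ` {1..}) \<union> Cap ` K)"
      by (rule summable_on_union[OF summable_on_union[OF 1 rays]
            summable_on_finite[OF finite_imageI[OF finite_K]]])
    moreover have "Old ` (X - {v}) \<union> (\<Union>x\<in>N. Ray x ` {1..}) \<union> Cap ` K = Y"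
      by (auto simp: modified_vertices_def)
    ultimately show ?thesis by (simp add: ell2_def f_def)
  qed
  then show ?thesis by (rule that[OF _ harm nonempty ray])
qed

text \<open>The component of \<open>Ray x 1\<close> contains the whole ray and is therefore
  infinite, whatever the removal of \<open>v\<close> does to the rest of the graph. The edge from
  \<open>Ray x 1\<close> to \<open>Ray x 2\<close> lies in it and carries a nonzero flux.\<close>

theorem nonconstant_harmonic:
  obtains f Z x y where "f \<in> ell2 Y m\<^sub>o" "harmonic Y b\<^sub>o m\<^sub>o f" "graph_component Y b\<^sub>o Z" "infinite Z"
    "x \<in> Z" "y \<in> Z" "0 < b\<^sub>o x y" "f x \<noteq> f y"
proof -
  obtain f where f: "f \<in> ell2 Y m\<^sub>o" "harmonic Y b\<^sub>o m\<^sub>o f" "N \<noteq> {}"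
    and ray: "\<And>x. x \<in> N \<Longrightarrow> f (Ray x 1) \<noteq> f (Ray x 2)"
    by (rule harmonic_extension, rule that)
  then obtain x where x: "x \<in> N" by blast
  let ?R = "\<lambda>u w. u \<in> Y \<and> w \<in> Y \<and> b\<^sub>o u w > 0"
  define Z where "Z = {q \<in> Y. ?R\<^sup>*\<^sup>* (Ray x 1) q}"
  have edge: "0 < b\<^sub>o (Ray x (Suc n)) (Ray x (Suc (Suc n)))" for n
    using bo_Ray_Ray_iff[OF x, of "Suc n" "Suc (Suc n)"] by simp
  have reach: "?R\<^sup>*\<^sup>* (Ray x 1) (Ray x (Suc n))" for n
  proof (induction n)
    case (Suc n)
    have "?R (Ray x (Suc n)) (Ray x (Suc (Suc n)))" using edge x by simp
    with Suc show ?case by (rule rtranclp.rtrancl_into_rtrancl)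
  qed simp
  have in_Z: "Ray x (Suc n) \<in> Z" for n using reach x by (simp add: Z_def)
  have "infinite Z"
  proof
    assume "finite Z"
    then have "finite (range (\<lambda>n. Ray x (Suc n)))" using in_Z by (auto intro: finite_subset)
    then show False using finite_imageD[of "\<lambda>n. Ray x (Suc n)" UNIV] by (auto simp: inj_on_def)
  qed
  moreover have "graph_component Y b\<^sub>o Z"
    unfolding Z_def by (rule new.component_of) (use x in simp)
  ultimately show ?thesis
    using that[OF f(1,2), of Z "Ray x 1" "Ray x 2"] in_Z[of 0] in_Z[of 1] edge[of 0] ray[OF x]
    by (simp add: numeral_2_eq_2)
qed

end

theorem theorem17:
  fixes X :: "'a set" and b :: "'a \<Rightarrow> 'a \<Rightarrow> real" and m :: "'a \<Rightarrow> real" and v :: 'a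
    and b\<^sub>o :: "'a vertex \<Rightarrow> 'a vertex \<Rightarrow> real" and m\<^sub>o :: "'a vertex \<Rightarrow> real"
  defines "X\<^sub>o \<equiv> modified_vertices X b m v"
  assumes "weighted_graph X b m"
    and "graph_connected X b"
    and "formal_laplacian X b m ` fin_supp X \<subseteq> ell2 X m"
    and "spectral_bottom X b m > 0"
    and "v \<in> X"
    and "finite (neighbors X b v)"
    and "modified_graph X b m v b\<^sub>o m\<^sub>o"
    and "\<And>x. x \<in> ray_neighbors X b m v \<Longrightarrow>
      (\<lambda>r. (\<Sum>n=1..r. 1 / b\<^sub>o (Ray x n) (Ray x (n + 1)))\<^sup>2 * m\<^sub>o (Ray x (r + 1))) summable_on {1..}"
  shows "(\<exists>f W. f \<in> ell2 X\<^sub>o m\<^sub>o \<and> harmonic X\<^sub>o b\<^sub>o m\<^sub>o f \<and>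
            graph_component X\<^sub>o b\<^sub>o W \<and> infinite W \<and> (\<exists>x\<in>W. \<exists>y\<in>W. f x \<noteq> f y)) \<and>
         \<not> ell2_Liouville X\<^sub>o b\<^sub>o m\<^sub>o \<and>
         \<not> essentially_self_adjoint X\<^sub>o m\<^sub>o (minimal_laplacian X\<^sub>o b\<^sub>o m\<^sub>o)"
proof -
  interpret modified X b m v b\<^sub>o m\<^sub>o
    by unfold_locales (fact assms)+
  obtain f W x y where f: "f \<in> ell2 X\<^sub>o m\<^sub>o" "harmonic X\<^sub>o b\<^sub>o m\<^sub>o f"
    and W: "graph_component X\<^sub>o b\<^sub>o W" "infinite W"
    and xy: "x \<in> W" "y \<in> W" "0 < b\<^sub>o x y" "f x \<noteq> f y"
    by (rule nonconstant_harmonic[folded X\<^sub>o_def], rule that)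
  have in_Xo: "x \<in> X\<^sub>o" "y \<in> X\<^sub>o" using W(1) xy(1,2) by (auto simp: graph_component_def)
  have "\<not> ell2_Liouville X\<^sub>o b\<^sub>o m\<^sub>o"
  proof
    assume "ell2_Liouville X\<^sub>o b\<^sub>o m\<^sub>o"
    then obtain k where "\<forall>x\<in>X\<^sub>o. f x = k" using f unfolding ell2_Liouville_def by blast
    then show False using in_Xo xy(4) by simp
  qed
  moreover have "\<not> essentially_self_adjoint X\<^sub>o m\<^sub>o (minimal_laplacian X\<^sub>o b\<^sub>o m\<^sub>o)"
    unfolding X\<^sub>o_def
    by (rule new.not_essentially_self_adjoint[OF f[unfolded X\<^sub>o_def] in_Xo[unfolded X\<^sub>o_def] xy(3,4)])
  moreover have "\<exists>x\<in>W. \<exists>y\<in>W. f x \<noteq> f y" using xy by blast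
  ultimately show ?thesis using f W by (intro conjI exI[of _ f] exI[of _ W])
qed

end
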